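(* Let $\mathrm{pen}:\mathcal M_n\to\mathbb R$ be a (possibly data-dependent) penalty, let $\widehat M\in\arg\min_{M\in\mathcal M_n}\{P_n(Ks_n(M))+\mathrm{pen}(M)\}$ and $M_*\in\arg\min_{M\in\mathcal M_n}\ell(s_*,s_n(M))$. Suppose that the set of assumptions (SAPP) (listed in the context) holds, and that for some $\delta\in[0,1)$ and $A_p,A_r>0$ there exists an event of probability at least $1-A_pn^{-2}$ on which: for every model $M\in\mathcal M_n$ such that $D_M\ge A_{\mathcal M,+}(\ln n)^3$, $$\left|\mathrm{pen}(M)-2\mathbb E\left[P_n(Ks_M-Ks_n(M))\right]\right|\le\delta\left(\ell(s_*,s_M)+\mathbb E\left[P_n(Ks_M-Ks_n(M))\right]\right),$$ and for every model $M\in\mathcal M_n$ such that $D_M\le A_{\mathcal M,+}(\ln n)^3$, $$|\mathrm{pen}(M)|\le A_r\left(\frac{\ell(s_*,s_M)}{(\ln n)^2}+\frac{(\ln n)^3}{n}\right).$$ Then, for any $\eta\in(0,\beta_+/(1+\beta_+))$, there exist an integer $n_0$ depending only on $\eta,\delta,\beta_+$ and on constants in (SAPP), a positive constant $A_3$ depending only on $c_{\mathcal M}$ and $A_p$, two positive constants $A_4$ and $A_5$ depending only on constants in (SAPP) and on $A_r$, and a sequence $$\theta_n\le\frac{A_4}{(\ln n)^{1/4}}$$ such that for all $n\ge n_0$, with probability at least $1-A_3n^{-2}$, $$D_{\widehat M}\le n^{\eta+1/(1+\beta_+)}$$ and $$\ell\left(s_*,s_n(\widehat M)\right)\le\left(\frac{1+\delta}{1-\delta}+\frac{5\theta_n}{(1-\delta)^2}\right)\ell\left(s_*,s_n(M_*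 )\right)+A_5\frac{(\ln n)^3}{n}.$$ Assume in addition that (Ap) holds: there exist $\beta_-\ge\beta_+>0$ and $C_+,C_->0$ such that $C_-D_M^{-\beta_-}\le\ell(s_*,s_M)\le C_+D_M^{-\beta_+}$ for all $M\in\mathcal M_n$. Then there is an integer $n_0'$, depending only on constants in (SAPP) and on $C_-,\beta_-,\beta_+,\eta,\delta$, such that for all $n\ge n_0'$, with probability at least $1-A_3n^{-2}$, $$A_{\mathcal M,+}(\ln n)^3\le D_{\widehat M}\le n^{\eta+1/(1+\beta_+)}$$ and $$\ell\left(s_*,s_n(\widehat M)\right)\le\left(\frac{1+\delta}{1-\delta}+\frac{5\theta_n}{(1-\delta)^2}\right)\ell\left(s_*,s_n(M_* )\right).$$
   Context: Setting. $\mathcal X=[0,1]$, $\mathrm{Leb}$ is Lebesgue measure on $[0,1]$. $\xi_i=(X_i,Y_i)\in\mathcal X\times\mathbb R$, $i=1,\dots,n$, are i.i.d. with distribution $P$, and $P^X$ is the law of $X_i$. They satisfy $Y_i=s_*(X_i)+\sigma(X_i)\varepsilon_i$ with $s_*\in L_2(P^X)$, $\sigma:\mathcal X\to\mathbb R_+$, $\mathbb E[\varepsilon_i\mid X_i]=0$, $\mathbb E[\varepsilon_i^2\mid X_i]=1$. $P_n=n^{-1}\sum_{i=1}^n\delta_{\xi_i}$ is the empirical measure; for a function $f$ of $(x,y)$, $Pf=P(f)=\int f\,dP$ and $P_nf=P_n(f)=\int f\,dP_n$ (when $f$ depends on the data, $Pf$ integrates over an independent copy only). $\|s\|_2=(\int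 s^2dP^X)^{1/2}$. The least-squares contrast is $Ks=K(s):(x,y)\mapsto (y-s(x))^2$. For each $n$, $\mathcal M_n$ is a finite collection of finite-dimensional linear subspaces (models) $M$ of $L_2(P^X)$, with linear dimension $D_M$. $s_M$ is the $L_2(P^X)$-orthogonal projection of $s_*$ onto $M$, and $s_n(M)\in\arg\min_{s\in M}P_n(Ks)$ is a least-squares estimator on $M$ (possibly non-unique). The excess loss of $s$ is $\ell(s_*,s)=P(Ks-Ks_* )=\|s-s_*\|_2^2$. Piecewise polynomials. $M$ is a model of piecewise polynomial functions with respect to a finite partition $\mathcal P_M$ of $[0,1]$, of degrees not larger than $r_M\in\mathbb N$, if $M=\mathrm{Span}\{x\mapsto x^j\mathbf 1_I(x): I\in\mathcal P_M,\ 0\le j\le r_M\}$. Assumptions (SAPP). Every $M\in\mathcal M_n$ is a model of piecewise polynomial functions and: (P1) there are constants $c_{\mathcal M},\alpha_{\mathcal M}>0$ with $\mathrm{Card}(\mathcal M_n)\le c_{\mathcal M}n^{\alpha_{\mathcal M}}$. (P2) there is a constant $A_{\mathcal M,+}>0$ with $1\le D_M\le A_{\mathcal M,+}n(\ln n)^{-2}\le n$ for every $M\in\mathcal M_n$. (P3) there are constants $c_{rich}>0$, $A_{rich}>0$ and models $M_0,M_1\in\mathcal M_n$ with $D_{M_0}\in[n^{1/(1+\beta_+)},c_{rich}n^{1/(1+\beta_+)}]$ and $D_{M_1}\ge A_{rich}n(\ln n)^{-2}$, with $\beta_+$ from (Ap$_u$). (Ap$_u$) there are constants $\beta_+>0$,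 $C_+>0$ with $\ell(s_*,s_M)\le C_+D_M^{-\beta_+}$ for all $M\in\mathcal M_n$. (An) there is a constant $\sigma_{\min}>0$ with $\sigma(X_i)\ge\sigma_{\min}$ a.s. (Ab) there is a constant $A>0$ with $|Y_i|\le A<\infty$. (Ad$_{\mathrm{Leb}}$) $P^X$ has a density $f$ with respect to $\mathrm{Leb}$ with $0<c_{\min}\le f(x)\le c_{\max}<\infty$ for all $x\in[0,1]$, for some constants $c_{\min},c_{\max}$. (Aud) there is $r\in\mathbb N^*$ such that for all $M\in\mathcal M_n$, $I\in\mathcal P_M$, $p\in M$: $\deg(p_{|I})\le r$. (Alr) there is a constant $c_{\mathcal M,\mathrm{Leb}}>0$ with $c_{\mathcal M,\mathrm{Leb}}\le|\mathcal P_M|\inf_{I\in\mathcal P_M}\mathrm{Leb}(I)<+\infty$ for all $M\in\mathcal M_n$. The "constants in (SAPP)" are those named in these assumptions; none of them depends on $n$.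
   Formalization: The constant A_5 may also depend on δ and the integer n_0' may also depend on A_r, since the claim is false without these dependencies; the pieces I of the partitions P_M are taken to be intervals, since for arbitrary measurable pieces the claim fails. *)

theory Defs
  imports "HOL-Probability.Probability" "HOL-Library.Function_Algebras"
    "HOL-Computational_Algebra.Polynomial"
begin

interpretation rfun: vector_space "\<lambda>(a::real) (f::real \<Rightarrow> real) x. a * f x"
  by unfold_locales (auto simp: fun_eq_iff algebra_simps)

text \<open>
  Functions on \<open>[0,1]\<close> are total functions on the reals; the piecewise polynomials below vanish
  outside \<open>[0,1]\<close>.  The pieces are intervals (open, closed or half-open), as is implicit in the
  term ``piecewise polynomial''.
\<close>

definition pp_space :: "real set set \<Rightarrow> nat \<Rightarrow> (real \<Rightarrow> real) set" where
  "pp_space Q r = rfun.span {(\<lambda>x. x ^ j * indicator I x) | I j. I \<in> Q \<and> j \<le> r}"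

definition is_pp_model :: "(real \<Rightarrow> real) set \<Rightarrow> real set set \<Rightarrow> bool" where
  "is_pp_model M Q \<longleftrightarrow>
     finite Q \<and> partition_on {0..1} Q \<and> (\<forall>I\<in>Q. is_interval I) \<and> (\<exists>r. M = pp_space Q r)"

text \<open>
  Under the assumptions made below on the partition and on the law of the design, distinct elements
  of a model differ on a set of positive measure, so the following is also the dimension of the
  model as a subspace of \<open>L\<^sub>2\<close>.
\<close>

definition model_dim :: "(real \<Rightarrow> real) set \<Rightarrow> real" where
  "model_dim M = real (rfun.dim M)"

definition contrast :: "(real \<Rightarrow> real) \<Rightarrow> real \<times> real \<Rightarrow> real" where
  "contrast s = (\<lambda>(x, y). (y - s x)\<^sup>2)"

definition emp_mean ::
    "nat \<Rightarrow> (nat \<Rightarrow> 'w \<Rightarrow> real) \<Rightarrow> (nat \<Rightarrow> 'w \<Rightarrow> real) \<Rightarrow> 'w \<Rightarrow> (real \<times> real \<Rightarrow> real) \<Rightarrow> real" where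
  "emp_mean n X Y \<omega> f = (\<Sum>i=1..n. f (X i \<omega>, Y i \<omega>)) / real n"

definition design_law :: "(real \<times> real) measure \<Rightarrow> real measure" where
  "design_law P = distr P borel fst"

definition excess_loss :: "(real \<times> real) measure \<Rightarrow> (real \<Rightarrow> real) \<Rightarrow> (real \<Rightarrow> real) \<Rightarrow> real" where
  "excess_loss P s0 s = (\<integral>z. contrast s z - contrast s0 z \<partial>P)"

definition is_L2_projection ::
    "real measure \<Rightarrow> (real \<Rightarrow> real) set \<Rightarrow> (real \<Rightarrow> real) \<Rightarrow> (real \<Rightarrow> real) \<Rightarrow> bool" where
  "is_L2_projection \<mu> M s p \<longleftrightarrow> p \<in> M \<and> (\<forall>t\<in>M. (\<integral>x. (s x - p x) * t x \<partial>\<mu>) = 0)"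

text \<open>
  The properties to which the next definition is applied involve arbitrary selections of minimizers
  and need not define measurable sets; a property holds with probability at least \<open>p\<close> if it holds on
  some event of probability at least \<open>p\<close>.
\<close>

definition with_prob_ge :: "'w measure \<Rightarrow> real \<Rightarrow> ('w \<Rightarrow> bool) \<Rightarrow> bool" where
  "with_prob_ge \<Omega> p Q \<longleftrightarrow> (\<exists>E\<in>sets \<Omega>. measure \<Omega> E \<ge> p \<and> (\<forall>\<omega>\<in>E. Q \<omega>))"

locale heteroscedastic_regression = prob_space \<Omega>
  for \<Omega> :: "'w measure" +
  fixes n :: nat
    and X Y \<epsilon> :: "nat \<Rightarrow> 'w \<Rightarrow> real"
    and P :: "(real \<times> real) measure"
    and s_star \<sigma> :: "real \<Rightarrow> real"
  assumes indep: "indep_vars (\<lambda>_. borel) (\<lambda>i \<omega>. (X i \<omega>, Y i \<omega>)) {1..n}"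
    and ident_distr: "i \<in> {1..n} \<Longrightarrow> distr \<Omega> borel (\<lambda>\<omega>. (X i \<omega>, Y i \<omega>)) = P"
    and design_range: "i \<in> {1..n} \<Longrightarrow> \<omega> \<in> space \<Omega> \<Longrightarrow> X i \<omega> \<in> {0..1}"
    and s_star_measurable: "s_star \<in> borel_measurable borel"
    and s_star_L2: "integrable (design_law P) (\<lambda>x. (s_star x)\<^sup>2)"
    and \<sigma>_measurable: "\<sigma> \<in> borel_measurable borel"
    and \<sigma>_nonneg: "x \<in> {0..1} \<Longrightarrow> 0 \<le> \<sigma> x"
    and regression: "i \<in> {1..n} \<Longrightarrow> \<omega> \<in> space \<Omega> \<Longrightarrow>
          Y i \<omega> = s_star (X i \<omega>) + \<sigma> (X i \<omega>) * \<epsilon> i \<omega>"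
    and noise_measurable: "i \<in> {1..n} \<Longrightarrow> \<epsilon> i \<in> borel_measurable \<Omega>"
    and noise_L2: "i \<in> {1..n} \<Longrightarrow> integrable \<Omega> (\<lambda>\<omega>. (\<epsilon> i \<omega>)\<^sup>2)"
    and noise_cond_mean: "i \<in> {1..n} \<Longrightarrow>
          AE \<omega> in \<Omega>. real_cond_exp \<Omega> (vimage_algebra (space \<Omega>) (X i) borel) (\<epsilon> i) \<omega> = 0"
    and noise_cond_var: "i \<in> {1..n} \<Longrightarrow>
          AE \<omega> in \<Omega>. real_cond_exp \<Omega> (vimage_algebra (space \<Omega>) (X i) borel)
                        (\<lambda>\<omega>. (\<epsilon> i \<omega>)\<^sup>2) \<omega> = 1"

text \<open>
  \<open>part M\<close> is the partition attached to the model \<open>M\<close>, \<open>sM M\<close> the orthogonal projection of the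
  regression function onto \<open>M\<close>, and \<open>sn \<omega> M\<close> a least-squares estimator on \<open>M\<close>, which is an
  arbitrary choice among the possibly many minimizers.
\<close>

locale least_squares_models = heteroscedastic_regression \<Omega> n X Y \<epsilon> P s_star \<sigma>
  for \<Omega> :: "'w measure" and n X Y \<epsilon> P s_star \<sigma> +
  fixes \<M> :: "(real \<Rightarrow> real) set set"
    and part :: "(real \<Rightarrow> real) set \<Rightarrow> real set set"
    and sM :: "(real \<Rightarrow> real) set \<Rightarrow> real \<Rightarrow> real"
    and sn :: "'w \<Rightarrow> (real \<Rightarrow> real) set \<Rightarrow> real \<Rightarrow> real"
  assumes finite_models: "finite \<M>"
    and pp_models: "M \<in> \<M> \<Longrightarrow> is_pp_model M (part M)"
    and projections: "M \<in> \<M> \<Longrightarrow> is_L2_projection (design_law P) M s_star (sM M)"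
    and estimators: "M \<in> \<M> \<Longrightarrow> \<omega> \<in> space \<Omega> \<Longrightarrow>
          is_arg_min (\<lambda>s. emp_mean n X Y \<omega> (contrast s)) (\<lambda>s. s \<in> M) (sn \<omega> M)"

record sapp_constants =
  c_card :: real
  alpha_card :: real
  A_plus :: real
  c_rich :: real
  A_rich :: real
  beta_plus :: real
  C_plus :: real
  sigma_min :: real
  A_bound :: real
  c_min :: real
  c_max :: real
  r_max :: nat
  c_Leb :: real

text \<open>
  All assumptions concern a single sample size \<open>n\<close>; the constants are collected in \<open>K\<close> so that
  statements uniform in everything except the constants can be expressed.
\<close>

locale SAPP = least_squares_models \<Omega> n X Y \<epsilon> P s_star \<sigma> \<M> part sM sn
  for \<Omega> :: "'w measure" and n X Y \<epsilon> P s_star \<sigma> \<M> part sM sn +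
  fixes K :: sapp_constants
  assumes constants_pos:
      "0 < c_card K" "0 < alpha_card K" "0 < A_plus K" "0 < c_rich K" "0 < A_rich K"
      "0 < beta_plus K" "0 < C_plus K" "0 < sigma_min K" "0 < A_bound K" "0 < c_min K"
      "0 < r_max K" "0 < c_Leb K"
    and P1: "real (card \<M>) \<le> c_card K * real n powr alpha_card K"
    and P2: "M \<in> \<M> \<Longrightarrow>
          1 \<le> model_dim M \<and> model_dim M \<le> A_plus K * real n / (ln (real n))\<^sup>2 \<and>
          A_plus K * real n / (ln (real n))\<^sup>2 \<le> real n"
    and P3: "\<exists>M0\<in>\<M>. \<exists>M1\<in>\<M>.
          real n powr (1 / (1 + beta_plus K)) \<le> model_dim M0 \<and>
          model_dim M0 \<le> c_rich K * real n powr (1 / (1 + beta_plus K)) \<and>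
          A_rich K * real n / (ln (real n))\<^sup>2 \<le> model_dim M1"
    and Apu: "M \<in> \<M> \<Longrightarrow>
          excess_loss P s_star (sM M) \<le> C_plus K * model_dim M powr (- beta_plus K)"
    and An: "i \<in> {1..n} \<Longrightarrow> AE \<omega> in \<Omega>. sigma_min K \<le> \<sigma> (X i \<omega>)"
    and Ab: "i \<in> {1..n} \<Longrightarrow> AE \<omega> in \<Omega>. \<bar>Y i \<omega>\<bar> \<le> A_bound K"
    and AdLeb: "\<exists>f\<in>borel_measurable borel.
          (\<forall>x\<in>{0..1}. c_min K \<le> f x \<and> f x \<le> c_max K) \<and>
          design_law P = density lborel (\<lambda>x. ennreal (f x * indicator {0..1} x))"
    and Aud: "M \<in> \<M> \<Longrightarrow> I \<in> part M \<Longrightarrow> p \<in> M \<Longrightarrow>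
          \<exists>q :: real poly. degree q \<le> r_max K \<and> (\<forall>x\<in>I. p x = poly q x)"
    and Alr: "M \<in> \<M> \<Longrightarrow>
          c_Leb K \<le> real (card (part M)) * (INF I\<in>part M. measure lborel I)"

definition mean_emp_excess ::
    "'w measure \<Rightarrow> nat \<Rightarrow> (nat \<Rightarrow> 'w \<Rightarrow> real) \<Rightarrow> (nat \<Rightarrow> 'w \<Rightarrow> real) \<Rightarrow>
     ((real \<Rightarrow> real) set \<Rightarrow> real \<Rightarrow> real) \<Rightarrow> ('w \<Rightarrow> (real \<Rightarrow> real) set \<Rightarrow> real \<Rightarrow> real) \<Rightarrow>
     (real \<Rightarrow> real) set \<Rightarrow> real" where
  "mean_emp_excess \<Omega> n X Y sM sn M =
     (\<integral>\<omega>. emp_mean n X Y \<omega> (\<lambda>z. contrast (sM M) z - contrast (sn \<omega> M) z) \<partial>\<Omega>)"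

end

theory Submission
  imports Defs "HOL-Real_Asymp.Real_Asymp"
begin

text \<open>
  Each model has an orthonormal basis \<open>\<phi>\<^sub>k\<close> of \<open>L\<^sub>2(P\<^sup>X)\<close>, localized on the pieces, with
  \<open>\<Sum>\<^sub>k |\<phi>\<^sub>k| \<lesssim> \<surd>D\<close>: on an interval the supremum norm of a polynomial is controlled by its \<open>L\<^sub>2\<close> norm
  (Lagrange interpolation at well-separated points where the polynomial does not exceed its quadratic
  mean).  When the empirical Gram matrix is within \<open>\<epsilon>\<close> of the identity, the minimality of the least-squares
  estimator squeezes both \<open>P(K s\<^sub>n - K s\<^sub>M)\<close> and \<open>P\<^sub>n(K s\<^sub>M - K s\<^sub>n)\<close> between \<open>(1 \<plusminus> 8\<epsilon>) \<chi>\<^sup>2\<close>, where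
  \<open>\<chi>\<^sup>2 = \<Sum>\<^sub>k (P\<^sub>n \<zeta>\<phi>\<^sub>k)\<^sup>2\<close> and \<open>\<zeta> = y - s\<^sub>M(x)\<close>.

  No concentration inequality for suprema of empirical processes is needed for \<open>\<chi>\<^sup>2\<close>.  Expanding the square,
  the diagonal is a sum of independent variables, and the off-diagonal part is a martingale with increments
  \<open>\<zeta>\<^sub>j \<Sum>\<^sub>k \<phi>\<^sub>k(X\<^sub>j) T\<^sub>j\<^sub>-\<^sub>1\<^sub>,\<^sub>k\<close>, where \<open>T\<^sub>j\<^sub>,\<^sub>k = \<Sum>\<^sub>i\<^sub>\<le>\<^sub>j \<zeta>\<^sub>i \<phi>\<^sub>k(X\<^sub>i)\<close>.  Truncating \<open>T\<close> at the level of order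
  \<open>\<surd>(n ln n)\<close> that Bernstein's inequality guarantees keeps the increments centered and makes them bounded, so that
  the off-diagonal part is of order \<open>n ln n \<surd>D\<close>, which is small compared with the mean \<open>n D\<close> of the diagonal as
  soon as \<open>D\<close> exceeds a multiple of \<open>(ln n)\<^sup>3\<close>.  Comparing criteria then yields the oracle inequalities; for the
  moderate \<open>n\<close> for which the small-model penalty is not yet negligible, the remainder is made trivial by the size of \<open>A5\<close>.
\<close>

section \<open>Exponential inequalities for martingales of independent samples\<close>

text \<open>Everything is calibrated to relative errors of order \<open>1 / sqrt L\<close>, where
  \<open>L = ln n\<close>. The bound \<open>D \<le> a n / L^2\<close> on the dimensions gives that
  precision for each entry of the Gram matrix, and since a basis function shares its piece with at
  most \<open>r\<close> others, entrywise control already controls the quadratic form without loss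
  in the dimension. The off-diagonal sum, of order \<open>n L sqrt D\<close>, is absorbed through
  \<open>2 L sqrt D \<le> (D + L^3) / sqrt L\<close>; this is where the cube of the logarithm
  enters. Two obstacles shape the rest. The estimator is an arbitrary, possibly non-measurable
  minimizer, so only its empirical risk, an infimum over countably many coefficient vectors, is ever
  integrated. And the threshold \<open>n0\<close> may not depend on \<open>Ar\<close>, although the
  small-model penalty does; the requirements on \<open>n\<close> are therefore divided into a regime
  free of \<open>Ar\<close>, which yields the dimension bound and a crude bound on the loss, and
  another one containing \<open>Ar\<close>, for the oracle inequality. Tail exponents are
  \<open>4 + alpha_card K\<close>: about \<open>n^2\<close> events per model and
  \<open>n^alpha\<close> models leave a failure probability of order \<open>n^(-2)\<close>.\<close>

lemma exp_le_quadratic: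
  fixes u :: real
  assumes "\<bar>u\<bar> \<le> 1"
  shows "exp u \<le> 1 + u + u\<^sup>2"
proof (cases "0 \<le> u")
  case True
  then show ?thesis using assms exp_bound[of u] by simp
next
  case False
  \<comment> \<open>For negative \<open>u\<close>, the Taylor lower bound of \<open>exp v\<close> is
    multiplied by \<open>1 - v + v^2\<close>; the linear terms cancel and the product stays above 1,
    so this factor dominates \<open>exp (- v)\<close>.\<close>
  define v where "v = - u"
  have v: "0 \<le> v" "v \<le> 1" using False assms by (auto simp: v_def)
  have "1 + v + v\<^sup>2 / 2 \<le> exp v" using exp_lower_Taylor_quadratic[OF v(1)] .
  moreover have "1 \<le> (1 - v + v\<^sup>2) * (1 + v + v\<^sup>2 / 2)"
  proof -
    have "(1 - v + v\<^sup>2) * (1 + v + v\<^sup>2 / 2) = 1 + v\<^sup>2 / 2 + v^3/2 + v^4/2"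
      by (simp add: field_simps power2_eq_square power3_eq_cube power4_eq_xxxx)
    then show ?thesis using v by simp
  qed
  moreover have "0 \<le> 1 - v + v\<^sup>2" using v by (simp add: add_nonneg_nonneg)
  ultimately have "1 \<le> (1 - v + v\<^sup>2) * exp v"
    by (meson mult_left_mono order_trans)
  then have "exp (-v) \<le> 1 - v + v\<^sup>2" by (simp add: exp_minus field_simps)
  then show ?thesis by (simp add: v_def)
qed

text \<open>Since \<open>\<mu> * g\<close> stays in \<open>[-1, 1]\<close>, the exponential lies
  below \<open>1 + u + u^2\<close>; the linear term integrates to zero and only the variance
  survives. The bound \<open>b\<close> restricts \<open>\<mu>\<close> but does not appear in the
  exponent.\<close>

lemma (in prob_space) nn_integral_exp_centered_le:
  fixes g :: "'a \<Rightarrow> real"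
  assumes [measurable]: "g \<in> borel_measurable M"
    and bd: "AE z in M. \<bar>g z\<bar> \<le> b" and mean: "expectation g = 0"
    and var: "expectation (\<lambda>z. (g z)\<^sup>2) \<le> v"
    and \<mu>: "\<bar>\<mu>\<bar> * b \<le> 1"
  shows "(\<integral>\<^sup>+ z. ennreal (exp (\<mu> * g z)) \<partial>M) \<le> ennreal (exp (\<mu>\<^sup>2 * v))"
proof -
  have int1: "integrable M g"
    by (rule integrable_const_bound[where B=b]) (use bd in auto)
  have int2: "integrable M (\<lambda>z. (g z)\<^sup>2)"
    by (rule integrable_const_bound[where B="b\<^sup>2"])
      (use bd in \<open>auto elim!: eventually_mono simp: abs_le_square_iff[symmetric]\<close>)
  have "(\<integral>\<^sup>+ z. ennreal (exp (\<mu> * g z)) \<partial>M) \<le> (\<integral>\<^sup>+ z. ennreal (1 + \<mu> * g z + (\<mu> * g z)\<^sup>2) \<partial>M)"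
  proof (rule nn_integral_mono_AE, use bd in eventually_elim)
    case (elim z)
    have "\<bar>\<mu> * g z\<bar> \<le> 1" using elim \<mu> mult_left_mono[OF elim, of "\<bar>\<mu>\<bar>"] by (simp add: abs_mult)
    from exp_le_quadratic[OF this] show ?case by (rule ennreal_leI)
  qed
  also have "\<dots> = ennreal (expectation (\<lambda>z. 1 + \<mu> * g z + (\<mu> * g z)\<^sup>2))"
  proof (rule nn_integral_eq_integral)
    show "integrable M (\<lambda>z. 1 + \<mu> * g z + (\<mu> * g z)\<^sup>2)"
      using int1 int2 by (simp add: power_mult_distrib)
    have "0 \<le> 1 + u + u\<^sup>2" for u :: real
    proof -
      have "1 + u + u\<^sup>2 = (u + 1/2)\<^sup>2 + 3/4" by (simp add: power2_eq_square field_simps)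
      then show ?thesis by simp
    qed
    then show "AE z in M. 0 \<le> 1 + \<mu> * g z + (\<mu> * g z)\<^sup>2" by simp
  qed
  also have "expectation (\<lambda>z. 1 + \<mu> * g z + (\<mu> * g z)\<^sup>2) = 1 + \<mu>\<^sup>2 * expectation (\<lambda>z. (g z)\<^sup>2)"
    using int1 int2 mean by (simp add: power_mult_distrib prob_space)
  also have "\<dots> \<le> 1 + \<mu>\<^sup>2 * v" using var by (simp add: mult_left_mono)
  also have "\<dots> \<le> exp (\<mu>\<^sup>2 * v)" by (rule exp_ge_add_one_self)
  finally show ?thesis by (simp add: ennreal_leI)
qed

text \<open>Induction on \<open>m\<close> by Fubini: integrating out the last coordinate with the
  past frozen costs one factor \<open>exp (\<mu>^2 v)\<close>, uniformly in the past. The hypotheses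
  bear on every past \<open>p\<close>, not almost every one, so no conditional expectation is
  involved; increments built from a truncated past satisfy them.\<close>

lemma nn_integral_exp_martingale_le:
  fixes g :: "nat \<Rightarrow> (nat \<Rightarrow> 'a) \<Rightarrow> 'a \<Rightarrow> real"
  assumes "prob_space P"
    and meas: "\<And>j. (\<lambda>(p, z). g j p z) \<in> borel_measurable (PiM {1..<j} (\<lambda>_. P) \<Otimes>\<^sub>M P)"
    and bd: "\<And>j p. AE z in P. \<bar>g j p z\<bar> \<le> b"
    and mean: "\<And>j p. (\<integral>z. g j p z \<partial>P) = 0"
    and var: "\<And>j p. (\<integral>z. (g j p z)\<^sup>2 \<partial>P) \<le> v"
    and \<mu>: "\<bar>\<mu>\<bar> * b \<le> 1"
  shows "(\<integral>\<^sup>+ z. ennreal (exp (\<mu> * (\<Sum>j=1..m. g j (restrict z {1..<j}) (z j)))) \<partial>PiM {1..m} (\<lambda>_. P))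
           \<le> ennreal (exp (real m * \<mu>\<^sup>2 * v))"
proof (induction m)
  interpret P: prob_space P by fact
  interpret pp: product_sigma_finite "\<lambda>_::nat. P" by standard
  case 0
  show ?case by (simp add: PiM_empty nn_integral_count_space_finite)
next
  interpret P: prob_space P by fact
  interpret pp: product_sigma_finite "\<lambda>_::nat. P" by standard
  case (Suc m)
  let ?S = "\<lambda>m z. \<Sum>j=1..m. g j (restrict z {1..<j}) (z j)"
  have ins: "{1..Suc m} = insert (Suc m) {1..m}" by auto
  have insM: "PiM {1..Suc m} (\<lambda>_. P) = PiM (insert (Suc m) {1..m}) (\<lambda>_. P)" by (simp only: ins)
  have gm: "(\<lambda>z. g j (restrict z {1..<j}) (z j)) \<in> borel_measurable (PiM J (\<lambda>_. P))"
    if "{1..j} \<subseteq> J" "1 \<le> j" for j J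
  proof -
    have "(\<lambda>z. (restrict z {1..<j}, z j)) \<in> measurable (PiM J (\<lambda>_. P)) (PiM {1..<j} (\<lambda>_. P) \<Otimes>\<^sub>M P)"
      using that by (intro measurable_Pair measurable_restrict_subset measurable_component_singleton) auto
    from measurable_compose[OF this meas[of j]] show ?thesis by simp
  qed
  have Sm: "?S k \<in> borel_measurable (PiM J (\<lambda>_. P))" if "{1..k} \<subseteq> J" for k J
    using that by (intro borel_measurable_sum gm) auto
  have sm[measurable]: "g (Suc m) p \<in> borel_measurable P" if "p \<in> space (PiM {1..m} (\<lambda>_. P))" for p
  proof -
    have "p \<in> space (PiM {1..<Suc m} (\<lambda>_. P))" using that by (simp add: atLeastLessThanSuc_atLeastAtMost)
    from measurable_compose[OF measurable_Pair1'[OF this] meas[of "Suc m"]] show ?thesis by simp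
  qed
  have "(\<integral>\<^sup>+ z. ennreal (exp (\<mu> * ?S (Suc m) z)) \<partial>PiM {1..Suc m} (\<lambda>_. P))
      = (\<integral>\<^sup>+ p. (\<integral>\<^sup>+ y. ennreal (exp (\<mu> * ?S (Suc m) (p(Suc m := y)))) \<partial>P) \<partial>PiM {1..m} (\<lambda>_. P))"
    unfolding insM
  proof (rule pp.product_nn_integral_insert)
    show "(\<lambda>z. ennreal (exp (\<mu> * ?S (Suc m) z))) \<in> borel_measurable (PiM (insert (Suc m) {1..m}) (\<lambda>_. P))"
      by (rule measurable_compose[OF Sm, where g="\<lambda>r. ennreal (exp (\<mu> * r))"]) auto
  qed auto
  also have "\<dots> = (\<integral>\<^sup>+ p. ennreal (exp (\<mu> * ?S m p)) * (\<integral>\<^sup>+ y. ennreal (exp (\<mu> * g (Suc m) p y)) \<partial>P) \<partial>PiM {1..m} (\<lambda>_. P))"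
  proof (rule nn_integral_cong)
    fix p assume p: "p \<in> space (PiM {1..m} (\<lambda>_. P))"
    \<comment> \<open>The increment \<open>g j\<close> sees the past only below \<open>j\<close>, so
      a change of coordinate \<open>Suc m\<close> reaches the last summand alone, and there only its
      final argument.\<close>
    have r1: "restrict (p(Suc m := y)) {1..<j} = restrict p {1..<j}" if "j \<le> Suc m" for y j
      using that by (auto simp: restrict_def)
    have r2: "restrict p {1..<Suc m} = p"
      using p by (auto simp: space_PiM PiE_def extensional_def restrict_def fun_eq_iff)
    have eq: "?S (Suc m) (p(Suc m := y)) = ?S m p + g (Suc m) p y" for y
    proof -
      have "?S m (p(Suc m := y)) = ?S m p"
        by (intro sum.cong refl) (auto simp: r1)
      then show ?thesis by (simp add: r1 r2[unfolded One_nat_def])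
    qed
    have [measurable]: "g (Suc m) p \<in> borel_measurable P" by (rule sm[OF p])
    have "(\<integral>\<^sup>+ y. ennreal (exp (\<mu> * ?S (Suc m) (p(Suc m := y)))) \<partial>P)
        = (\<integral>\<^sup>+ y. ennreal (exp (\<mu> * ?S m p)) * ennreal (exp (\<mu> * g (Suc m) p y)) \<partial>P)"
      by (intro nn_integral_cong) (simp only: eq, simp add: distrib_left exp_add ennreal_mult)
    then show "(\<integral>\<^sup>+ y. ennreal (exp (\<mu> * ?S (Suc m) (p(Suc m := y)))) \<partial>P)
        = ennreal (exp (\<mu> * ?S m p)) * (\<integral>\<^sup>+ y. ennreal (exp (\<mu> * g (Suc m) p y)) \<partial>P)"
      by (simp add: nn_integral_cmult)
  qed
  also have "\<dots> \<le> (\<integral>\<^sup>+ p. ennreal (exp (\<mu> * ?S m p)) * ennreal (exp (\<mu>\<^sup>2 * v)) \<partial>PiM {1..m} (\<lambda>_. P))"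
    by (intro nn_integral_mono mult_left_mono P.nn_integral_exp_centered_le[OF sm bd mean var \<mu>]) auto
  also have "\<dots> = (\<integral>\<^sup>+ p. ennreal (exp (\<mu> * ?S m p)) \<partial>PiM {1..m} (\<lambda>_. P)) * ennreal (exp (\<mu>\<^sup>2 * v))"
    using Sm[of m "{1..m}"] by (intro nn_integral_multc) simp
  also have "\<dots> \<le> ennreal (exp (real m * \<mu>\<^sup>2 * v)) * ennreal (exp (\<mu>\<^sup>2 * v))"
    by (intro mult_right_mono Suc.IH) simp
  also have "\<dots> = ennreal (exp (real (Suc m) * \<mu>\<^sup>2 * v))"
    by (simp add: ennreal_mult[symmetric] exp_add[symmetric] algebra_simps)
  finally show ?case .
qed

text \<open>The condition \<open>1 \<le> n\<close> makes \<open>P\<close> the law of an actual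
  observation; that it is a Borel probability measure is derived from this.\<close>

locale iid_sample = prob_space \<Omega> for \<Omega> :: "'w measure" +
  fixes n :: nat and Z :: "nat \<Rightarrow> 'w \<Rightarrow> 'a::topological_space" and P :: "'a measure"
  assumes indep_Z: "indep_vars (\<lambda>_. borel) Z {1..n}"
    and distr_Z: "i \<in> {1..n} \<Longrightarrow> distr \<Omega> borel (Z i) = P"
    and n_pos: "1 \<le> n"
begin

lemma Z_measurable: "i \<in> {1..n} \<Longrightarrow> Z i \<in> borel_measurable \<Omega>"
  using indep_Z by (auto simp: indep_vars_def)

lemma sets_P[simp, measurable_cong]: "sets P = sets borel"
  using distr_Z[of 1] n_pos by (metis atLeastAtMost_iff order_refl sets_distr)

lemma space_P[simp]: "space P = UNIV"
  using sets_eq_imp_space_eq[OF sets_P] by simp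

lemma prob_space_P: "prob_space P"
  using distr_Z[of 1] n_pos prob_space_distr[OF Z_measurable[of 1]] by auto

lemma AE_Z:
  assumes "i \<in> {1..n}" "AE z in P. Q z"
  shows "AE \<omega> in \<Omega>. Q (Z i \<omega>)"
  using assms(2) unfolding distr_Z[OF assms(1), symmetric]
  by (rule AE_distrD[OF Z_measurable[OF assms(1)]])

lemma integral_Z:
  fixes f :: "'a \<Rightarrow> real"
  assumes "i \<in> {1..n}" "f \<in> borel_measurable borel"
  shows "(\<integral>\<omega>. f (Z i \<omega>) \<partial>\<Omega>) = (\<integral>z. f z \<partial>P)"
  unfolding distr_Z[OF assms(1), symmetric]
  using assms Z_measurable by (simp add: integral_distr)

text \<open>Independence enters only here: it identifies the law of the sample with a product
  measure, on which the Fubini induction runs.\<close>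

lemma distr_sample:
  "distr \<Omega> (PiM {1..n} (\<lambda>_. P)) (\<lambda>\<omega>. \<lambda>i\<in>{1..n}. Z i \<omega>) = PiM {1..n} (\<lambda>_. P)"
proof -
  have "distr \<Omega> (PiM {1..n} (\<lambda>_. borel)) (\<lambda>\<omega>. \<lambda>i\<in>{1..n}. Z i \<omega>) = PiM {1..n} (\<lambda>i. distr \<Omega> borel (Z i))"
    using indep_Z n_pos Z_measurable by (subst indep_vars_iff_distr_eq_PiM'[symmetric]) auto
  also have "\<dots> = PiM {1..n} (\<lambda>_. P)" by (intro PiM_cong) (auto simp: distr_Z)
  finally show ?thesis by (metis (no_types, lifting) distr_cong sets_PiM_cong sets_P)
qed

lemma martingale_measurable:
  assumes meas: "\<And>j. (\<lambda>(p, z). g j p z) \<in> borel_measurable (PiM {1..<j} (\<lambda>_. P) \<Otimes>\<^sub>M P)"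
  shows "(\<lambda>\<omega>. \<Sum>j=1..n. g j (restrict (\<lambda>i. Z i \<omega>) {1..<j}) (Z j \<omega>) :: real) \<in> borel_measurable \<Omega>"
proof (rule borel_measurable_sum)
  fix j assume j: "j \<in> {1..n}"
  have "(\<lambda>\<omega>. (restrict (\<lambda>i. Z i \<omega>) {1..<j}, Z j \<omega>)) \<in> measurable \<Omega> (PiM {1..<j} (\<lambda>_. P) \<Otimes>\<^sub>M P)"
    using j Z_measurable
    by (intro measurable_Pair measurable_restrict)
      (auto simp: measurable_cong_sets[OF refl sets_P])
  from measurable_compose[OF this meas[of j]]
  show "(\<lambda>\<omega>. g j (restrict (\<lambda>i. Z i \<omega>) {1..<j}) (Z j \<omega>)) \<in> borel_measurable \<Omega>" by simp
qed

text \<open>Chernoff's bound with the parameter \<open>\<mu>\<close> left free. Each application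
  picks the \<open>\<mu>\<close> that balances \<open>n \<mu> v\<close> against
  \<open>x / \<mu>\<close> within the constraint \<open>\<mu> * b \<le> 1\<close>, so the bound need
  not be optimized in general.\<close>

lemma martingale_upper_tail:
  fixes g :: "nat \<Rightarrow> (nat \<Rightarrow> 'a) \<Rightarrow> 'a \<Rightarrow> real"
  assumes meas: "\<And>j. (\<lambda>(p, z). g j p z) \<in> borel_measurable (PiM {1..<j} (\<lambda>_. P) \<Otimes>\<^sub>M P)"
    and bd: "\<And>j p. AE z in P. \<bar>g j p z\<bar> \<le> b"
    and mean: "\<And>j p. (\<integral>z. g j p z \<partial>P) = 0"
    and var: "\<And>j p. (\<integral>z. (g j p z)\<^sup>2 \<partial>P) \<le> v"
    and \<mu>: "0 < \<mu>" "\<mu> * b \<le> 1"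
  shows "prob {\<omega>\<in>space \<Omega>. real n * \<mu> * v + x / \<mu> <
            (\<Sum>j=1..n. g j (restrict (\<lambda>i. Z i \<omega>) {1..<j}) (Z j \<omega>))} \<le> exp (- x)"
proof -
  let ?S = "\<lambda>z. \<Sum>j=1..n. g j (restrict z {1..<j}) (z j)"
  let ?t = "real n * \<mu> * v + x / \<mu>"
  have [measurable]: "(\<lambda>\<omega>. ?S (\<lambda>i. Z i \<omega>)) \<in> borel_measurable \<Omega>"
    by (rule martingale_measurable[OF meas])
  have S2: "?S \<in> borel_measurable (PiM {1..n} (\<lambda>_. P))"
  proof (rule borel_measurable_sum)
    fix j assume j: "j \<in> {1..n}"
    have "(\<lambda>z. (restrict z {1..<j}, z j)) \<in> measurable (PiM {1..n} (\<lambda>_. P)) (PiM {1..<j} (\<lambda>_. P) \<Otimes>\<^sub>M P)"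
      using j by (intro measurable_Pair measurable_restrict_subset measurable_component_singleton) auto
    from measurable_compose[OF this meas[of j]]
    show "(\<lambda>z. g j (restrict z {1..<j}) (z j)) \<in> borel_measurable (PiM {1..n} (\<lambda>_. P))" by simp
  qed
  have smp: "(\<lambda>\<omega>. \<lambda>i\<in>{1..n}. Z i \<omega>) \<in> measurable \<Omega> (PiM {1..n} (\<lambda>_. P))"
    using Z_measurable by (intro measurable_restrict) (auto simp: measurable_cong_sets[OF refl sets_P])
  have fm: "(\<lambda>z. ennreal (exp (\<mu> * ?S z))) \<in> borel_measurable (distr \<Omega> (PiM {1..n} (\<lambda>_. P)) (\<lambda>\<omega>. \<lambda>i\<in>{1..n}. Z i \<omega>))"
    unfolding measurable_distr_eq1 by (rule measurable_compose[OF S2, where g="\<lambda>r. ennreal (exp (\<mu> * r))"]) auto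
  have "(\<integral>\<^sup>+ \<omega>. ennreal (exp (\<mu> * ?S (\<lambda>i. Z i \<omega>))) \<partial>\<Omega>)
      = (\<integral>\<^sup>+ \<omega>. ennreal (exp (\<mu> * ?S (\<lambda>i\<in>{1..n}. Z i \<omega>))) \<partial>\<Omega>)"
  proof (intro nn_integral_cong arg_cong[where f=ennreal] arg_cong[where f=exp] arg_cong2[where f="(*)"] refl sum.cong)
    fix \<omega> j assume "j \<in> {1..n}"
    moreover from this have "restrict (restrict (\<lambda>i. Z i \<omega>) {1..n}) {1..<j} = restrict (\<lambda>i. Z i \<omega>) {1..<j}"
      by (auto simp: fun_eq_iff restrict_def)
    ultimately show "g j (restrict (\<lambda>i. Z i \<omega>) {1..<j}) (Z j \<omega>)
       = g j (restrict (restrict (\<lambda>i. Z i \<omega>) {1..n}) {1..<j}) (restrict (\<lambda>i. Z i \<omega>) {1..n} j)" by simp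
  qed
  also have "\<dots> = (\<integral>\<^sup>+ z. ennreal (exp (\<mu> * ?S z)) \<partial>PiM {1..n} (\<lambda>_. P))"
    using nn_integral_distr[OF smp fm] by (simp only: distr_sample)
  also have "\<dots> \<le> ennreal (exp (real n * \<mu>\<^sup>2 * v))"
    using \<mu> by (intro nn_integral_exp_martingale_le[OF prob_space_P meas bd mean var]) auto
  finally have le: "(\<integral>\<^sup>+ \<omega>. ennreal (exp (\<mu> * ?S (\<lambda>i. Z i \<omega>))) \<partial>\<Omega>) \<le> ennreal (exp (real n * \<mu>\<^sup>2 * v))" .
  have Um: "(\<lambda>\<omega>. ennreal (exp (\<mu> * ?S (\<lambda>i. Z i \<omega>)))) \<in> borel_measurable \<Omega>"
    by (rule measurable_compose[OF martingale_measurable[OF meas], where g="\<lambda>r. ennreal (exp (\<mu> * r))"]) auto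
  have "emeasure \<Omega> {\<omega>\<in>space \<Omega>. ?t < ?S (\<lambda>i. Z i \<omega>)}
     \<le> emeasure \<Omega> {\<omega>\<in>space \<Omega>. 1 \<le> ennreal (exp (- (\<mu> * ?t))) * ennreal (exp (\<mu> * ?S (\<lambda>i. Z i \<omega>)))}"
  proof (rule emeasure_mono)
    show "{\<omega>\<in>space \<Omega>. ?t < ?S (\<lambda>i. Z i \<omega>)} \<subseteq>
       {\<omega>\<in>space \<Omega>. 1 \<le> ennreal (exp (- (\<mu> * ?t))) * ennreal (exp (\<mu> * ?S (\<lambda>i. Z i \<omega>)))}"
    proof safe
      fix \<omega> assume "?t < ?S (\<lambda>i. Z i \<omega>)"
      then have "\<mu> * ?t \<le> \<mu> * ?S (\<lambda>i. Z i \<omega>)" using \<mu> by simp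
      then have "1 \<le> exp (- (\<mu> * ?t) + \<mu> * ?S (\<lambda>i. Z i \<omega>))" by simp
      then show "1 \<le> ennreal (exp (- (\<mu> * ?t))) * ennreal (exp (\<mu> * ?S (\<lambda>i. Z i \<omega>)))"
        by (simp add: ennreal_mult[symmetric] exp_add[symmetric])
    qed
  qed measurable
  also have "\<dots> = emeasure \<Omega> ({\<omega>\<in>space \<Omega>. 1 \<le> ennreal (exp (- (\<mu> * ?t))) * ennreal (exp (\<mu> * ?S (\<lambda>i. Z i \<omega>)))} \<inter> space \<Omega>)"
    by (simp add: Int_absorb2 subset_eq)
  also have "\<dots> \<le> ennreal (exp (- (\<mu> * ?t))) * (\<integral>\<^sup>+ \<omega>. ennreal (exp (\<mu> * ?S (\<lambda>i. Z i \<omega>))) * indicator (space \<Omega>) \<omega> \<partial>\<Omega>)"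
    using nn_integral_Markov_inequality[OF borel_measurable_times_ennreal[OF Um borel_measurable_indicator[OF sets.top]], of "ennreal (exp (- (\<mu> * ?t)))"]
    by (simp add: Int_def conj_commute del: One_nat_def)
  also have "\<dots> = ennreal (exp (- (\<mu> * ?t))) * (\<integral>\<^sup>+ \<omega>. ennreal (exp (\<mu> * ?S (\<lambda>i. Z i \<omega>))) \<partial>\<Omega>)"
    by (intro arg_cong2[where f="(*)"] refl nn_integral_cong) simp
  also have "\<dots> \<le> ennreal (exp (- (\<mu> * ?t))) * ennreal (exp (real n * \<mu>\<^sup>2 * v))"
    by (intro mult_left_mono le) simp
  also have "\<dots> = ennreal (exp (- x))"
  proof -
    have "- (\<mu> * ?t) + real n * \<mu>\<^sup>2 * v = - x" using \<mu> by (simp add: field_simps power2_eq_square)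
    then show ?thesis by (simp add: ennreal_mult[symmetric] exp_add[symmetric])
  qed
  finally show ?thesis by (simp add: emeasure_eq_measure)
qed

lemma martingale_tail:
  fixes g :: "nat \<Rightarrow> (nat \<Rightarrow> 'a) \<Rightarrow> 'a \<Rightarrow> real"
  assumes meas: "\<And>j. (\<lambda>(p, z). g j p z) \<in> borel_measurable (PiM {1..<j} (\<lambda>_. P) \<Otimes>\<^sub>M P)"
    and bd: "\<And>j p. AE z in P. \<bar>g j p z\<bar> \<le> b"
    and mean: "\<And>j p. (\<integral>z. g j p z \<partial>P) = 0"
    and var: "\<And>j p. (\<integral>z. (g j p z)\<^sup>2 \<partial>P) \<le> v"
    and \<mu>: "0 < \<mu>" "\<mu> * b \<le> 1"
  shows "prob {\<omega>\<in>space \<Omega>. real n * \<mu> * v + x / \<mu> <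
            \<bar>\<Sum>j=1..n. g j (restrict (\<lambda>i. Z i \<omega>) {1..<j}) (Z j \<omega>)\<bar>} \<le> 2 * exp (- x)"
proof -
  define S where "S = (\<lambda>g \<omega>. \<Sum>j=1..n. g j (restrict (\<lambda>i. Z i \<omega>) {1..<j}) (Z j \<omega>) :: real)"
  let ?t = "real n * \<mu> * v + x / \<mu>"
  let ?h = "\<lambda>j p z. - g j p z"
  have hm: "(\<lambda>(p, z). ?h j p z) \<in> borel_measurable (PiM {1..<j} (\<lambda>_. P) \<Otimes>\<^sub>M P)" for j
    using borel_measurable_uminus[OF meas[of j]] by (simp add: case_prod_unfold)
  have [measurable]: "S g \<in> borel_measurable \<Omega>"
    unfolding S_def by (rule martingale_measurable[OF meas])
  have Sh: "S ?h = (\<lambda>\<omega>. - S g \<omega>)" by (simp add: S_def sum_negf)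
  have "prob {\<omega>\<in>space \<Omega>. ?t < \<bar>S g \<omega>\<bar>}
     \<le> prob ({\<omega>\<in>space \<Omega>. ?t < S g \<omega>} \<union> {\<omega>\<in>space \<Omega>. ?t < S ?h \<omega>})"
    using Sh by (intro finite_measure_mono) auto
  also have "\<dots> \<le> prob {\<omega>\<in>space \<Omega>. ?t < S g \<omega>} + prob {\<omega>\<in>space \<Omega>. ?t < S ?h \<omega>}"
    unfolding Sh by (rule measure_subadditive) (auto simp: emeasure_eq_measure)
  also have "\<dots> \<le> exp (- x) + exp (- x)"
    unfolding S_def using bd mean var \<mu>
    by (intro add_mono martingale_upper_tail[OF meas] martingale_upper_tail[OF hm]) auto
  finally show ?thesis by (simp add: S_def)
qed

text \<open>A partial sum is a martingale whose increments vanish after \<open>m\<close>. The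
  threshold keeps \<open>n\<close> in place of \<open>m\<close>, so that a single level serves all
  partial sums.\<close>

lemma bernstein:
  fixes h :: "'a \<Rightarrow> real"
  assumes [measurable]: "h \<in> borel_measurable borel"
    and bd: "AE z in P. \<bar>h z\<bar> \<le> b"
    and mean: "(\<integral>z. h z \<partial>P) = 0"
    and var: "(\<integral>z. (h z)\<^sup>2 \<partial>P) \<le> v" 
    and \<mu>: "0 < \<mu>" "\<mu> * b \<le> 1" and m: "m \<le> n"
  shows "prob {\<omega>\<in>space \<Omega>. real n * \<mu> * v + x / \<mu> < \<bar>\<Sum>j=1..m. h (Z j \<omega>)\<bar>} \<le> 2 * exp (- x)"
proof -
  let ?g = "\<lambda>j (p :: nat \<Rightarrow> 'a) z. if j \<le> m then h z else 0"
  \<comment> \<open>The zero increments after \<open>m\<close> have to obey the bound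
    \<open>b\<close> as well.\<close>
  have b: "0 \<le> b"
  proof -
    interpret P: prob_space P by (rule prob_space_P)
    show ?thesis using eventually_happens[OF bd] P.AE_prob_1 P.not_empty
      by (metis P.emeasure_space_1 abs_ge_zero ae_filter_eq_bot_iff dual_order.trans zero_neq_one)
  qed
  have v: "0 \<le> v" using order_trans[OF _ var] by simp
  have "(\<Sum>j=1..n. ?g j (restrict (\<lambda>i. Z i \<omega>) {1..<j}) (Z j \<omega>)) = (\<Sum>j=1..m. h (Z j \<omega>))" for \<omega>
    using m by (intro sum.mono_neutral_cong_right) auto
  moreover have "prob {\<omega>\<in>space \<Omega>. real n * \<mu> * v + x / \<mu> <
            \<bar>\<Sum>j=1..n. ?g j (restrict (\<lambda>i. Z i \<omega>) {1..<j}) (Z j \<omega>)\<bar>} \<le> 2 * exp (- x)"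
  proof (rule martingale_tail)
    show "(\<lambda>(p, z). ?g j p z) \<in> borel_measurable (PiM {1..<j} (\<lambda>_. P) \<Otimes>\<^sub>M P)" for j
      by (cases "j \<le> m") (simp_all add: case_prod_unfold)
    show "AE z in P. \<bar>?g j p z\<bar> \<le> b" for j p
      using bd b by (cases "j \<le> m") simp_all
    show "(\<integral>z. ?g j p z \<partial>P) = 0" for j p
      using mean by (cases "j \<le> m") simp_all
    show "(\<integral>z. (?g j p z)\<^sup>2 \<partial>P) \<le> v" for j p
      using var v by (cases "j \<le> m") simp_all
  qed (use \<mu> in auto)
  ultimately show ?thesis by simp
qed

end

section \<open>Polynomials on intervals\<close>

lemma lagrange_interpolation:
  fixes q :: "'a::field poly"
  assumes deg: "degree q \<le> r" and inj: "inj_on y {..r}"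
  shows "poly q x = (\<Sum>i\<le>r. poly q (y i) * (\<Prod>j\<in>{..r} - {i}. (x - y j) / (y i - y j)))"
proof -
  define L where "L = (\<Sum>i\<le>r. smult (poly q (y i)) (\<Prod>j\<in>{..r} - {i}. smult (1 / (y i - y j)) [:- y j, 1:]))"
  have poly_L: "poly L x = (\<Sum>i\<le>r. poly q (y i) * (\<Prod>j\<in>{..r} - {i}. (x - y j) / (y i - y j)))" for x
    by (simp add: L_def poly_sum poly_prod diff_divide_distrib)
  have "degree L \<le> r" unfolding L_def
  proof (rule degree_sum_le, simp)
    fix i assume i: "i \<in> {..r}"
    have "degree (\<Prod>j\<in>{..r} - {i}. smult (1 / (y i - y j)) [:- y j, 1:])
        \<le> (\<Sum>j\<in>{..r} - {i}. degree (smult (1 / (y i - y j)) [:- y j, 1:]))"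
      by (rule order_trans[OF degree_prod_sum_le]) (simp_all only: o_def finite_Diff finite_atMost order_refl)
    also have "\<dots> \<le> (\<Sum>j\<in>{..r} - {i}. 1)" by (intro sum_mono) simp
    also have "\<dots> = r" using i by simp
    finally show "degree (smult (poly q (y i)) (\<Prod>j\<in>{..r} - {i}. smult (1 / (y i - y j)) [:- y j, 1:])) \<le> r"
      by (meson degree_smult_le le_trans)
  qed
  then have deg': "degree (q - L) \<le> r" using deg degree_diff_le by blast
  have eq: "poly L (y k) = poly q (y k)" if k: "k \<le> r" for k
  proof -
    have z: "(\<Prod>j\<in>{..r} - {i}. (y k - y j) / (y i - y j)) = (if i = k then 1 else 0)" if "i \<le> r" for i
    proof (cases "i = k")
      case True
      then have "(y k - y j) / (y i - y j) = 1" if "j \<in> {..r} - {i}" for j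
        using that k inj by (auto dest: inj_onD[of y "{..r}" k j])
      then show ?thesis using True by (auto intro!: prod.neutral)
    next
      case False
      then show ?thesis using k by (auto simp: prod_zero_iff)
    qed
    have "poly L (y k) = (\<Sum>i\<le>r. poly q (y i) * (if i = k then 1 else 0))"
      unfolding poly_L by (intro sum.cong refl) (simp add: z)
    also have "\<dots> = poly q (y k)" using k by (simp add: if_distrib cong: if_cong)
    finally show ?thesis .
  qed
  have "q - L = 0"
  proof (rule ccontr)
    assume nz: "q - L \<noteq> 0"
    have "card (y ` {..r}) \<le> card {x. poly (q - L) x = 0}"
      using nz eq by (intro card_mono poly_roots_finite) auto
    also have "\<dots> \<le> degree (q - L)" using nz by (rule card_poly_roots_bound)
    finally show False using deg' inj by (simp add: card_image)
  qed
  then have "poly q x = poly L x" by simp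
  then show ?thesis unfolding poly_L .
qed

text \<open>The interval is cut into \<open>2 r + 1\<close> equal cells, which gives the first
  factor. The squared one bounds the sum of the absolute Lagrange basis polynomials when the nodes
  lie in alternate cells.\<close>

definition inverse_const :: "nat \<Rightarrow> real" where
  "inverse_const r = (2 * real r + 1) * ((real r + 1) * (2 * real r + 1) ^ r)\<^sup>2"

lemma inverse_const_pos: "0 < inverse_const r"
  by (simp add: inverse_const_def)

text \<open>Otherwise the square of \<open>q\<close> exceeds \<open>T / c\<close> on all of
  \<open>J\<close>, and the excess is a nonnegative function with integral at most zero; it vanishes
  almost everywhere, which forces \<open>J\<close> to be a null set.\<close>

lemma exists_sq_le_average:
  fixes q :: "real poly"
  assumes "finite_measure \<mu>" and [measurable_cong]: "sets \<mu> = sets borel"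
    and sub: "J \<subseteq> I" "J \<in> sets borel" "I \<in> sets borel" "bounded I"
    and c: "0 < c" "c \<le> measure \<mu> J"
  shows "\<exists>y\<in>J. c * (poly q y)\<^sup>2 \<le> (\<integral>z. (poly q z)\<^sup>2 * indicator I z \<partial>\<mu>)"
proof (rule ccontr)
  interpret finite_measure \<mu> by fact
  have [measurable]: "poly q \<in> borel_measurable borel"
    by (intro borel_measurable_continuous_onI continuous_on_poly continuous_on_id)
  have [measurable]: "I \<in> sets borel" "J \<in> sets borel" using sub by auto
  define T where "T = (\<integral>z. (poly q z)\<^sup>2 * indicator I z \<partial>\<mu>)"
  assume "\<not> ?thesis"
  then have gt: "T / c < (poly q y)\<^sup>2" if "y \<in> J" for y
    using that c by (auto simp: T_def field_simps not_le)
  have T0: "0 \<le> T" unfolding T_def by simp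
  obtain b where b: "\<And>z. z \<in> closure I \<Longrightarrow> norm (poly q z) \<le> b"
    using sub(4) compact_imp_bounded[OF compact_continuous_image[OF continuous_on_poly[OF continuous_on_id], of "closure I" q]]
    by (auto simp: bounded_iff compact_closure)
  have int: "integrable \<mu> (\<lambda>z. (poly q z)\<^sup>2 * indicator S z)" if "S \<in> sets borel" "S \<subseteq> I" for S
  proof (rule integrable_const_bound[where B="b\<^sup>2"])
    show "AE z in \<mu>. norm ((poly q z)\<^sup>2 * indicator S z) \<le> b\<^sup>2"
    proof (rule AE_I2)
      fix z show "norm ((poly q z)\<^sup>2 * indicator S z) \<le> b\<^sup>2"
        using b[of z] that closure_subset[of I] 
        by (auto split: split_indicator simp: abs_le_square_iff[symmetric])
    qed
  qed (use that in measurable)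
  have intJ: "integrable \<mu> (indicator J :: real \<Rightarrow> real)"
    using sub(2) by (simp add: integrable_indicator_iff emeasure_eq_measure assms(2))
  have "(\<integral>z. ((poly q z)\<^sup>2 - T / c) * indicator J z \<partial>\<mu>) = (\<integral>z. (poly q z)\<^sup>2 * indicator J z \<partial>\<mu>) - T / c * measure \<mu> J"
    using int[OF sub(2,1)] intJ by (simp add: left_diff_distrib assms(2) sets_eq_imp_space_eq[OF assms(2)])
  also have "\<dots> \<le> T - T / c * c"
  proof (intro diff_mono)
    show "(\<integral>z. (poly q z)\<^sup>2 * indicator J z \<partial>\<mu>) \<le> T"
      unfolding T_def using int sub by (intro integral_mono) (auto split: split_indicator)
    show "T / c * c \<le> T / c * measure \<mu> J" using c T0 by (intro mult_left_mono) auto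
  qed
  also have "\<dots> = 0" using c by simp
  finally have le0: "(\<integral>z. ((poly q z)\<^sup>2 - T / c) * indicator J z \<partial>\<mu>) \<le> 0" .
  have nn: "0 \<le> ((poly q z)\<^sup>2 - T / c) * indicator J z" for z
    using gt[of z] by (auto split: split_indicator)
  have "integrable \<mu> (\<lambda>z. ((poly q z)\<^sup>2 - T / c) * indicator J z)"
    using int[OF sub(2,1)] intJ by (simp add: left_diff_distrib)
  moreover have "(\<integral>z. ((poly q z)\<^sup>2 - T / c) * indicator J z \<partial>\<mu>) = 0"
    using le0 nn by (intro antisym integral_nonneg_AE) auto
  ultimately have "AE z in \<mu>. ((poly q z)\<^sup>2 - T / c) * indicator J z = 0"
    using nn by (subst integral_nonneg_eq_0_iff_AE[symmetric]) auto
  then have "AE z in \<mu>. z \<notin> J"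
    by eventually_elim (use gt in \<open>force split: split_indicator_asm\<close>)
  then have "measure \<mu> J = 0"
    using sub(2) by (subst (asm) AE_iff_measurable[OF _ refl]) (auto simp: assms(2) sets_eq_imp_space_eq[OF assms(2)] measure_def)
  then show False using c by simp
qed

text \<open>An inverse inequality: the supremum of a polynomial of bounded degree is controlled by
  its quadratic mean, with a constant that scales like the inverse length. Only a lower bound of
  \<open>\<mu>\<close> on open subintervals is used, so the design density may be arbitrary
  otherwise.\<close>

lemma poly_sq_le_integral:
  fixes q :: "real poly"
  assumes fin: "finite_measure \<mu>" and sets: "sets \<mu> = sets borel" and ab: "a < b" and c: "0 < c"
    and lower: "\<And>s t. a \<le> s \<Longrightarrow> s \<le> t \<Longrightarrow> t \<le> b \<Longrightarrow> c * (t - s) \<le> measure \<mu> {s<..<t}"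
    and I: "{a<..<b} \<subseteq> I" "I \<in> sets borel" "bounded I"
    and deg: "degree q \<le> r" and x: "x \<in> {a..b}"
  shows "(poly q x)\<^sup>2 \<le> inverse_const r / (c * (b - a)) * (\<integral>z. (poly q z)\<^sup>2 * indicator I z \<partial>\<mu>)"
proof -
  define N where "N = 2 * real r + 1"
  define h where "h = (b - a) / N"
  define T where "T = (\<integral>z. (poly q z)\<^sup>2 * indicator I z \<partial>\<mu>)"
  \<comment> \<open>Left endpoints of every second cell: nodes chosen inside them are at least one
    cell length \<open>h\<close> apart, while all distances are at most \<open>N * h\<close>, so
    each Lagrange factor is at most \<open>N\<close>.\<close>
  define s where "s i = a + 2 * real i * h" for i
  have N: "1 \<le> N" by (simp add: N_def)
  have h: "0 < h" using ab N by (simp add: h_def)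
  have hN: "N * h = b - a" using N by (simp add: h_def)
  have s_bd: "a \<le> s i" "s i + h \<le> b" if "i \<le> r" for i
  proof -
    show "a \<le> s i" using h by (simp add: s_def)
    have "(2 * real i + 1) * h \<le> N * h" using that h by (intro mult_right_mono) (auto simp: N_def)
    then show "s i + h \<le> b" unfolding hN by (simp add: s_def algebra_simps)
  qed
  have "\<exists>y. s i < y \<and> y < s i + h \<and> c * h * (poly q y)\<^sup>2 \<le> T" if "i \<le> r" for i
  proof -
    have "\<exists>y\<in>{s i<..<s i + h}. c * h * (poly q y)\<^sup>2 \<le> T" unfolding T_def
    proof (rule exists_sq_le_average[OF fin sets])
      show "{s i<..<s i + h} \<subseteq> I" using s_bd[OF that] I(1) by force
      show "c * h \<le> measure \<mu> {s i<..<s i + h}"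
        using lower[of "s i" "s i + h"] s_bd[OF that] h by simp
    qed (use c h I in auto)
    then show ?thesis by auto
  qed
  then obtain y where y: "\<And>i. i \<le> r \<Longrightarrow> s i < y i" "\<And>i. i \<le> r \<Longrightarrow> y i < s i + h"
      "\<And>i. i \<le> r \<Longrightarrow> c * h * (poly q (y i))\<^sup>2 \<le> T"
    by metis
  have sep1: "h \<le> y j - y i" if "i < j" "j \<le> r" for i j
  proof -
    have "1 * h \<le> (2 * (real j - real i) - 1) * h" using that h by (intro mult_right_mono) auto
    then have "h \<le> s j - (s i + h)" by (simp add: s_def algebra_simps)
    then show ?thesis using y(1)[of j] y(2)[of i] that by simp
  qed
  have sep: "h \<le> \<bar>y i - y j\<bar>" if "i \<le> r" "j \<le> r" "i \<noteq> j" for i j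
    using sep1[of i j] sep1[of j i] that by (cases "i < j") auto
  have inj: "inj_on y {..r}"
    using sep h by (intro inj_onI) force
  have T0: "0 \<le> T" unfolding T_def by simp
  define m where "m = T / (c * h)"
  have m0: "0 \<le> m" using T0 c h by (simp add: m_def)
  have ym: "\<bar>poly q (y i)\<bar> \<le> sqrt m" if "i \<le> r" for i
    using y(3)[OF that] c h by (intro real_le_rsqrt) (simp add: m_def field_simps)
  have "\<bar>poly q x\<bar> \<le> (\<Sum>i\<le>r. \<bar>poly q (y i) * (\<Prod>j\<in>{..r} - {i}. (x - y j) / (y i - y j))\<bar>)"
    unfolding lagrange_interpolation[OF deg inj, of x] by (rule sum_abs)
  also have "\<dots> \<le> (\<Sum>i\<le>r. sqrt m * N ^ r)"
  proof (rule sum_mono)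
    fix i assume i: "i \<in> {..r}"
    have "(\<Prod>j\<in>{..r} - {i}. \<bar>(x - y j) / (y i - y j)\<bar>) \<le> (\<Prod>j\<in>{..r} - {i}. N)"
    proof (rule prod_mono)
      fix j assume j: "j \<in> {..r} - {i}"
      have "\<bar>x - y j\<bar> \<le> N * h"
        unfolding hN using x y(1)[of j] y(2)[of j] s_bd[of j] j by auto
      also have "\<dots> \<le> N * \<bar>y i - y j\<bar>" using sep[of i j] i j N by (intro mult_left_mono) auto
      finally show "0 \<le> \<bar>(x - y j) / (y i - y j)\<bar> \<and> \<bar>(x - y j) / (y i - y j)\<bar> \<le> N"
        using sep[of i j] i j h by (auto simp: abs_divide field_simps)
    qed
    also have "\<dots> = N ^ r" using i by simp
    finally show "\<bar>poly q (y i) * (\<Prod>j\<in>{..r} - {i}. (x - y j) / (y i - y j))\<bar> \<le> sqrt m * N ^ r"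
      unfolding abs_mult abs_prod using ym[of i] i m0 by (intro mult_mono prod_nonneg) auto
  qed
  also have "\<dots> = ((real r + 1) * N ^ r) * sqrt m" by simp
  finally have "(poly q x)\<^sup>2 \<le> (((real r + 1) * N ^ r) * sqrt m)\<^sup>2"
    by (simp add: power2_le_iff_abs_le N_def m0)
  also have "\<dots> = ((real r + 1) * N ^ r)\<^sup>2 * m" using m0 by (simp add: power_mult_distrib)
  also have "\<dots> = (N * ((real r + 1) * N ^ r)\<^sup>2) / (c * (b - a)) * T"
    using N c ab by (simp add: m_def h_def)
  also have "N * ((real r + 1) * N ^ r)\<^sup>2 = inverse_const r"
    by (simp add: inverse_const_def N_def)
  finally show ?thesis by (simp add: T_def)
qed

text \<open>Gram-Schmidt applied to the monomials. The exact degrees are recorded because they make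
  the family triangular, hence spanning, through \<open>poly_expansion\<close>.\<close>

lemma orthonormal_polys:
  fixes ip :: "real poly \<Rightarrow> real poly \<Rightarrow> real"
  assumes add: "\<And>p q s. ip (p + q) s = ip p s + ip q s"
    and smult: "\<And>a p s. ip (smult a p) s = a * ip p s"
    and sym: "\<And>p q. ip p q = ip q p"
    and pos: "\<And>p. p \<noteq> 0 \<Longrightarrow> 0 < ip p p"
  shows "\<exists>q :: nat \<Rightarrow> real poly. (\<forall>i<m. q i \<noteq> 0 \<and> degree (q i) = i) \<and>
           (\<forall>i<m. \<forall>j<m. ip (q i) (q j) = (if i = j then 1 else 0))"
proof (induction m)
  case 0
  show ?case by simp
next
  case (Suc m)
  then obtain q where q: "\<And>i. i < m \<Longrightarrow> degree (q i) = i" "\<And>i. i < m \<Longrightarrow> q i \<noteq> 0"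
    and on: "\<And>i j. i < m \<Longrightarrow> j < m \<Longrightarrow> ip (q i) (q j) = (if i = j then 1 else 0)" by metis
  have zero: "ip 0 s = 0" for s using smult[of 0 0 s] by simp
  have sum: "ip (\<Sum>i\<in>A. f i) s = (\<Sum>i\<in>A. ip (f i) s)" for A :: "nat set" and f s
    by (induction A rule: infinite_finite_induct) (auto simp: zero add)
  define v where "v = (\<Sum>i<m. smult (- ip (monom 1 m) (q i)) (q i))"
  define u where "u = monom 1 m + v"
  have cv: "coeff v k = 0" if "m \<le> k" for k
    unfolding v_def coeff_sum using that q(1) by (intro sum.neutral) (auto simp: coeff_eq_0)
  have cu: "coeff u m = 1" by (simp add: u_def cv)
  have u0: "u \<noteq> 0" using cu by auto
  have degu: "degree u = m"
    using cu cv by (intro antisym degree_le le_degree) (auto simp: u_def)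
  have orth: "ip u (q j) = 0" if "j < m" for j
  proof -
    have "ip u (q j) = ip (monom 1 m) (q j) + (\<Sum>i<m. - ip (monom 1 m) (q i) * (if i = j then 1 else 0))"
      unfolding u_def v_def add sum smult using on that by (intro arg_cong2[where f="(+)"] sum.cong) auto
    then show ?thesis using that by (simp add: if_distrib cong: if_cong)
  qed
  define w where "w = smult (1 / sqrt (ip u u)) u"
  have pu: "0 < ip u u" using pos u0 by blast
  have w: "w \<noteq> 0" "degree w = m" "ip w w = 1" "\<And>j. j < m \<Longrightarrow> ip w (q j) = 0"
    using u0 pu degu orth sym[of u "smult (1 / sqrt (ip u u)) u"]
    by (simp_all add: w_def smult)
  have w': "ip (q j) w = 0" if "j < m" for j using w(4)[OF that] sym[of "q j" w] by simp
  show ?case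
  proof (rule exI[of _ "q(m := w)"], intro conjI allI impI)
    fix i assume "i < Suc m"
    then show "(q(m := w)) i \<noteq> 0" "degree ((q(m := w)) i) = i" using q w by (auto simp: less_Suc_eq)
    fix j assume "j < Suc m"
    then show "ip ((q(m := w)) i) ((q(m := w)) j) = (if i = j then 1 else 0)"
      using \<open>i < Suc m\<close> w w' on by (auto simp: less_Suc_eq)
  qed
qed

text \<open>Elimination of the leading coefficient. Phrasing the degree condition by coefficients
  lets \<open>m = 0\<close> cover the zero polynomial, which \<open>degree p < m\<close> could
  not.\<close>

lemma poly_expansion:
  fixes p :: "real poly"
  assumes q: "\<And>i. i < m \<Longrightarrow> q i \<noteq> 0 \<and> degree (q i) = i" and p: "\<And>k. m \<le> k \<Longrightarrow> coeff p k = 0"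
  shows "\<exists>c. p = (\<Sum>i<m. smult (c i) (q i))"
  using assms
proof (induction m arbitrary: p)
  case 0
  then show ?case by (simp add: poly_eq_iff)
next
  case (Suc m)
  define d where "d = coeff p m / lead_coeff (q m)"
  have qm: "q m \<noteq> 0" "degree (q m) = m" using Suc.prems(1)[of m] by auto
  have "\<exists>c. p - smult d (q m) = (\<Sum>i<m. smult (c i) (q i))"
  proof (rule Suc.IH)
    show "coeff (p - smult d (q m)) k = 0" if "m \<le> k" for k
      using qm leading_coeff_neq_0[OF qm(1)] Suc.prems(2)[of k] that by (cases "k = m") (auto simp: d_def coeff_eq_0)
  qed (use Suc.prems(1) in auto)
  then obtain c where c: "p - smult d (q m) = (\<Sum>i<m. smult (c i) (q i))" by blast
  have "p = (\<Sum>i<Suc m. smult ((c(m := d)) i) (q i))"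
    using c by (simp add: algebra_simps)
  then show ?case by blast
qed

section \<open>Localized bases of piecewise polynomials\<close>

text \<open>\<open>C1\<close> measures localization in supremum norm, \<open>R\<close> bounds the
  number of basis functions meeting a given one, and \<open>C2\<close> is a Lebesgue constant: it
  bounds the orthogonal projection as an operator on bounded functions.\<close>

locale localized_basis = prob_space \<mu> for \<mu> :: "real measure" +
  fixes B :: "'k set" and \<phi> :: "'k \<Rightarrow> real \<Rightarrow> real" and M :: "(real \<Rightarrow> real) set"
    and C1 C2 R :: real
  assumes sets_\<mu>[measurable_cong]: "sets \<mu> = sets borel"
    and finite_B[simp]: "finite B" and B_nonempty: "B \<noteq> {}"
    and M_eq: "M = {(\<lambda>x. \<Sum>k\<in>B. c k * \<phi> k x) | c. True}"
    and \<phi>_measurable[measurable]: "\<And>k. \<phi> k \<in> borel_measurable borel"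
    and orthonormal: "\<And>k l. k \<in> B \<Longrightarrow> l \<in> B \<Longrightarrow> (\<integral>x. \<phi> k x * \<phi> l x \<partial>\<mu>) = (if k = l then 1 else 0)"
    and sum_\<phi>_le: "\<And>x. (\<Sum>k\<in>B. \<bar>\<phi> k x\<bar>) \<le> sqrt (C1 * card B)"
    and overlap: "\<And>k. k \<in> B \<Longrightarrow> real (card {l\<in>B. \<exists>x. \<phi> k x * \<phi> l x \<noteq> 0}) \<le> R"
    and projector_le: "\<And>x. (\<Sum>k\<in>B. \<bar>\<phi> k x\<bar> * (\<integral>z. \<bar>\<phi> k z\<bar> \<partial>\<mu>)) \<le> C2"

lemma sum_fun_apply: "(\<Sum>i\<in>A. f i) x = (\<Sum>i\<in>A. f i x)" for f :: "'i \<Rightarrow> real \<Rightarrow> real"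
  by (induction A rule: infinite_finite_induct) auto

text \<open>Triangularity in the degree on each piece gives both inclusions of spans; linear
  independence follows by integrating a vanishing combination against one basis function.\<close>

lemma pp_space_basis:
  fixes q :: "real set \<Rightarrow> nat \<Rightarrow> real poly" and \<mu> :: "real measure"
  defines "\<phi> \<equiv> \<lambda>(I, j) x. poly (q I j) x * indicator I x"
  assumes fin: "finite Q"
    and q: "\<And>I j. I \<in> Q \<Longrightarrow> j \<le> r \<Longrightarrow> q I j \<noteq> 0 \<and> degree (q I j) = j"
    and int: "\<And>k l. k \<in> Q \<times> {..r} \<Longrightarrow> l \<in> Q \<times> {..r} \<Longrightarrow> integrable \<mu> (\<lambda>x. \<phi> k x * \<phi> l x)"
    and on: "\<And>k l. k \<in> Q \<times> {..r} \<Longrightarrow> l \<in> Q \<times> {..r} \<Longrightarrow>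
               (\<integral>x. \<phi> k x * \<phi> l x \<partial>\<mu>) = (if k = l then 1 else 0)"
  shows "pp_space Q r = {(\<lambda>x. \<Sum>k\<in>Q \<times> {..r}. c k * \<phi> k x) | c. True}"
    and "model_dim (pp_space Q r) = card (Q \<times> {..r})"
proof -
  let ?B = "Q \<times> {..r}"
  let ?G = "{(\<lambda>x. x ^ j * indicator I x) | I j. I \<in> Q \<and> j \<le> r} :: (real \<Rightarrow> real) set"
  have finB: "finite ?B" using fin by simp
  have inj: "inj_on \<phi> ?B"
  proof (rule inj_onI)
    fix k l assume kl: "k \<in> ?B" "l \<in> ?B" "\<phi> k = \<phi> l"
    then show "k = l" using on[of k l] on[of l l] by (auto split: if_splits)
  qed
  have in_span: "\<phi> k \<in> rfun.span ?G" if "k \<in> ?B" for k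
  proof -
    obtain I j where k: "k = (I, j)" "I \<in> Q" "j \<le> r" using \<open>k \<in> ?B\<close> by auto
    have mono: "(\<lambda>x. x ^ i * indicator I x) \<in> ?G" if "i \<le> j" for i
      using k that by (intro CollectI exI[of _ I] exI[of _ i]) auto
    have "\<phi> k = (\<Sum>i\<le>j. (\<lambda>x. coeff (q I j) i * (x ^ i * indicator I x)))"
      using q[of I j] k by (auto simp: \<phi>_def fun_eq_iff sum_fun_apply poly_altdef sum_distrib_right mult.assoc)
    also have "\<dots> \<in> rfun.span ?G"
      by (rule rfun.span_sum, rule rfun.span_scale, rule rfun.span_base, rule mono) simp
    finally show ?thesis .
  qed
  have gen: "g \<in> rfun.span (\<phi> ` ?B)" if "g \<in> ?G" for g
  proof -
    obtain I j where g: "g = (\<lambda>x. x ^ j * indicator I x)" "I \<in> Q" "j \<le> r" using \<open>g \<in> ?G\<close> by blast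
    have "\<exists>c. monom 1 j = (\<Sum>i<Suc r. smult (c i) (q I i))"
      using q[OF g(2)] g(3) by (intro poly_expansion) auto
    then obtain c where c: "monom 1 j = (\<Sum>i<Suc r. smult (c i) (q I i))" by blast
    have "x ^ j = (\<Sum>i<Suc r. c i * poly (q I i) x)" for x
      using arg_cong[OF c, of "\<lambda>p. poly p x"] by (simp add: poly_monom poly_sum)
    then have "g = (\<Sum>i<Suc r. (\<lambda>x. c i * \<phi> (I, i) x))"
      by (auto simp: g(1) \<phi>_def fun_eq_iff sum_fun_apply sum_distrib_right mult.assoc simp del: sum.lessThan_Suc)
    also have "\<dots> \<in> rfun.span (\<phi> ` ?B)"
      using g by (intro rfun.span_sum rfun.span_scale rfun.span_base) auto
    finally show ?thesis .
  qed
  have span: "pp_space Q r = rfun.span (\<phi> ` ?B)"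
    unfolding pp_space_def
    by (intro antisym rfun.span_minimal rfun.subspace_span subsetI) (use in_span gen in auto)
  have "pp_space Q r = range (\<lambda>u. \<Sum>v\<in>\<phi> ` ?B. (\<lambda>x. u v * v x))"
    unfolding span using finB by (intro rfun.span_finite) simp
  also have "\<dots> = range (\<lambda>u. (\<lambda>x. \<Sum>k\<in>?B. u (\<phi> k) * \<phi> k x))"
    by (intro arg_cong[where f=range] ext) (simp add: sum.reindex[OF inj] sum_fun_apply)
  also have "\<dots> = {(\<lambda>x. \<Sum>k\<in>?B. c k * \<phi> k x) | c. True}"
  proof safe
    fix c :: "_ \<Rightarrow> real"
    have "(\<lambda>x. \<Sum>k\<in>?B. c k * \<phi> k x) = (\<lambda>x. \<Sum>k\<in>?B. c (inv_into ?B \<phi> (\<phi> k)) * \<phi> k x)"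
      using inj by (intro ext sum.cong refl) simp
    then show "(\<lambda>x. \<Sum>k\<in>?B. c k * \<phi> k x) \<in> range (\<lambda>u. (\<lambda>x. \<Sum>k\<in>?B. u (\<phi> k) * \<phi> k x))"
      by (intro image_eqI[of _ _ "\<lambda>v. c (inv_into ?B \<phi> v)"]) auto
  next
    fix u :: "(real \<Rightarrow> real) \<Rightarrow> real"
    show "\<exists>c. (\<lambda>x. \<Sum>k\<in>?B. u (\<phi> k) * \<phi> k x) = (\<lambda>x. \<Sum>k\<in>?B. c k * \<phi> k x) \<and> True"
      by (intro exI[of _ "\<lambda>k. u (\<phi> k)"]) simp
  qed
  finally show "pp_space Q r = {(\<lambda>x. \<Sum>k\<in>?B. c k * \<phi> k x) | c. True}" .
  have "rfun.independent (\<phi> ` ?B)"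
  proof (subst rfun.independent_explicit_finite_subsets, intro allI impI ballI)
    fix S u v assume S: "S \<subseteq> \<phi> ` ?B" "finite S" and z: "(\<Sum>v\<in>S. (\<lambda>x. u v * v x)) = 0" and v: "v \<in> S"
    obtain l where l: "l \<in> ?B" "v = \<phi> l" using S v by auto
    \<comment> \<open>Extension by zero turns a relation on the finite subset \<open>S\<close> into
      one over the whole family, to which orthonormality applies.\<close>
    define u' where "u' w = (if w \<in> S then u w else 0)" for w
    have "(\<Sum>k\<in>?B. u' (\<phi> k) * \<phi> k x) = 0" for x
    proof -
      have "(\<Sum>k\<in>?B. u' (\<phi> k) * \<phi> k x) = (\<Sum>v\<in>\<phi> ` ?B. u' v * v x)"
        by (simp add: sum.reindex[OF inj])
      also have "\<dots> = (\<Sum>v\<in>S. u v * v x)"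
        using S finB by (intro sum.mono_neutral_cong_right) (auto simp: u'_def)
      also have "\<dots> = 0" using fun_cong[OF z, of x] by (simp add: sum_fun_apply)
      finally show ?thesis .
    qed
    then have "0 = (\<integral>x. (\<Sum>k\<in>?B. u' (\<phi> k) * \<phi> k x) * \<phi> l x \<partial>\<mu>)" by simp
    also have "\<dots> = (\<integral>x. (\<Sum>k\<in>?B. u' (\<phi> k) * (\<phi> k x * \<phi> l x)) \<partial>\<mu>)"
      by (simp add: sum_distrib_right mult.assoc)
    also have "\<dots> = (\<Sum>k\<in>?B. u' (\<phi> k) * (if k = l then 1 else 0))"
      using int on l by (simp add: Bochner_Integration.integral_sum)
    also have "\<dots> = (\<Sum>k\<in>?B. if k = l then u' (\<phi> k) else 0)" by (intro sum.cong) auto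
    also have "\<dots> = u' (\<phi> l)" using finB l(1) by (subst sum.delta) auto
    also have "\<dots> = u v" using l v by (simp add: u'_def)
    finally show "u v = 0" by simp
  qed
  then show "model_dim (pp_space Q r) = card ?B"
    unfolding model_dim_def span by (simp add: rfun.dim_eq_card_independent card_image[OF inj])
qed

lemma interval_hull:
  fixes I :: "real set"
  assumes I: "is_interval I" "I \<noteq> {}" "bounded I"
  shows "{Inf I<..<Sup I} \<subseteq> I" "I \<subseteq> {Inf I..Sup I}" "Inf I \<le> Sup I"
    "measure lborel I = Sup I - Inf I"
proof -
  have bd: "bdd_below I" "bdd_above I"
    using I(3) by (auto intro: bounded_imp_bdd_below bounded_imp_bdd_above)
  show sub2: "I \<subseteq> {Inf I..Sup I}" using bd by (auto intro: cInf_lower cSup_upper)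
  then show le: "Inf I \<le> Sup I" using I(2) by (meson atLeastAtMost_iff equals0I order_trans subsetD)
  show sub1: "{Inf I<..<Sup I} \<subseteq> I"
  proof
    fix x assume x: "x \<in> {Inf I<..<Sup I}"
    obtain a where a: "a \<in> I" "a < x" using x cInf_less_iff[OF I(2) bd(1), of x] by auto
    obtain b where b: "b \<in> I" "x < b" using x less_cSup_iff[OF I(2) bd(2), of x] by auto
    show "x \<in> I" using I(1) a b by (meson less_imp_le mem_is_interval_1_I)
  qed
  have m: "I \<in> sets lborel" using I(1) by (simp add: real_interval_borel_measurable)
  show "measure lborel I = Sup I - Inf I"
  proof (rule antisym)
    have "measure lborel I \<le> measure lborel {Inf I..Sup I}"
      using sub2 m by (intro measure_mono_fmeasurable) (auto simp: fmeasurable_def emeasure_lborel_Icc[OF le])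
    then show "measure lborel I \<le> Sup I - Inf I" using le by simp
    have "I \<in> fmeasurable lborel"
      by (rule fmeasurableI2[of "{Inf I..Sup I}"]) (use sub2 m in \<open>auto simp: fmeasurable_def emeasure_lborel_Icc[OF le]\<close>)
    then have "measure lborel {Inf I<..<Sup I} \<le> measure lborel I"
      using sub1 by (intro measure_mono_fmeasurable) auto
    then show "Sup I - Inf I \<le> measure lborel I" using le by simp
  qed
qed


lemma measurable_poly[measurable]: "poly p \<in> borel_measurable (borel :: real measure)"
  by (intro borel_measurable_continuous_onI continuous_on_poly continuous_on_id)

lemma integrable_poly_indicator:
  fixes \<mu> :: "real measure"
  assumes "finite_measure \<mu>" and [measurable_cong]: "sets \<mu> = sets borel"
    and [measurable]: "I \<in> sets borel" and I: "bounded I"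
  shows "integrable \<mu> (\<lambda>x. poly p x * indicator I x)"
proof -
  interpret finite_measure \<mu> by fact
  obtain b where b: "\<And>z. z \<in> closure I \<Longrightarrow> norm (poly p z) \<le> b"
    using I compact_imp_bounded[OF compact_continuous_image[OF continuous_on_poly[OF continuous_on_id], of "closure I" p]]
    by (auto simp: bounded_iff compact_closure)
  show ?thesis
  proof (rule integrable_const_bound[where B="\<bar>b\<bar>"])
    show "AE z in \<mu>. norm (poly p z * indicator I z) \<le> \<bar>b\<bar>"
      using b closure_subset[of I] by (intro AE_I2) (force split: split_indicator)
  qed measurable
qed

text \<open>On a piece of length \<open>h\<close> the inverse inequality bounds a normalized
  polynomial by a multiple of \<open>1 / sqrt h\<close>. Lower regularity turns \<open>1 / h\<close>
  into at most \<open>card B / cL\<close>, which gives the first constant. The \<open>L1\<close>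
  norm is at most of order \<open>sqrt h\<close>, so \<open>h\<close> cancels in the second
  constant, which is therefore independent of the partition.\<close>

theorem localized_basis_exists:
  fixes \<mu> :: "real measure"
  assumes prob: "prob_space \<mu>" and sets[measurable_cong]: "sets \<mu> = sets borel"
    and lower: "\<And>S. S \<in> sets borel \<Longrightarrow> S \<subseteq> {0..1} \<Longrightarrow> cmin * measure lborel S \<le> measure \<mu> S"
    and upper: "\<And>S. S \<in> sets borel \<Longrightarrow> S \<subseteq> {0..1} \<Longrightarrow> measure \<mu> S \<le> cmax * measure lborel S"
    and c: "0 < cmin" "0 < cL"
    and model: "is_pp_model M Q"
    and deg: "\<And>I p. I \<in> Q \<Longrightarrow> p \<in> M \<Longrightarrow> \<exists>q :: real poly. degree q \<le> r \<and> (\<forall>x\<in>I. p x = poly q x)"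
    and reg: "cL \<le> real (card Q) * (INF I\<in>Q. measure lborel I)"
  shows "\<exists>(B :: (real set \<times> nat) set) \<phi>. model_dim M = card B \<and>
    localized_basis \<mu> B \<phi> M ((real r + 1)\<^sup>2 * inverse_const r / (cmin * cL))
      ((real r + 1) * sqrt (inverse_const r * cmax / cmin)) (real r + 1)"
proof -
  interpret prob_space \<mu> by fact
  have fin: "finite Q" and part: "partition_on {0..1} Q" and ivl: "\<And>I. I \<in> Q \<Longrightarrow> is_interval I"
    using model by (auto simp: is_pp_model_def)
  obtain s where M: "M = pp_space Q s" using model by (auto simp: is_pp_model_def)
  have Q_ne: "Q \<noteq> {}" using part by (auto simp: partition_on_def)
  have sub: "I \<subseteq> {0..1}" if "I \<in> Q" for I using part that by (auto simp: partition_on_def)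
  have bnd: "bounded I" if "I \<in> Q" for I using sub[OF that] bounded_subset bounded_closed_interval by blast
  have ne: "I \<noteq> {}" if "I \<in> Q" for I using part that by (auto simp: partition_on_def)
  have disj: "I = J" if "I \<in> Q" "J \<in> Q" "x \<in> I" "x \<in> J" for I J x
    using part that by (auto simp: partition_on_def disjoint_def)
  have meas: "I \<in> sets borel" if "I \<in> Q" for I using ivl[OF that] by (rule real_interval_borel_measurable)
  define h where "h I = measure lborel (I :: real set)" for I
  have cardQ: "1 \<le> card Q" using fin Q_ne by (simp add: Suc_leI card_gt_0_iff)
  have h_lower: "cL / card Q \<le> h I" if "I \<in> Q" for I
  proof -
    have "(INF I\<in>Q. measure lborel I) \<le> h I"
      unfolding h_def using fin that by (intro cINF_lower bdd_below_finite) auto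
    then have "real (card Q) * (INF I\<in>Q. measure lborel I) \<le> card Q * h I"
      using cardQ by (intro mult_left_mono) auto
    with reg have "cL \<le> card Q * h I" by linarith
    then show ?thesis using cardQ by (simp add: divide_le_eq mult.commute)
  qed
  \<comment> \<open>Lower regularity excludes degenerate pieces such as single points.\<close>
  have h_pos: "0 < h I" if "I \<in> Q" for I
    using h_lower[OF that] c cardQ by (meson divide_pos_pos less_le_trans of_nat_0_less_iff zero_less_one less_le_trans)
  have hull: "{Inf I<..<Sup I} \<subseteq> I" "I \<subseteq> {Inf I..Sup I}" "h I = Sup I - Inf I" "Inf I < Sup I" if "I \<in> Q" for I
    using interval_hull[OF ivl[OF that] ne[OF that] bnd[OF that]] h_pos[OF that] by (auto simp: h_def)
  define C where "C = inverse_const r"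
  have C: "0 < C" by (simp add: C_def inverse_const_pos)
  have sup_le: "(poly q x)\<^sup>2 \<le> inverse_const d / (cmin * h I) * (\<integral>z. (poly q z)\<^sup>2 * indicator I z \<partial>\<mu>)"
    if I: "I \<in> Q" and q: "degree q \<le> d" "x \<in> I" for I x d q
    unfolding hull(3)[OF I]
  proof (rule poly_sq_le_integral[OF _ sets hull(4)[OF I] c(1) _ hull(1)[OF I] meas[OF I] bnd[OF I] q(1)])
    fix s t :: real assume st: "Inf I \<le> s" "s \<le> t" "t \<le> Sup I"
    have "{s<..<t} \<subseteq> {0..1}" using st hull(1)[OF I] sub[OF I] by force
    from lower[OF _ this] show "cmin * (t - s) \<le> measure \<mu> {s<..<t}" using st by simp
  qed (use q hull(2)[OF I] in \<open>auto intro: finite_measure_axioms\<close>)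
  define ip where "ip I p q = (\<integral>x. poly (p * q) x * indicator I x \<partial>\<mu>)" for I p q
  have int_p: "integrable \<mu> (\<lambda>x. poly p x * indicator I x)" if "I \<in> Q" for I p
    using integrable_poly_indicator[OF finite_measure_axioms sets meas[OF that] bnd[OF that]] .
  have inf_I: "infinite {Inf I<..<Sup I}" if "I \<in> Q" for I using hull(4)[OF that] by simp
  \<comment> \<open>The model is generated with its own degree \<open>s\<close>, whereas the
    constants may only involve the uniform bound \<open>r\<close>. On a piece with infinitely many
    points, \<open>x ^ s\<close> agrees with no polynomial but \<open>monom 1 s\<close>.\<close>
  have s_le: "s \<le> r"
  proof -
    obtain I where I: "I \<in> Q" using Q_ne by blast
    have "(\<lambda>x. x ^ s * indicator I x) \<in> M"
      unfolding M pp_space_def using I by (intro rfun.span_base) auto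
    from deg[OF I this] obtain q where q: "degree q \<le> r" "\<And>x. x \<in> I \<Longrightarrow> x ^ s = poly q x" by auto
    have "q = monom 1 s"
    proof (rule ccontr)
      assume "q \<noteq> monom 1 s"
      then have "finite {x. poly (q - monom 1 s) x = 0}" by (intro poly_roots_finite) simp
      moreover have "{Inf I<..<Sup I} \<subseteq> {x. poly (q - monom 1 s) x = 0}"
        using q(2) hull(1)[OF I] by (auto simp: poly_monom)
      ultimately show False using inf_I[OF I] finite_subset by blast
    qed
    then show ?thesis using q(1) by (simp add: degree_monom_eq)
  qed
  have "\<exists>q :: nat \<Rightarrow> real poly. (\<forall>i<Suc s. q i \<noteq> 0 \<and> degree (q i) = i) \<and>
           (\<forall>i<Suc s. \<forall>j<Suc s. ip I (q i) (q j) = (if i = j then 1 else 0))" if I: "I \<in> Q" for I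
  proof (rule orthonormal_polys)
    show "ip I (p + q) t = ip I p t + ip I q t" for p q t
      using int_p[OF I, of "p * t"] int_p[OF I, of "q * t"]
      by (simp add: ip_def distrib_right)
    show "ip I (smult a p) t = a * ip I p t" for a p t
      by (simp add: ip_def mult.assoc)
    show "ip I p q = ip I q p" for p q by (simp add: ip_def mult.commute)
    show "0 < ip I p p" if p: "p \<noteq> 0" for p
    proof -
      have "finite {x. poly p x = 0}" using p by (rule poly_roots_finite)
      then have "\<not> {Inf I<..<Sup I} \<subseteq> {x. poly p x = 0}"
        using inf_I[OF I] finite_subset by blast
      then obtain x where x: "x \<in> {Inf I<..<Sup I}" "poly p x \<noteq> 0" by blast
      have "0 < (poly p x)\<^sup>2" using x by simp
      also have "\<dots> \<le> inverse_const (degree p) / (cmin * h I) * ip I p p"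
        using sup_le[OF I order_refl, of x p] x hull(1)[OF I] by (auto simp: ip_def power2_eq_square)
      finally show ?thesis
        using inverse_const_pos[of "degree p"] mult_pos_pos[OF c(1) h_pos[OF I]] by (simp add: zero_less_mult_iff zero_less_divide_iff)
    qed
  qed
  then obtain q where q: "\<And>I i. I \<in> Q \<Longrightarrow> i \<le> s \<Longrightarrow> q I i \<noteq> 0 \<and> degree (q I i) = i"
    and on: "\<And>I i j. I \<in> Q \<Longrightarrow> i \<le> s \<Longrightarrow> j \<le> s \<Longrightarrow> ip I (q I i) (q I j) = (if i = j then 1 else (0::real))"
    unfolding less_Suc_eq_le by metis
  define \<phi> where "\<phi> k x = (case k of (I, j) \<Rightarrow> poly (q I j) x * indicator I x)" for k :: "real set \<times> nat" and x :: real
  define B where "B = Q \<times> {..s}"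
  have \<phi>_alt: "\<phi> = (\<lambda>(I, j) x. poly (q I j) x * indicator I x)" by (auto simp: \<phi>_def fun_eq_iff)
  have mult: "\<phi> (I, i) x * \<phi> (J, j) x = (if I = J then poly (q I i * q I j) x * indicator I x else 0)"
    if "I \<in> Q" "J \<in> Q" for I J i j x
    using disj[OF that, of x] by (auto simp: \<phi>_def split: split_indicator)
  have int: "integrable \<mu> (\<lambda>x. \<phi> k x * \<phi> l x)" if "k \<in> B" "l \<in> B" for k l
    using that int_p by (cases k; cases l; cases "fst k = fst l") (auto simp: B_def mult simp del: poly_mult)
  have orth: "(\<integral>x. \<phi> k x * \<phi> l x \<partial>\<mu>) = (if k = l then 1 else 0)" if "k \<in> B" "l \<in> B" for k l
    using that on[unfolded ip_def] by (cases k; cases l; cases "fst k = fst l") (auto simp: B_def mult simp del: poly_mult)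
  have basis: "M = {(\<lambda>x. \<Sum>k\<in>B. c k * \<phi> k x) | c. True}" "model_dim M = card B"
    unfolding M B_def \<phi>_alt
    by (rule pp_space_basis[OF fin q int[unfolded B_def \<phi>_alt] orth[unfolded B_def \<phi>_alt]]; assumption)+
  have cardB: "card Q \<le> card B" by (simp add: B_def card_cartesian_product)
  \<comment> \<open>A point lies in at most one piece, so at most \<open>s + 1\<close> indices
    contribute, whatever the number of pieces.\<close>
  have cell_sum: "(\<Sum>k\<in>B. g k) \<le> (real r + 1) * b"
    if b: "0 \<le> b" and g: "\<And>I j. I \<in> Q \<Longrightarrow> j \<le> s \<Longrightarrow> x \<in> I \<Longrightarrow> g (I, j) \<le> b"
      and g0: "\<And>I j. I \<in> Q \<Longrightarrow> x \<notin> I \<Longrightarrow> g (I, j) = 0" for g b and x :: real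
  proof (cases "\<exists>I\<in>Q. x \<in> I")
    case True
    then obtain I where I: "I \<in> Q" "x \<in> I" by blast
    have "g (J, j) = 0" if "J \<in> Q" "J \<noteq> I" for J j
      using g0[OF that(1)] disj[OF I(1) that(1) I(2)] that(2) by blast
    then have "(\<Sum>k\<in>B. g k) = (\<Sum>k\<in>{I} \<times> {..s}. g k)"
      using I(1) fin unfolding B_def by (intro sum.mono_neutral_right) auto
    also have "\<dots> \<le> real (card ({I} \<times> {..s})) * b"
      using I g by (intro sum_bounded_above) auto
    also have "\<dots> \<le> (real r + 1) * b" using s_le b by (intro mult_right_mono) auto
    finally show ?thesis .
  next
    case False
    then have "(\<Sum>k\<in>B. g k) = 0" using g0 by (intro sum.neutral) (auto simp: B_def)
    then show ?thesis using b by simp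
  qed
  have \<phi>_le: "\<bar>\<phi> (I, j) x\<bar> \<le> sqrt (C / (cmin * h I))" if "I \<in> Q" "j \<le> s" "x \<in> I" for I j x
  proof (rule real_le_rsqrt)
    show "\<bar>\<phi> (I, j) x\<bar>\<^sup>2 \<le> C / (cmin * h I)"
      using sup_le[OF that(1) _ that(3), of "q I j" r] that q[OF that(1,2)] on[OF that(1,2,2)] s_le
      by (simp add: \<phi>_def ip_def C_def power2_eq_square)
  qed
  have \<phi>_0: "\<phi> (I, j) x = 0" if "x \<notin> I" for I j x using that by (simp add: \<phi>_def)
  have \<phi>_m: "\<phi> k \<in> borel_measurable borel" if "k \<in> B" for k
    using that meas by (cases k) (auto simp: \<phi>_alt B_def)
  \<comment> \<open>Cauchy-Schwarz in its weighted arithmetic-mean form, with weight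
    \<open>t = sqrt (cmax * h I)\<close>, which bounds the square root of the mass of the
    piece.\<close>
  have L1: "(\<integral>z. \<bar>\<phi> (I, j) z\<bar> \<partial>\<mu>) \<le> sqrt (cmax * h I)" if k: "I \<in> Q" "j \<le> s" for I j
  proof -
    have "cmin * h I \<le> cmax * h I" using lower[OF meas[OF k(1)] sub[OF k(1)]] upper[OF meas[OF k(1)] sub[OF k(1)]] by (simp add: h_def)
    then have "0 < cmax" using c h_pos[OF k(1)] by simp
    then have t: "0 < sqrt (cmax * h I)" using h_pos[OF k(1)] by simp
    define t where "t = sqrt (cmax * h I)"
    have t2: "0 < t" "t * t = cmax * h I" using t by (auto simp: t_def)
    have kB: "(I, j) \<in> B" using k by (simp add: B_def)
    have [measurable]: "I \<in> sets borel" "\<phi> (I, j) \<in> borel_measurable borel" using meas k \<phi>_m[OF kB] by auto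
    have intI: "integrable \<mu> (indicator I :: real \<Rightarrow> real)"
      by (simp add: integrable_indicator_iff emeasure_eq_measure)
    have int1: "integrable \<mu> (\<lambda>z. \<bar>\<phi> (I, j) z\<bar>)"
      using integrable_abs[OF int_p[OF k(1), of "q I j"]] by (simp add: \<phi>_def)
    have "(\<integral>z. \<bar>\<phi> (I, j) z\<bar> \<partial>\<mu>) \<le> (\<integral>z. (t * (\<phi> (I, j) z * \<phi> (I, j) z) + indicator I z / t) / 2 \<partial>\<mu>)"
    proof (rule integral_mono[OF int1])
      show "integrable \<mu> (\<lambda>z. (t * (\<phi> (I, j) z * \<phi> (I, j) z) + indicator I z / t) / 2)"
        using int[OF kB kB] intI by simp
      fix z
      have "\<bar>u\<bar> \<le> (t * (u * u) + 1 / t) / 2" for u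
      proof -
        have "0 \<le> (t * \<bar>u\<bar> - 1)\<^sup>2 / t" using t2 by simp
        also have "\<dots> = t * (u * u) + 1 / t - 2 * \<bar>u\<bar>"
          using t2 by (simp add: power2_eq_square field_simps)
        finally show ?thesis by simp
      qed
      then show "\<bar>\<phi> (I, j) z\<bar> \<le> (t * (\<phi> (I, j) z * \<phi> (I, j) z) + indicator I z / t) / 2"
        by (cases "z \<in> I") (auto simp: \<phi>_0)
    qed
    also have "\<dots> = (t + measure \<mu> I / t) / 2"
      using int[OF kB kB] intI orth[OF kB kB] by (simp add: sets sets_eq_imp_space_eq[OF sets])
    also have "\<dots> \<le> (t + (t * t) / t) / 2"
      using t2 upper[OF meas[OF k(1)] sub[OF k(1)]] by (intro divide_right_mono add_mono) (auto simp: h_def)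
    also have "\<dots> = t" using t2(1) by simp
    finally show ?thesis by (simp add: t_def)
  qed
  \<comment> \<open>Outside \<open>B\<close> the functions are replaced by zero, since the locale
    wants every \<open>\<phi>' k\<close> to be measurable.\<close>
  have "localized_basis \<mu> B \<phi>' M ((real r + 1)\<^sup>2 * C / (cmin * cL))
      ((real r + 1) * sqrt (C * cmax / cmin)) (real r + 1)"
    if \<phi>': "\<phi>' = (\<lambda>k. if k \<in> B then \<phi> k else (\<lambda>_. 0))" for \<phi>'
  proof
    show "sets \<mu> = sets borel" by fact
    show "finite B" "B \<noteq> {}" using fin Q_ne by (auto simp: B_def)
    show "M = {(\<lambda>x. \<Sum>k\<in>B. c k * \<phi>' k x) | c. True}" unfolding basis \<phi>' by simp
    show "\<phi>' k \<in> borel_measurable borel" for k using \<phi>_m by (simp add: \<phi>')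
    show "(\<integral>x. \<phi>' k x * \<phi>' l x \<partial>\<mu>) = (if k = l then 1 else 0)" if "k \<in> B" "l \<in> B" for k l
      using orth that by (simp add: \<phi>')
    have bound: "sqrt (C / (cmin * h I)) \<le> sqrt (C * card B / (cmin * cL))" if "I \<in> Q" for I
    proof -
      have "cL \<le> card Q * h I" using h_lower[OF that] cardQ by (simp add: field_simps)
      also have "\<dots> \<le> card B * h I" using cardB h_pos[OF that] by (intro mult_right_mono) auto
      finally have "C * cL \<le> C * (card B * h I)" using C by (intro mult_left_mono) auto
      then show ?thesis using C c h_pos[OF that] by (intro real_sqrt_le_mono) (simp add: field_simps)
    qed
    show "(\<Sum>k\<in>B. \<bar>\<phi>' k x\<bar>) \<le> sqrt ((real r + 1)\<^sup>2 * C / (cmin * cL) * card B)" for x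
    proof -
      have "(\<Sum>k\<in>B. \<bar>\<phi>' k x\<bar>) = (\<Sum>k\<in>B. \<bar>\<phi> k x\<bar>)" by (simp add: \<phi>')
      also have "\<dots> \<le> (real r + 1) * sqrt (C * card B / (cmin * cL))"
        using order_trans[OF \<phi>_le bound] \<phi>_0 C c by (intro cell_sum[of _ x]) auto
      also have "\<dots> = sqrt ((real r + 1)\<^sup>2) * sqrt (C * card B / (cmin * cL))" by simp
      also have "\<dots> = sqrt ((real r + 1)\<^sup>2 * C / (cmin * cL) * card B)"
        unfolding real_sqrt_mult[symmetric] by (simp add: mult.assoc)
      finally show ?thesis .
    qed
    show "real (card {l \<in> B. \<exists>x. \<phi>' k x * \<phi>' l x \<noteq> 0}) \<le> real r + 1" if "k \<in> B" for k
    proof -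
      have "{l \<in> B. \<exists>x. \<phi>' k x * \<phi>' l x \<noteq> 0} \<subseteq> {fst k} \<times> {..s}"
      proof
        fix l assume "l \<in> {l \<in> B. \<exists>x. \<phi>' k x * \<phi>' l x \<noteq> 0}"
        then obtain I j x where l: "l = (I, j)" "(I, j) \<in> B" "\<phi>' k x * \<phi>' (I, j) x \<noteq> 0"
          by (cases l) auto
        then have "x \<in> I" "x \<in> fst k" using \<phi>_0[of x] \<open>k \<in> B\<close> by (cases k; force simp: \<phi>')+
        moreover have "I \<in> Q" "fst k \<in> Q" using l(2) \<open>k \<in> B\<close> by (auto simp: B_def)
        ultimately have "I = fst k" using disj[of I "fst k" x] by blast
        then show "l \<in> {fst k} \<times> {..s}" using l by (simp add: B_def)
      qed
      from card_mono[OF _ this] have "card {l \<in> B. \<exists>x. \<phi>' k x * \<phi>' l x \<noteq> 0} \<le> Suc s" by simp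
      then show ?thesis using s_le by linarith
    qed
    show "(\<Sum>k\<in>B. \<bar>\<phi>' k x\<bar> * (\<integral>z. \<bar>\<phi>' k z\<bar> \<partial>\<mu>)) \<le> (real r + 1) * sqrt (C * cmax / cmin)" for x
    proof -
      obtain I0 where "I0 \<in> Q" using Q_ne by blast
      then have "cmin * h I0 \<le> cmax * h I0" 
        using lower[OF meas sub, OF \<open>I0 \<in> Q\<close> \<open>I0 \<in> Q\<close>] upper[OF meas sub, OF \<open>I0 \<in> Q\<close> \<open>I0 \<in> Q\<close>]
        by (simp add: h_def)
      then have cmax: "0 < cmax" using c h_pos[OF \<open>I0 \<in> Q\<close>] by simp
      have "(\<Sum>k\<in>B. \<bar>\<phi>' k x\<bar> * (\<integral>z. \<bar>\<phi>' k z\<bar> \<partial>\<mu>)) = (\<Sum>k\<in>B. \<bar>\<phi> k x\<bar> * (\<integral>z. \<bar>\<phi> k z\<bar> \<partial>\<mu>))"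
        by (simp add: \<phi>')
      also have "\<dots> \<le> (real r + 1) * sqrt (C * cmax / cmin)"
      proof (rule cell_sum[of _ x])
        fix I j assume k: "I \<in> Q" "j \<le> s" "x \<in> I"
        have "\<bar>\<phi> (I, j) x\<bar> * (\<integral>z. \<bar>\<phi> (I, j) z\<bar> \<partial>\<mu>) \<le> sqrt (C / (cmin * h I)) * sqrt (cmax * h I)"
          using k by (intro mult_mono \<phi>_le L1) (auto simp: C c less_imp_le h_pos)
        also have "\<dots> = sqrt (C * cmax / cmin)"
          unfolding real_sqrt_mult[symmetric] using h_pos[OF k(1)] by (simp add: field_simps)
        finally show "\<bar>\<phi> (I, j) x\<bar> * (\<integral>z. \<bar>\<phi> (I, j) z\<bar> \<partial>\<mu>) \<le> sqrt (C * cmax / cmin)" .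
      qed (use C c cmax \<phi>_0 in auto)
      finally show ?thesis .
    qed
  qed
  then show ?thesis using basis(2) unfolding C_def by blast
qed

section \<open>Least squares on a single model\<close>

context prob_space begin

lemma integrable_AE_bounded:
  fixes f :: "'a \<Rightarrow> real"
  assumes "f \<in> borel_measurable M" "AE x in M. \<bar>f x\<bar> \<le> b"
  shows "integrable M f"
  by (rule integrable_const_bound[where B=b]) (use assms in auto)

lemma expectation_sq_le:
  fixes f :: "'a \<Rightarrow> real"
  assumes [measurable]: "f \<in> borel_measurable M" and bd: "AE x in M. \<bar>f x\<bar> \<le> b"
  shows "expectation (\<lambda>x. (f x)\<^sup>2) \<le> b\<^sup>2"
proof -
  have "integrable M (\<lambda>x. (f x)\<^sup>2)"
    by (rule integrable_AE_bounded[where b="b\<^sup>2"])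
      (use bd in \<open>auto elim!: eventually_mono simp: abs_le_square_iff[symmetric]\<close>)
  then have "expectation (\<lambda>x. (f x)\<^sup>2) \<le> expectation (\<lambda>_. b\<^sup>2)"
    by (rule integral_mono_AE) (use bd in \<open>auto elim!: eventually_mono simp: abs_le_square_iff[symmetric]\<close>)
  then show ?thesis by (simp add: prob_space)
qed

lemma abs_expectation_le:
  fixes f :: "'a \<Rightarrow> real"
  assumes [measurable]: "f \<in> borel_measurable M" and bd: "AE x in M. \<bar>f x\<bar> \<le> b"
  shows "\<bar>expectation f\<bar> \<le> b"
proof -
  have "integrable M f" by (rule integrable_AE_bounded[OF _ bd]) simp
  moreover have "AE x in M. f x \<le> b" "AE x in M. - b \<le> f x" using bd by (auto elim!: eventually_mono)
  ultimately have "expectation f \<le> expectation (\<lambda>_. b)" "expectation (\<lambda>_. - b) \<le> expectation f"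
    by - (rule integral_mono_AE; simp)+
  then show ?thesis by (simp add: prob_space abs_le_iff)
qed

lemma expectation_centered_sq_le:
  fixes f :: "'a \<Rightarrow> real"
  assumes "integrable M f" "integrable M (\<lambda>x. (f x)\<^sup>2)"
  shows "expectation (\<lambda>x. (f x - expectation f)\<^sup>2) \<le> expectation (\<lambda>x. (f x)\<^sup>2)"
  using variance_eq[OF assms] by simp

end

lemma sq_le_sq: "\<bar>u\<bar> \<le> b \<Longrightarrow> u\<^sup>2 \<le> b\<^sup>2" for u b :: real
  using abs_le_square_iff[of u b] by linarith

definition clip :: "real \<Rightarrow> real \<Rightarrow> real" where
  "clip t x = max (- t) (min t x)"

lemma clip_measurable[measurable]: "clip t \<in> borel_measurable borel"
  unfolding clip_def by measurable

lemma abs_clip_le: "0 \<le> t \<Longrightarrow> \<bar>clip t x\<bar> \<le> t"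
  by (auto simp: clip_def)

lemma clip_id: "\<bar>x\<bar> \<le> t \<Longrightarrow> clip t x = x"
  by (auto simp: clip_def)

text \<open>Conditional moments of the noise are expressed by testing against functions of the
  design. This keeps the analysis of one model on the law \<open>P\<close>, away from the
  probability space and from conditional expectations.\<close>

locale regression_model = iid_sample \<Omega> n Z P + basis: localized_basis "design_law P" B \<phi> M C1 C2 R
  for \<Omega> :: "'w measure" and n :: nat and Z :: "nat \<Rightarrow> 'w \<Rightarrow> real \<times> real" and P
    and B :: "'k set" and \<phi> M C1 C2 R +
  fixes s0 sM :: "real \<Rightarrow> real" and A smin :: real
  assumes A_pos: "0 < A" and smin_pos: "0 < smin"
    and s0_measurable[measurable]: "s0 \<in> borel_measurable borel"
    and response_bounded: "AE z in P. \<bar>snd z\<bar> \<le> A"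
    and s0_bounded: "AE z in P. \<bar>s0 (fst z)\<bar> \<le> A"
    and noise_centered: "\<And>g b. g \<in> borel_measurable borel \<Longrightarrow> AE z in P. \<bar>g (fst z)\<bar> \<le> b \<Longrightarrow>
          (\<integral>z. (snd z - s0 (fst z)) * g (fst z) \<partial>P) = 0"
    and noise_variance: "\<And>g b. g \<in> borel_measurable borel \<Longrightarrow> (\<And>x. 0 \<le> g x \<and> g x \<le> b) \<Longrightarrow>
          smin\<^sup>2 * (\<integral>z. g (fst z) \<partial>P) \<le> (\<integral>z. (snd z - s0 (fst z))\<^sup>2 * g (fst z) \<partial>P)"
    and projection: "is_L2_projection (design_law P) M s0 sM"
begin

sublocale P: prob_space P by (rule prob_space_P)

lemma pair_measurable[measurable]:
  "fst \<in> borel_measurable (borel :: (real \<times> real) measure)" "snd \<in> borel_measurable (borel :: (real \<times> real) measure)"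
  by (auto intro!: borel_measurable_continuous_onI continuous_intros)

lemma fst_measurable_P: "fst \<in> borel_measurable P"
  by (simp add: measurable_cong_sets[OF sets_P refl])

lemma integral_design:
  fixes g :: "real \<Rightarrow> real"
  assumes "g \<in> borel_measurable borel"
  shows "(\<integral>x. g x \<partial>design_law P) = (\<integral>z. g (fst z) \<partial>P)"
  unfolding design_law_def using assms fst_measurable_P by (intro integral_distr) auto

definition D :: real where "D = real (card B)"

lemma D_ge_1: "1 \<le> D"
  using basis.finite_B basis.B_nonempty by (simp add: D_def Suc_leI card_gt_0_iff)

lemma sum_\<phi>_le: "(\<Sum>k\<in>B. \<bar>\<phi> k x\<bar>) \<le> sqrt (C1 * D)"
  using basis.sum_\<phi>_le by (simp add: D_def)

lemma C1_nonneg: "0 \<le> C1"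
proof -
  have "0 \<le> sqrt (C1 * D)" by (rule order_trans[OF sum_nonneg sum_\<phi>_le[of 0]]) simp
  then show ?thesis using D_ge_1 by (simp add: zero_le_mult_iff)
qed

lemma C2_nonneg: "0 \<le> C2"
  using order_trans[OF sum_nonneg basis.projector_le[of 0]] by simp

lemma \<phi>_le: "k \<in> B \<Longrightarrow> \<bar>\<phi> k x\<bar> \<le> sqrt (C1 * D)"
  using member_le_sum[of k B "\<lambda>k. \<bar>\<phi> k x\<bar>"] sum_\<phi>_le[of x] by simp

lemma \<phi>_mult_le: "k \<in> B \<Longrightarrow> l \<in> B \<Longrightarrow> \<bar>\<phi> k x * \<phi> l x\<bar> \<le> C1 * D"
  using mult_mono[OF \<phi>_le[of k x] \<phi>_le[of l x]] C1_nonneg D_ge_1 by (simp add: abs_mult)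

lemma sum_\<phi>_sq_le: "(\<Sum>k\<in>B. (\<phi> k x)\<^sup>2) \<le> C1 * D"
proof -
  have "(\<Sum>k\<in>B. (\<phi> k x)\<^sup>2) \<le> (\<Sum>k\<in>B. \<bar>\<phi> k x\<bar> * sqrt (C1 * D))"
  proof (rule sum_mono)
    fix k assume "k \<in> B"
    then have "\<bar>\<phi> k x\<bar> * \<bar>\<phi> k x\<bar> \<le> \<bar>\<phi> k x\<bar> * sqrt (C1 * D)" by (intro mult_left_mono \<phi>_le) auto
    then show "(\<phi> k x)\<^sup>2 \<le> \<bar>\<phi> k x\<bar> * sqrt (C1 * D)" by (simp add: power2_eq_square)
  qed
  also have "\<dots> \<le> sqrt (C1 * D) * sqrt (C1 * D)"
    unfolding sum_distrib_right[symmetric] using C1_nonneg D_ge_1 by (intro mult_right_mono sum_\<phi>_le) simp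
  finally show ?thesis using C1_nonneg D_ge_1 by simp
qed

lemma \<phi>_integrable:
  assumes "k \<in> B"
  shows "integrable P (\<lambda>z. \<phi> k (fst z))"
  using \<phi>_le[OF assms] by (intro P.integrable_AE_bounded[where b="sqrt (C1 * D)"]) auto

lemma \<phi>_orthonormal:
  assumes "k \<in> B" "l \<in> B"
  shows "(\<integral>z. \<phi> k (fst z) * \<phi> l (fst z) \<partial>P) = (if k = l then 1 else 0)"
  using basis.orthonormal[OF assms] by (simp add: integral_design)

lemma \<phi>_mult_integrable:
  assumes "k \<in> B" "l \<in> B"
  shows "integrable P (\<lambda>z. \<phi> k (fst z) * \<phi> l (fst z))"
  using \<phi>_mult_le[OF assms] by (intro P.integrable_AE_bounded[where b="C1 * D"]) auto

definition coef :: "'k \<Rightarrow> real" where "coef k = (\<integral>z. s0 (fst z) * \<phi> k (fst z) \<partial>P)"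

lemma s0_\<phi>_integrable: "k \<in> B \<Longrightarrow> integrable P (\<lambda>z. s0 (fst z) * \<phi> k (fst z))"
proof (rule P.integrable_AE_bounded)
  assume k: "k \<in> B"
  show "AE z in P. \<bar>s0 (fst z) * \<phi> k (fst z)\<bar> \<le> A * sqrt (C1 * D)"
    using s0_bounded by eventually_elim (use \<phi>_le[OF k] A_pos in \<open>auto simp: abs_mult intro!: mult_mono\<close>)
qed measurable

lemma comb_integral:
  assumes "l \<in> B"
  shows "(\<integral>z. (\<Sum>k\<in>B. c k * \<phi> k (fst z)) * \<phi> l (fst z) \<partial>P) = c l"
proof -
  have "(\<integral>z. (\<Sum>k\<in>B. c k * \<phi> k (fst z)) * \<phi> l (fst z) \<partial>P)
      = (\<integral>z. (\<Sum>k\<in>B. c k * (\<phi> k (fst z) * \<phi> l (fst z))) \<partial>P)"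
    by (simp add: sum_distrib_right mult.assoc)
  also have "\<dots> = (\<Sum>k\<in>B. c k * (if k = l then 1 else 0))"
    using assms by (simp add: \<phi>_mult_integrable \<phi>_orthonormal)
  also have "\<dots> = (\<Sum>k\<in>B. if k = l then c k else 0)" by (intro sum.cong) auto
  also have "\<dots> = c l" using assms by (subst sum.delta) auto
  finally show ?thesis .
qed

text \<open>The coefficients are found by testing the residual against each basis function. The
  identity is pointwise, not merely almost everywhere, because models are sets of functions.\<close>

lemma sM_eq: "sM x = (\<Sum>k\<in>B. coef k * \<phi> k x)"
proof -
  have sM: "sM \<in> M" "\<And>t. t \<in> M \<Longrightarrow> (\<integral>x. (s0 x - sM x) * t x \<partial>design_law P) = 0"
    using projection by (auto simp: is_L2_projection_def)
  obtain c where c: "sM = (\<lambda>x. \<Sum>k\<in>B. c k * \<phi> k x)" using sM(1) unfolding basis.M_eq by auto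
  have "coef l = c l" if l: "l \<in> B" for l
  proof -
    have "\<phi> l = (\<lambda>x. \<Sum>k\<in>B. (if k = l then 1 else 0) * \<phi> k x)"
      using l by (auto simp: if_distrib[of "\<lambda>c. c * _"] cong: if_cong)
    then have "\<phi> l \<in> M" unfolding basis.M_eq by (intro CollectI exI[of _ "\<lambda>k. if k = l then 1 else 0"]) simp
    then have "0 = (\<integral>z. (s0 (fst z) - sM (fst z)) * \<phi> l (fst z) \<partial>P)"
      using sM(2) by (subst integral_design[symmetric]) (auto simp: c)
    also have "\<dots> = (\<integral>z. s0 (fst z) * \<phi> l (fst z) - (\<Sum>k\<in>B. c k * (\<phi> k (fst z) * \<phi> l (fst z))) \<partial>P)"
      by (simp add: c left_diff_distrib sum_distrib_right mult.assoc)
    also have "\<dots> = coef l - (\<integral>z. (\<Sum>k\<in>B. c k * (\<phi> k (fst z) * \<phi> l (fst z))) \<partial>P)"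
      using l by (subst Bochner_Integration.integral_diff)
        (auto simp: coef_def s0_\<phi>_integrable intro!: Bochner_Integration.integrable_sum \<phi>_mult_integrable)
    also have "(\<integral>z. (\<Sum>k\<in>B. c k * (\<phi> k (fst z) * \<phi> l (fst z))) \<partial>P) = c l"
      using comb_integral[OF l, of c] by (simp add: sum_distrib_right mult.assoc)
    finally show ?thesis by simp
  qed
  then show ?thesis by (simp add: c)
qed

lemma sM_measurable[measurable]: "sM \<in> borel_measurable borel"
proof -
  have "sM = (\<lambda>x. \<Sum>k\<in>B. coef k * \<phi> k x)" by (simp add: sM_eq fun_eq_iff)
  then show ?thesis by simp
qed

text \<open>Each coefficient is at most \<open>A\<close> times the \<open>L1\<close> norm of its
  basis function, and \<open>C2\<close> bounds the resulting kernel. Without such a dimension-free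
  bound, the residual \<open>\<zeta>\<close> would not be bounded uniformly over the models.\<close>

lemma sM_le: "\<bar>sM x\<bar> \<le> A * C2"
proof -
  have "\<bar>coef k\<bar> \<le> A * (\<integral>z. \<bar>\<phi> k z\<bar> \<partial>design_law P)" if k: "k \<in> B" for k
  proof -
    have "\<bar>coef k\<bar> \<le> (\<integral>z. \<bar>s0 (fst z) * \<phi> k (fst z)\<bar> \<partial>P)"
      unfolding coef_def by (rule integral_abs_bound)
    also have "\<dots> \<le> (\<integral>z. A * \<bar>\<phi> k (fst z)\<bar> \<partial>P)"
    proof (rule integral_mono_AE)
      show "AE z in P. \<bar>s0 (fst z) * \<phi> k (fst z)\<bar> \<le> A * \<bar>\<phi> k (fst z)\<bar>"
        using s0_bounded by eventually_elim (auto simp: abs_mult intro!: mult_right_mono)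
    qed (use k in \<open>auto intro!: integrable_abs s0_\<phi>_integrable \<phi>_integrable\<close>)
    also have "\<dots> = A * (\<integral>z. \<bar>\<phi> k z\<bar> \<partial>design_law P)" by (simp add: integral_design)
    finally show ?thesis .
  qed
  then have "\<bar>sM x\<bar> \<le> (\<Sum>k\<in>B. A * (\<integral>z. \<bar>\<phi> k z\<bar> \<partial>design_law P) * \<bar>\<phi> k x\<bar>)"
    unfolding sM_eq by (intro order_trans[OF sum_abs] sum_mono) (auto simp: abs_mult intro!: mult_right_mono)
  also have "\<dots> = A * (\<Sum>k\<in>B. \<bar>\<phi> k x\<bar> * (\<integral>z. \<bar>\<phi> k z\<bar> \<partial>design_law P))"
    by (simp add: sum_distrib_left mult_ac)
  also have "\<dots> \<le> A * C2" using basis.projector_le[of x] A_pos by (intro mult_left_mono) auto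
  finally show ?thesis .
qed

definition \<zeta> :: "real \<times> real \<Rightarrow> real" where "\<zeta> z = snd z - sM (fst z)"

definition K0 :: real where "K0 = A * (1 + C2)"

lemma K0_pos: "0 < K0" and A_le_K0: "A \<le> K0"
  using A_pos C2_nonneg by (auto simp: K0_def intro!: mult_pos_pos)

lemma \<zeta>_measurable[measurable]: "\<zeta> \<in> borel_measurable borel"
  unfolding \<zeta>_def[abs_def] by measurable

lemma \<zeta>_bounded: "AE z in P. \<bar>\<zeta> z\<bar> \<le> K0"
  using response_bounded
proof eventually_elim
  case (elim z)
  then show ?case using sM_le[of "fst z"] by (simp add: \<zeta>_def K0_def distrib_left)
qed

lemma s0_sM_bounded: "AE z in P. \<bar>s0 (fst z) - sM (fst z)\<bar> \<le> K0"
  using s0_bounded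
proof eventually_elim
  case (elim z)
  then show ?case using sM_le[of "fst z"] by (simp add: K0_def distrib_left)
qed

lemma noise_bounded: "AE z in P. \<bar>snd z - s0 (fst z)\<bar> \<le> 2 * A"
  using s0_bounded response_bounded by eventually_elim auto

lemma \<zeta>_\<phi>_bounded: "k \<in> B \<Longrightarrow> AE z in P. \<bar>\<zeta> z * \<phi> k (fst z)\<bar> \<le> K0 * sqrt (C1 * D)"
  using \<zeta>_bounded by (rule eventually_mono) (use \<phi>_le K0_pos in \<open>auto simp: abs_mult intro!: mult_mono\<close>)

lemma \<zeta>_\<phi>_integrable: "k \<in> B \<Longrightarrow> integrable P (\<lambda>z. \<zeta> z * \<phi> k (fst z))"
  by (rule P.integrable_AE_bounded[OF _ \<zeta>_\<phi>_bounded]) measurable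

text \<open>The noise is orthogonal to functions of the design, and \<open>s0 - sM\<close> is
  orthogonal to the model.\<close>

lemma \<zeta>_centered:
  assumes k: "k \<in> B"
  shows "(\<integral>z. \<zeta> z * \<phi> k (fst z) \<partial>P) = 0"
proof -
  have "AE z in P. \<bar>(snd z - s0 (fst z)) * \<phi> k (fst z)\<bar> \<le> 2 * A * sqrt (C1 * D)"
    using noise_bounded by eventually_elim (use \<phi>_le[OF k] A_pos in \<open>auto simp: abs_mult intro!: mult_mono\<close>)
  then have i1: "integrable P (\<lambda>z. (snd z - s0 (fst z)) * \<phi> k (fst z))"
    by (rule P.integrable_AE_bounded[rotated]) measurable
  have i2: "integrable P (\<lambda>z. sM (fst z) * \<phi> k (fst z))"
    using \<phi>_le[OF k] sM_le
    by (intro P.integrable_AE_bounded[where b="A * C2 * sqrt (C1 * D)"]) (auto simp: abs_mult intro!: mult_mono C2_nonneg mult_nonneg_nonneg less_imp_le[OF A_pos])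
  have "(\<integral>z. \<zeta> z * \<phi> k (fst z) \<partial>P)
     = (\<integral>z. (snd z - s0 (fst z)) * \<phi> k (fst z) + (s0 (fst z) * \<phi> k (fst z) - sM (fst z) * \<phi> k (fst z)) \<partial>P)"
    by (simp add: \<zeta>_def algebra_simps)
  also have "\<dots> = (\<integral>z. (snd z - s0 (fst z)) * \<phi> k (fst z) \<partial>P) + (coef k - (\<integral>z. sM (fst z) * \<phi> k (fst z) \<partial>P))"
    unfolding coef_def using i1 i2 s0_\<phi>_integrable[OF k] by simp
  also have "(\<integral>z. sM (fst z) * \<phi> k (fst z) \<partial>P) = coef k"
    using comb_integral[OF k, of coef] by (simp add: sM_eq)
  also have "(\<integral>z. (snd z - s0 (fst z)) * \<phi> k (fst z) \<partial>P) = 0"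
    using \<phi>_le[OF k] by (intro noise_centered[where b="sqrt (C1 * D)"]) auto
  finally show ?thesis by simp
qed

text \<open>\<open>V / n\<close> is the mean of the squared norm of the score vector
  \<open>chi2\<close>, the off-diagonal terms being centered; it is the common center of all later
  concentration statements.\<close>

definition V :: real where "V = (\<integral>z. (\<zeta> z)\<^sup>2 * (\<Sum>k\<in>B. (\<phi> k (fst z))\<^sup>2) \<partial>P)"

lemma sum_\<phi>_sq_integral: "(\<integral>z. (\<Sum>k\<in>B. (\<phi> k (fst z))\<^sup>2) \<partial>P) = D"
proof -
  have "(\<integral>z. (\<Sum>k\<in>B. (\<phi> k (fst z))\<^sup>2) \<partial>P) = (\<Sum>k\<in>B. \<integral>z. \<phi> k (fst z) * \<phi> k (fst z) \<partial>P)"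
    using \<phi>_mult_integrable by (subst Bochner_Integration.integral_sum) (auto simp: power2_eq_square)
  also have "\<dots> = D" by (simp add: \<phi>_orthonormal D_def)
  finally show ?thesis .
qed

lemma diag_bounds: "AE z in P. 0 \<le> (\<zeta> z)\<^sup>2 * (\<Sum>k\<in>B. (\<phi> k (fst z))\<^sup>2) \<and>
    (\<zeta> z)\<^sup>2 * (\<Sum>k\<in>B. (\<phi> k (fst z))\<^sup>2) \<le> K0\<^sup>2 * (\<Sum>k\<in>B. (\<phi> k (fst z))\<^sup>2)"
  using \<zeta>_bounded
proof eventually_elim
  case (elim z)
  then have "(\<zeta> z)\<^sup>2 \<le> K0\<^sup>2" using K0_pos by (simp add: abs_le_square_iff[symmetric])
  then show ?case by (auto intro!: mult_right_mono mult_nonneg_nonneg sum_nonneg)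
qed

lemma diag_bounded: "AE z in P. \<bar>(\<zeta> z)\<^sup>2 * (\<Sum>k\<in>B. (\<phi> k (fst z))\<^sup>2)\<bar> \<le> K0\<^sup>2 * (C1 * D)"
  using diag_bounds
proof eventually_elim
  case (elim z)
  have "K0\<^sup>2 * (\<Sum>k\<in>B. (\<phi> k (fst z))\<^sup>2) \<le> K0\<^sup>2 * (C1 * D)" by (intro mult_left_mono sum_\<phi>_sq_le) simp
  then show ?case using elim by linarith
qed

lemma diag_integrable: "integrable P (\<lambda>z. (\<zeta> z)\<^sup>2 * (\<Sum>k\<in>B. (\<phi> k (fst z))\<^sup>2))"
  by (rule P.integrable_AE_bounded[OF _ diag_bounded]) measurable

lemma sum_\<phi>_sq_integrable: "integrable P (\<lambda>z. \<Sum>k\<in>B. (\<phi> k (fst z))\<^sup>2)"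
  by (rule Bochner_Integration.integrable_sum) (use \<phi>_mult_integrable in \<open>simp add: power2_eq_square\<close>)

lemma V_upper: "V \<le> K0\<^sup>2 * D"
proof -
  have "V \<le> (\<integral>z. K0\<^sup>2 * (\<Sum>k\<in>B. (\<phi> k (fst z))\<^sup>2) \<partial>P)"
    unfolding V_def
  proof (rule integral_mono_AE[OF diag_integrable])
    show "integrable P (\<lambda>z. K0\<^sup>2 * (\<Sum>k\<in>B. (\<phi> k (fst z))\<^sup>2))"
      by (rule integrable_mult_right, rule sum_\<phi>_sq_integrable)
    show "AE z in P. (\<zeta> z)\<^sup>2 * (\<Sum>k\<in>B. (\<phi> k (fst z))\<^sup>2) \<le> K0\<^sup>2 * (\<Sum>k\<in>B. (\<phi> k (fst z))\<^sup>2)"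
      using diag_bounds by (rule eventually_mono) (rule conjunct2)
  qed
  then show ?thesis by (simp add: sum_\<phi>_sq_integral)
qed

text \<open>Write \<open>\<zeta>\<close> as noise plus \<open>s0 - sM\<close>. The cross term
  integrates to zero, the squared bias part is dropped, and the noise part is at least
  \<open>smin^2 * D\<close> by the variance condition.\<close>

lemma V_lower: "smin\<^sup>2 * D \<le> V"
proof -
  let ?g = "\<lambda>x. \<Sum>k\<in>B. (\<phi> k x)\<^sup>2"
  let ?u = "\<lambda>z. (snd z - s0 (fst z))\<^sup>2 * ?g (fst z)"
  let ?c = "\<lambda>z. (snd z - s0 (fst z)) * (2 * (s0 (fst z) - sM (fst z)) * ?g (fst z))"
  have gb: "0 \<le> ?g x" "?g x \<le> C1 * D" for x by (simp add: sum_nonneg, rule sum_\<phi>_sq_le)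
  have bd2: "AE z in P. \<bar>2 * (s0 (fst z) - sM (fst z)) * ?g (fst z)\<bar> \<le> 2 * K0 * (C1 * D)"
    using s0_sM_bounded by eventually_elim (use gb K0_pos in \<open>auto simp: abs_mult intro!: mult_mono\<close>)
  have iu: "integrable P ?u"
  proof (rule P.integrable_AE_bounded)
    show "AE z in P. \<bar>?u z\<bar> \<le> (2 * A)\<^sup>2 * (C1 * D)"
      using noise_bounded
    proof eventually_elim
      case (elim z)
      then have "(snd z - s0 (fst z))\<^sup>2 \<le> (2 * A)\<^sup>2" by (rule sq_le_sq)
      then show ?case using gb[of "fst z"] by (auto simp: abs_mult intro!: mult_mono)
    qed
  qed measurable
  have ic: "integrable P ?c"
  proof (rule P.integrable_AE_bounded)
    show "AE z in P. \<bar>?c z\<bar> \<le> 2 * A * (2 * K0 * (C1 * D))"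
      using noise_bounded bd2 by eventually_elim (subst abs_mult, intro mult_mono, use A_pos in auto)
  qed measurable
  have "smin\<^sup>2 * D \<le> (\<integral>z. ?u z \<partial>P)"
    using noise_variance[of ?g "C1 * D"] gb by (simp add: sum_\<phi>_sq_integral)
  also have "\<dots> = (\<integral>z. ?u z + ?c z \<partial>P)"
    using iu ic noise_centered[of "\<lambda>x. 2 * (s0 x - sM x) * ?g x", OF _ bd2] by simp
  also have "\<dots> \<le> V" unfolding V_def
  proof (rule integral_mono)
    fix z
    have "(\<zeta> z)\<^sup>2 * ?g (fst z) - (?u z + ?c z) = (s0 (fst z) - sM (fst z))\<^sup>2 * ?g (fst z)"
      by (simp add: \<zeta>_def power2_eq_square algebra_simps)
    then show "?u z + ?c z \<le> (\<zeta> z)\<^sup>2 * ?g (fst z)"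
      using gb(1)[of "fst z"] by (metis diff_ge_0_iff_ge mult_nonneg_nonneg zero_le_power2)
  qed (use iu ic diag_integrable in auto)
  finally show ?thesis .
qed

section \<open>Loss differences and the excess loss in coordinates\<close>

definition loss_diff :: "real \<times> real \<Rightarrow> real" where "loss_diff z = contrast sM z - contrast s0 z"

definition bias :: real where "bias = excess_loss P s0 sM"

lemma loss_diff_eq: "loss_diff z = (s0 (fst z) - sM (fst z)) * ((snd z - s0 (fst z)) + \<zeta> z)"
  by (cases z) (simp add: loss_diff_def contrast_def \<zeta>_def power2_eq_square algebra_simps)

lemma loss_diff_measurable[measurable]: "loss_diff \<in> borel_measurable borel"
  unfolding loss_diff_eq[abs_def] by measurable

lemma loss_diff_le: "AE z in P. \<bar>loss_diff z\<bar> \<le> 3 * K0 * \<bar>s0 (fst z) - sM (fst z)\<bar>"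
  using noise_bounded \<zeta>_bounded
proof eventually_elim
  case (elim z)
  then have "\<bar>(snd z - s0 (fst z)) + \<zeta> z\<bar> \<le> 3 * K0" using A_le_K0 by auto
  from mult_left_mono[OF this, of "\<bar>s0 (fst z) - sM (fst z)\<bar>"]
  show ?case unfolding loss_diff_eq abs_mult by (simp add: mult_ac)
qed

lemma loss_diff_bounded: "AE z in P. \<bar>loss_diff z\<bar> \<le> 3 * K0\<^sup>2"
  using loss_diff_le s0_sM_bounded
proof eventually_elim
  case (elim z)
  have "3 * K0 * \<bar>s0 (fst z) - sM (fst z)\<bar> \<le> 3 * K0 * K0" using elim(2) K0_pos by (intro mult_left_mono) auto
  then show ?case using elim(1) by (simp add: power2_eq_square)
qed

lemma loss_diff_integrable: "integrable P loss_diff"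
  by (rule P.integrable_AE_bounded[OF _ loss_diff_bounded]) measurable

lemma bias_eq_integral: "bias = (\<integral>z. loss_diff z \<partial>P)"
  by (simp add: bias_def excess_loss_def loss_diff_def)

text \<open>The cross term is the noise times a bounded function of the design, hence has mean
  zero.\<close>

lemma excess_loss_eq:
  assumes [measurable]: "s \<in> borel_measurable borel" and bd: "\<And>x. \<bar>s x\<bar> \<le> b"
  shows "excess_loss P s0 s = (\<integral>z. (s (fst z) - s0 (fst z))\<^sup>2 \<partial>P)"
    and "integrable P (\<lambda>z. (s (fst z) - s0 (fst z))\<^sup>2)"
proof -
  have b2: "AE z in P. \<bar>s (fst z) - s0 (fst z)\<bar> \<le> b + A"
    using s0_bounded
  proof eventually_elim
    case (elim z)
    then show ?case using bd[of "fst z"] by linarith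
  qed
  then have "AE z in P. \<bar>2 * (s0 (fst z) - s (fst z))\<bar> \<le> 2 * (b + A)" by eventually_elim auto
  note b3 = this
  show i1: "integrable P (\<lambda>z. (s (fst z) - s0 (fst z))\<^sup>2)"
  proof (rule P.integrable_AE_bounded)
    show "AE z in P. \<bar>(s (fst z) - s0 (fst z))\<^sup>2\<bar> \<le> (b + A)\<^sup>2"
      using b2 by eventually_elim (auto simp: abs_le_square_iff[symmetric])
  qed measurable
  have i2: "integrable P (\<lambda>z. (snd z - s0 (fst z)) * (2 * (s0 (fst z) - s (fst z))))"
  proof (rule P.integrable_AE_bounded)
    show "AE z in P. \<bar>(snd z - s0 (fst z)) * (2 * (s0 (fst z) - s (fst z)))\<bar> \<le> 2 * A * (2 * (b + A))"
      using noise_bounded b3 by eventually_elim (subst abs_mult, intro mult_mono, use A_pos in auto)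
  qed measurable
  have "excess_loss P s0 s = (\<integral>z. (s (fst z) - s0 (fst z))\<^sup>2 + (snd z - s0 (fst z)) * (2 * (s0 (fst z) - s (fst z))) \<partial>P)"
    unfolding excess_loss_def by (intro Bochner_Integration.integral_cong refl) (auto simp: contrast_def power2_eq_square algebra_simps)
  also have "\<dots> = (\<integral>z. (s (fst z) - s0 (fst z))\<^sup>2 \<partial>P)"
    using i1 i2 noise_centered[of "\<lambda>x. 2 * (s0 x - s x)", OF _ b3] by simp
  finally show "excess_loss P s0 s = (\<integral>z. (s (fst z) - s0 (fst z))\<^sup>2 \<partial>P)" .
qed

lemma bias_eq: "bias = (\<integral>z. (sM (fst z) - s0 (fst z))\<^sup>2 \<partial>P)"
  unfolding bias_def by (rule excess_loss_eq[OF _ sM_le]) simp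

lemma bias_nonneg: "0 \<le> bias"
  unfolding bias_eq by simp

lemma bias_le: "bias \<le> K0\<^sup>2"
  unfolding bias_eq using s0_sM_bounded by (intro P.expectation_sq_le) (auto simp: abs_minus_commute)

text \<open>The loss difference is \<open>s0 - sM\<close> times a bounded factor, so its second
  moment is controlled by its own mean \<open>bias\<close>. Bernstein's inequality then yields
  fluctuations proportional to the bias.\<close>

lemma loss_diff_second_moment: "(\<integral>z. (loss_diff z)\<^sup>2 \<partial>P) \<le> 9 * K0\<^sup>2 * bias"
proof -
  have "(\<integral>z. (loss_diff z)\<^sup>2 \<partial>P) \<le> (\<integral>z. 9 * K0\<^sup>2 * (sM (fst z) - s0 (fst z))\<^sup>2 \<partial>P)"
  proof (rule integral_mono_AE)
    show "integrable P (\<lambda>z. (loss_diff z)\<^sup>2)"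
    proof (rule P.integrable_AE_bounded)
      show "AE z in P. \<bar>(loss_diff z)\<^sup>2\<bar> \<le> (3 * K0\<^sup>2)\<^sup>2"
        using loss_diff_bounded by eventually_elim (simp only: abs_power2 sq_le_sq)
    qed measurable
    show "integrable P (\<lambda>z. 9 * K0\<^sup>2 * (sM (fst z) - s0 (fst z))\<^sup>2)"
      using excess_loss_eq(2)[OF sM_measurable sM_le] by simp
    show "AE z in P. (loss_diff z)\<^sup>2 \<le> 9 * K0\<^sup>2 * (sM (fst z) - s0 (fst z))\<^sup>2"
      using loss_diff_le
    proof eventually_elim
      case (elim z)
      then have "\<bar>loss_diff z\<bar> \<le> \<bar>3 * K0 * (s0 (fst z) - sM (fst z))\<bar>" using K0_pos by (simp add: abs_mult)
      then have "(loss_diff z)\<^sup>2 \<le> (3 * K0 * (s0 (fst z) - sM (fst z)))\<^sup>2" by (simp only: abs_le_square_iff)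
      then show ?case by (simp add: power_mult_distrib power2_commute)
    qed
  qed
  then show ?thesis by (simp add: bias_eq)
qed

text \<open>Pythagoras splits off the bias and Parseval evaluates the rest, so the excess loss is a
  function of the coefficients alone.\<close>

lemma excess_loss_comb:
  "excess_loss P s0 (\<lambda>x. \<Sum>k\<in>B. c k * \<phi> k x) = bias + (\<Sum>k\<in>B. (c k - coef k)\<^sup>2)"
proof -
  let ?s = "\<lambda>x. \<Sum>k\<in>B. c k * \<phi> k x"
  let ?d = "\<lambda>x. \<Sum>k\<in>B. (c k - coef k) * \<phi> k x"
  have s: "?s x = sM x + ?d x" for x by (simp add: sM_eq left_diff_distrib sum_subtractf)
  have "\<bar>?s x\<bar> \<le> (\<Sum>k\<in>B. \<bar>c k\<bar> * sqrt (C1 * D))" for x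
    using \<phi>_le by (intro order_trans[OF sum_abs] sum_mono) (auto simp: abs_mult intro!: mult_left_mono)
  note sb = this
  have \<phi>d: "integrable P (\<lambda>z. (s0 (fst z) - sM (fst z)) * \<phi> k (fst z))"
      "(\<integral>z. (s0 (fst z) - sM (fst z)) * \<phi> k (fst z) \<partial>P) = 0" if k: "k \<in> B" for k
  proof -
    have i2: "integrable P (\<lambda>z. sM (fst z) * \<phi> k (fst z))"
      using \<phi>_le[OF k] sM_le
      by (intro P.integrable_AE_bounded[where b="A * C2 * sqrt (C1 * D)"]) (auto simp: abs_mult intro!: mult_mono C2_nonneg mult_nonneg_nonneg less_imp_le[OF A_pos])
    show "integrable P (\<lambda>z. (s0 (fst z) - sM (fst z)) * \<phi> k (fst z))"
      "(\<integral>z. (s0 (fst z) - sM (fst z)) * \<phi> k (fst z) \<partial>P) = 0"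
      using i2 s0_\<phi>_integrable[OF k] comb_integral[OF k, of coef]
      by (simp_all add: left_diff_distrib coef_def[symmetric] sM_eq[symmetric])
  qed
  have dd_int: "integrable P (\<lambda>z. (c k - coef k) * (c l - coef l) * (\<phi> k (fst z) * \<phi> l (fst z)))" if "k \<in> B" "l \<in> B" for k l
    using \<phi>_mult_integrable[OF that] by simp
  have dsq: "(?d x)\<^sup>2 = (\<Sum>k\<in>B. \<Sum>l\<in>B. (c k - coef k) * (c l - coef l) * (\<phi> k x * \<phi> l x))" for x
    unfolding power2_eq_square sum_product by (intro sum.cong refl) (simp add: mult_ac)
  have "(\<integral>z. (?d (fst z))\<^sup>2 \<partial>P) = (\<Sum>k\<in>B. \<Sum>l\<in>B. (c k - coef k) * (c l - coef l) * (if k = l then 1 else 0))"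
    unfolding dsq using dd_int by (simp add: Bochner_Integration.integral_sum \<phi>_mult_integrable \<phi>_orthonormal)
  also have "\<dots> = (\<Sum>k\<in>B. \<Sum>l\<in>B. if l = k then (c k - coef k)\<^sup>2 else 0)"
    by (intro sum.cong refl) (auto simp: power2_eq_square)
  also have "\<dots> = (\<Sum>k\<in>B. (c k - coef k)\<^sup>2)" by (intro sum.cong refl) simp
  finally have I2: "(\<integral>z. (?d (fst z))\<^sup>2 \<partial>P) = (\<Sum>k\<in>B. (c k - coef k)\<^sup>2)" .
  have i2: "integrable P (\<lambda>z. (?d (fst z))\<^sup>2)" unfolding dsq using dd_int by simp
  have cr: "(s0 (fst z) - sM (fst z)) * ?d (fst z) = (\<Sum>k\<in>B. (c k - coef k) * ((s0 (fst z) - sM (fst z)) * \<phi> k (fst z)))" for z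
    by (simp add: sum_distrib_left mult_ac)
  have i3: "integrable P (\<lambda>z. (s0 (fst z) - sM (fst z)) * ?d (fst z))"
    "(\<integral>z. (s0 (fst z) - sM (fst z)) * ?d (fst z) \<partial>P) = 0"
    unfolding cr using \<phi>d by (simp_all add: Bochner_Integration.integral_sum)
  have "excess_loss P s0 ?s = (\<integral>z. (?s (fst z) - s0 (fst z))\<^sup>2 \<partial>P)"
    by (rule excess_loss_eq[OF _ sb]) simp
  also have "\<dots> = (\<integral>z. ((sM (fst z) - s0 (fst z))\<^sup>2 + (?d (fst z))\<^sup>2) - 2 * ((s0 (fst z) - sM (fst z)) * ?d (fst z)) \<partial>P)"
    by (intro Bochner_Integration.integral_cong refl) (simp only: s, simp add: power2_eq_square algebra_simps)
  also have "\<dots> = bias + (\<Sum>k\<in>B. (c k - coef k)\<^sup>2)"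
    using excess_loss_eq(2)[OF sM_measurable sM_le] i2 i3 I2 by (simp add: bias_eq)
  finally show ?thesis .
qed

end

section \<open>Deviation bounds for one model\<close>

lemma (in prob_space) prob_UN_le:
  fixes b :: real
  assumes "finite I" and E: "\<And>i. i \<in> I \<Longrightarrow> E i \<in> events" "\<And>i. i \<in> I \<Longrightarrow> prob (E i) \<le> b"
  shows "prob (\<Union>i\<in>I. E i) \<le> card I * b"
proof -
  have "prob (\<Union>i\<in>I. E i) \<le> (\<Sum>i\<in>I. prob (E i))"
    using assms by (intro finite_measure_subadditive_finite) auto
  also have "\<dots> \<le> card I * b" using E(2) by (rule sum_bounded_above)
  finally show ?thesis .
qed

text \<open>The conditions \<open>n1\<close> to \<open>n5\<close> are the constraints
  \<open>\<mu> * b \<le> 1\<close> of the five exponential bounds below (for \<open>T\<close>,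
  \<open>gram\<close>, \<open>offdiag\<close>, \<open>diag\<close> and \<open>dbar\<close>, in this
  order), and \<open>n6\<close> makes the Gram perturbation at most \<open>1 / 2\<close>. With
  \<open>4 \<le> \<kappa>\<close>, a single event fails with probability of order
  \<open>n^(-4)\<close>.\<close>

locale large_sample_model = regression_model \<Omega> n Z P B \<phi> M C1 C2 R s0 sM A smin
  for \<Omega> :: "'w measure" and n Z P and B :: "'k set" and \<phi> M C1 C2 R s0 sM A smin +
  fixes \<kappa> a L :: real
  assumes L_def: "L = ln (real n)" and L_ge_1: "1 \<le> L" and \<kappa>_ge: "4 \<le> \<kappa>" and a_pos: "0 < a"
    and D_le: "D \<le> a * real n / L\<^sup>2" and D_le_n: "D \<le> real n" and L_sq_le: "L\<^sup>2 \<le> real n"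
    and n1: "K0\<^sup>2 * C1 * a \<le> L"
    and n2: "((C1 + 1) * a)\<^sup>2 \<le> L"
    and n3: "(K0 * sqrt C1 * (K0\<^sup>2 + \<kappa>)) * sqrt (L / n) \<le> 1"
    and n4: "K0\<^sup>2 * C1 * sqrt (L / n) \<le> 1"
    and n5: "6 * K0\<^sup>2 \<le> L"
    and n6: "2 * R * (C1 * a + \<kappa>) \<le> sqrt L"
begin

lemma \<kappa>_pos: "0 < \<kappa>" using \<kappa>_ge by simp

lemma P_UNIV[simp]: "P.prob UNIV = 1"
  using P.prob_space by simp

definition w :: real where "w = 1 / sqrt L"

lemma w_pos: "0 < w" and w_le_1: "w \<le> 1" and w_sq: "w\<^sup>2 = 1 / L" and w_sqrt: "w * sqrt L = 1"
  using L_ge_1 by (auto simp: w_def power_divide)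

definition T :: "nat \<Rightarrow> 'k \<Rightarrow> 'w \<Rightarrow> real" where
  "T m k \<omega> = (\<Sum>i=1..m. \<zeta> (Z i \<omega>) * \<phi> k (fst (Z i \<omega>)))"

text \<open>The threshold produced by \<open>bernstein\<close> with
  \<open>\<mu> = sqrt (L / n)\<close>, variance bound \<open>K0^2\<close> and
  \<open>x = \<kappa> * L\<close>.\<close>

definition \<tau> :: real where "\<tau> = (K0\<^sup>2 + \<kappa>) * sqrt (n * L)"

lemma \<tau>_nonneg: "0 \<le> \<tau>"
  using \<kappa>_pos L_ge_1 by (simp add: \<tau>_def)

lemma n_real_pos: "0 < real n" using n_pos by simp

lemma sqrt_L_n: "0 < sqrt (L / n)" "n * sqrt (L / n) = sqrt (n * L)" "L / sqrt (L / n) = sqrt (n * L)"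
  "sqrt (L / n) * sqrt (n * L) = L"
proof -
  show "0 < sqrt (L / n)" using L_ge_1 n_real_pos by simp
  have "n * sqrt (L / n) = sqrt (real n * real n) * sqrt (L / n)" by simp
  also have "\<dots> = sqrt (n * L)" unfolding real_sqrt_mult[symmetric] using n_real_pos by simp
  finally show 1: "n * sqrt (L / n) = sqrt (n * L)" .
  have "sqrt (L / n) * sqrt (n * L) = sqrt (L * L)"
    unfolding real_sqrt_mult[symmetric] using n_real_pos by simp
  then show 2: "sqrt (L / n) * sqrt (n * L) = L" using L_ge_1 by simp
  have "sqrt (L / n) \<noteq> 0" using L_ge_1 n_real_pos by simp
  then show "L / sqrt (L / n) = sqrt (n * L)" using 2 by (metis nonzero_mult_div_cancel_left)
qed

lemma T_measurable: "m \<le> n \<Longrightarrow> T m k \<in> borel_measurable \<Omega>"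
  unfolding T_def[abs_def] using Z_measurable
  by (intro borel_measurable_sum) (auto intro!: borel_measurable_times measurable_compose[OF Z_measurable])

text \<open>Needed at all times \<open>m\<close>, not only at \<open>n\<close>: together these
  bounds make the truncation in \<open>offdiag\<close> inactive with high probability.\<close>

lemma T_tail:
  assumes k: "k \<in> B" and m: "m \<le> n"
  shows "prob {\<omega>\<in>space \<Omega>. \<tau> < \<bar>T m k \<omega>\<bar>} \<le> 2 * exp (- (\<kappa> * L))"
proof -
  let ?\<mu> = "sqrt (L / n)"
  have "real n * ?\<mu> * K0\<^sup>2 + \<kappa> * L / ?\<mu> = \<tau>"
  proof -
    have "real n * ?\<mu> * K0\<^sup>2 + \<kappa> * L / ?\<mu> = (n * ?\<mu>) * K0\<^sup>2 + \<kappa> * (L / ?\<mu>)" by simp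
    then show ?thesis unfolding sqrt_L_n by (simp add: \<tau>_def algebra_simps)
  qed
  moreover have "prob {\<omega>\<in>space \<Omega>. real n * ?\<mu> * K0\<^sup>2 + \<kappa> * L / ?\<mu> <
      \<bar>\<Sum>i=1..m. \<zeta> (Z i \<omega>) * \<phi> k (fst (Z i \<omega>))\<bar>} \<le> 2 * exp (- (\<kappa> * L))"
  proof (rule bernstein[OF _ \<zeta>_\<phi>_bounded[OF k] \<zeta>_centered[OF k]])
    show "(\<lambda>z. \<zeta> z * \<phi> k (fst z)) \<in> borel_measurable borel" by measurable
    have "(\<integral>z. (\<zeta> z * \<phi> k (fst z))\<^sup>2 \<partial>P) \<le> (\<integral>z. K0\<^sup>2 * (\<phi> k (fst z) * \<phi> k (fst z)) \<partial>P)"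
    proof (rule integral_mono_AE)
      show "integrable P (\<lambda>z. (\<zeta> z * \<phi> k (fst z))\<^sup>2)"
      proof (rule P.integrable_AE_bounded)
        show "AE z in P. \<bar>(\<zeta> z * \<phi> k (fst z))\<^sup>2\<bar> \<le> (K0 * sqrt (C1 * D))\<^sup>2"
          using \<zeta>_\<phi>_bounded[OF k] by eventually_elim (simp only: abs_power2 sq_le_sq)
      qed measurable
      show "integrable P (\<lambda>z. K0\<^sup>2 * (\<phi> k (fst z) * \<phi> k (fst z)))"
        using \<phi>_mult_integrable[OF k k] by simp
      show "AE z in P. (\<zeta> z * \<phi> k (fst z))\<^sup>2 \<le> K0\<^sup>2 * (\<phi> k (fst z) * \<phi> k (fst z))"
        using \<zeta>_bounded
      proof eventually_elim
        case (elim z)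
        then show ?case using mult_right_mono[OF sq_le_sq[OF elim], of "(\<phi> k (fst z))\<^sup>2"]
          by (simp add: power2_eq_square mult_ac)
      qed
    qed
    also have "\<dots> = K0\<^sup>2" using k by (simp add: \<phi>_orthonormal)
    finally show "(\<integral>z. (\<zeta> z * \<phi> k (fst z))\<^sup>2 \<partial>P) \<le> K0\<^sup>2" .
    \<comment> \<open>The increments may be as large as \<open>sqrt D\<close>; the dimension bound
      makes the square of the left side at most \<open>K0^2 C1 a / L\<close>.\<close>
    show "?\<mu> * (K0 * sqrt (C1 * D)) \<le> 1"
    proof (rule power2_le_imp_le)
      have "(?\<mu> * (K0 * sqrt (C1 * D)))\<^sup>2 = (K0\<^sup>2 * C1 * L / n) * D"
        using L_ge_1 n_real_pos C1_nonneg D_ge_1 by (simp add: power_mult_distrib)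
      also have "\<dots> \<le> (K0\<^sup>2 * C1 * L / n) * (a * real n / L\<^sup>2)"
        using C1_nonneg L_ge_1 by (intro mult_left_mono D_le) simp
      also have "\<dots> = K0\<^sup>2 * C1 * a / L"
        using n_real_pos L_ge_1 by (simp add: field_simps power2_eq_square)
      also have "\<dots> \<le> 1" using n1 L_ge_1 by simp
      finally show "(?\<mu> * (K0 * sqrt (C1 * D)))\<^sup>2 \<le> 1\<^sup>2" by simp
    qed simp
  qed (use m sqrt_L_n(1) in auto)
  ultimately show ?thesis by (simp add: T_def)
qed

definition gram :: "'k \<Rightarrow> 'k \<Rightarrow> 'w \<Rightarrow> real" where
  "gram k l \<omega> = (\<Sum>i=1..n. \<phi> k (fst (Z i \<omega>)) * \<phi> l (fst (Z i \<omega>))) / n"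

definition \<epsilon>0 :: real where "\<epsilon>0 = (C1 * a + \<kappa>) * w"

lemma gram_measurable: "gram k l \<in> borel_measurable \<Omega>"
  unfolding gram_def[abs_def]
  by (intro borel_measurable_divide borel_measurable_sum borel_measurable_const borel_measurable_times
      measurable_compose[OF measurable_compose[OF Z_measurable pair_measurable(1)] basis.\<phi>_measurable])

lemma gram_tail:
  assumes k: "k \<in> B" and l: "l \<in> B"
  shows "prob {\<omega>\<in>space \<Omega>. \<epsilon>0 < \<bar>gram k l \<omega> - (if k = l then 1 else 0)\<bar>} \<le> 2 * exp (- (\<kappa> * L))"
proof -
  let ?\<delta> = "if k = l then 1 else 0 :: real"
  let ?h = "\<lambda>z :: real \<times> real. \<phi> k (fst z) * \<phi> l (fst z) - ?\<delta>"
  \<comment> \<open>The variance is at most \<open>C1 * D\<close>, hence of order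
    \<open>n / L^2\<close>; with this choice both \<open>n \<mu> v\<close> and
    \<open>\<kappa> L / \<mu>\<close> are of order \<open>n / sqrt L\<close>.\<close>
  let ?\<mu> = "L * sqrt L / n"
  let ?t = "real n * ?\<mu> * (C1 * D) + \<kappa> * L / ?\<mu>"
  have L0: "0 < L" "0 < sqrt L" "sqrt L * sqrt L = L" using L_ge_1 by auto
  have hm: "?h \<in> borel_measurable borel"
    by (intro borel_measurable_diff borel_measurable_times borel_measurable_const
        measurable_compose[OF pair_measurable(1) basis.\<phi>_measurable])
  have DL: "C1 * D * L\<^sup>2 \<le> C1 * a * n"
  proof -
    have "D * L\<^sup>2 \<le> a * n" using D_le L0 by (simp add: field_simps)
    from mult_left_mono[OF this C1_nonneg] show ?thesis by (simp add: mult_ac)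
  qed
  have t: "?t \<le> n * \<epsilon>0"
  proof -
    have "?t = L * sqrt L * (C1 * D) + \<kappa> * n / sqrt L"
      using L0 n_real_pos by (simp add: field_simps)
    also have "L * sqrt L * (C1 * D) = C1 * D * L\<^sup>2 / sqrt L"
      using L0 by (simp add: field_simps power2_eq_square)
    also have "\<dots> \<le> C1 * a * n / sqrt L" using DL L0 by (intro divide_right_mono) auto
    finally show ?thesis by (simp add: \<epsilon>0_def w_def field_simps)
  qed
  have "prob {\<omega>\<in>space \<Omega>. \<epsilon>0 < \<bar>gram k l \<omega> - ?\<delta>\<bar>} \<le> prob {\<omega>\<in>space \<Omega>. ?t < \<bar>\<Sum>i=1..n. ?h (Z i \<omega>)\<bar>}"
  proof (rule finite_measure_mono)
    show "{\<omega>\<in>space \<Omega>. \<epsilon>0 < \<bar>gram k l \<omega> - ?\<delta>\<bar>} \<subseteq> {\<omega>\<in>space \<Omega>. ?t < \<bar>\<Sum>i=1..n. ?h (Z i \<omega>)\<bar>}"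
    proof (rule Collect_mono, rule impI, elim conjE, rule conjI, assumption)
      fix \<omega> assume "\<epsilon>0 < \<bar>gram k l \<omega> - ?\<delta>\<bar>"
      then have "n * \<epsilon>0 < \<bar>n * (gram k l \<omega> - ?\<delta>)\<bar>" using n_real_pos by (simp add: abs_mult)
      also have "n * (gram k l \<omega> - ?\<delta>) = (\<Sum>i=1..n. ?h (Z i \<omega>))"
        using n_real_pos unfolding gram_def sum_subtractf by (simp add: right_diff_distrib)
      finally show "?t < \<bar>\<Sum>i=1..n. ?h (Z i \<omega>)\<bar>" using t by linarith
    qed
    have "(\<lambda>\<omega>. \<Sum>i=1..n. ?h (Z i \<omega>)) \<in> borel_measurable \<Omega>"
      by (intro borel_measurable_sum measurable_compose[OF Z_measurable hm])
    then show "{\<omega>\<in>space \<Omega>. ?t < \<bar>\<Sum>i=1..n. ?h (Z i \<omega>)\<bar>} \<in> events" by simp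
  qed
  also have "\<dots> \<le> 2 * exp (- (\<kappa> * L))"
  proof (rule bernstein)
    show "?h \<in> borel_measurable borel" by (rule hm)
    have "\<bar>?h z\<bar> \<le> (C1 + 1) * D" for z
    proof -
      have "\<bar>?h z\<bar> \<le> \<bar>\<phi> k (fst z) * \<phi> l (fst z)\<bar> + 1"
        using abs_triangle_ineq4[of "\<phi> k (fst z) * \<phi> l (fst z)" ?\<delta>] by (simp split: if_splits)
      also have "\<dots> \<le> C1 * D + D" using \<phi>_mult_le[OF k l] D_ge_1 by (intro add_mono) auto
      finally show ?thesis by (simp add: algebra_simps)
    qed
    then show "AE z in P. \<bar>?h z\<bar> \<le> (C1 + 1) * D" by simp
    show "(\<integral>z. ?h z \<partial>P) = 0"
      using \<phi>_mult_integrable[OF k l] by (simp add: \<phi>_orthonormal[OF k l])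
    have sq: "integrable P (\<lambda>z. (\<phi> k (fst z) * \<phi> l (fst z))\<^sup>2)"
      by (rule P.integrable_AE_bounded[where b="(C1 * D)\<^sup>2"]) (auto intro!: sq_le_sq \<phi>_mult_le k l)
    have "(\<integral>z. (?h z)\<^sup>2 \<partial>P) \<le> (\<integral>z. (\<phi> k (fst z) * \<phi> l (fst z))\<^sup>2 \<partial>P)"
      using P.expectation_centered_sq_le[OF \<phi>_mult_integrable[OF k l] sq] by (simp add: \<phi>_orthonormal[OF k l])
    also have "\<dots> \<le> (\<integral>z. (C1 * D) * (\<phi> l (fst z) * \<phi> l (fst z)) \<partial>P)"
    proof (rule integral_mono[OF sq])
      show "integrable P (\<lambda>z. (C1 * D) * (\<phi> l (fst z) * \<phi> l (fst z)))" using \<phi>_mult_integrable[OF l l] by simp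
      fix z
      have "(\<phi> k (fst z) * \<phi> k (fst z)) * (\<phi> l (fst z) * \<phi> l (fst z)) \<le> (C1 * D) * (\<phi> l (fst z) * \<phi> l (fst z))"
        using \<phi>_mult_le[OF k k, of "fst z"] by (intro mult_right_mono) auto
      then show "(\<phi> k (fst z) * \<phi> l (fst z))\<^sup>2 \<le> (C1 * D) * (\<phi> l (fst z) * \<phi> l (fst z))"
        by (simp add: power2_eq_square mult_ac)
    qed
    also have "\<dots> = C1 * D" by (simp add: \<phi>_orthonormal[OF l l])
    finally show "(\<integral>z. (?h z)\<^sup>2 \<partial>P) \<le> C1 * D" .
    show "0 < ?\<mu>" using L0 n_real_pos by simp
    have "(C1 + 1) * a \<le> sqrt L" using n2 by (intro real_le_rsqrt)
    then have "(C1 + 1) * a / sqrt L \<le> 1" using L0 by simp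
    moreover have "?\<mu> * ((C1 + 1) * D) \<le> (C1 + 1) * a / sqrt L"
    proof -
      have "?\<mu> * ((C1 + 1) * D) = (C1 + 1) / n * (L * sqrt L) * D" by simp
      also have "\<dots> \<le> (C1 + 1) / n * (L * sqrt L) * (a * real n / L\<^sup>2)"
        using C1_nonneg L0 by (intro mult_left_mono D_le) simp
      also have "\<dots> = (C1 + 1) * a * (sqrt L / L)"
        using L0 n_real_pos by (simp add: power2_eq_square)
      also have "sqrt L / L = 1 / sqrt L" using L0 by (simp add: field_simps)
      finally show ?thesis by simp
    qed
    ultimately show "?\<mu> * ((C1 + 1) * D) \<le> 1" by linarith
  qed simp
  finally show ?thesis .
qed

text \<open>Clipping acts on the past only, so each increment is linear in the centered variables
  \<open>\<zeta> * \<phi> k\<close> of observation \<open>j\<close> and remains centered for every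
  past.\<close>

definition offdiag :: "'w \<Rightarrow> real" where
  "offdiag \<omega> = (\<Sum>j=1..n. \<zeta> (Z j \<omega>) * (\<Sum>k\<in>B. \<phi> k (fst (Z j \<omega>)) * clip \<tau> (T (j - 1) k \<omega>)))"

definition c_off :: real where "c_off = K0\<^sup>2 * C1 * (K0\<^sup>2 + \<kappa>)\<^sup>2 + \<kappa>"

lemma offdiag_eq:
  "offdiag \<omega> = (\<Sum>j=1..n. (\<lambda>j p z. \<zeta> z * (\<Sum>k\<in>B. \<phi> k (fst z) * clip \<tau> (\<Sum>i\<in>{1..<j}. \<zeta> (p i) * \<phi> k (fst (p i))))) j
      (restrict (\<lambda>i. Z i \<omega>) {1..<j}) (Z j \<omega>))"
  unfolding offdiag_def T_def
proof (intro sum.cong refl)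
  fix j :: nat assume "j \<in> {1..n}"
  then have "{1..j - 1} = {1..<j}" by auto
  then show "\<zeta> (Z j \<omega>) * (\<Sum>k\<in>B. \<phi> k (fst (Z j \<omega>)) * clip \<tau> (\<Sum>i = 1..j - 1. \<zeta> (Z i \<omega>) * \<phi> k (fst (Z i \<omega>)))) =
    \<zeta> (Z j \<omega>) * (\<Sum>k\<in>B. \<phi> k (fst (Z j \<omega>)) * clip \<tau> (\<Sum>i\<in>{1..<j}. \<zeta> (restrict (\<lambda>i. Z i \<omega>) {1..<j} i) * \<phi> k (fst (restrict (\<lambda>i. Z i \<omega>) {1..<j} i))))"
    by simp
qed

lemma offdiag_step_measurable:
  "(\<lambda>(p, z). \<zeta> z * (\<Sum>k\<in>B. \<phi> k (fst z) * clip \<tau> (\<Sum>i\<in>{1..<j}. \<zeta> (p i) * \<phi> k (fst (p i)))))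
     \<in> borel_measurable (PiM {1..<j} (\<lambda>_. P) \<Otimes>\<^sub>M P)"
proof -
  have p: "(\<lambda>x. fst x i) \<in> measurable (PiM {1..<j} (\<lambda>_. P) \<Otimes>\<^sub>M P) borel" if "i \<in> {1..<j}" for i
  proof -
    have "(\<lambda>x. fst x i) \<in> measurable (PiM {1..<j} (\<lambda>_. P) \<Otimes>\<^sub>M P) P"
      by (rule measurable_compose[OF measurable_fst]) (rule measurable_component_singleton[OF that])
    then show ?thesis by (simp add: measurable_cong_sets[OF refl sets_P])
  qed
  have z: "snd \<in> measurable (PiM {1..<j} (\<lambda>_. P) \<Otimes>\<^sub>M P) borel"
    using measurable_snd by (simp add: measurable_cong_sets[OF refl sets_P])
  show ?thesis
    unfolding case_prod_unfold
    by (intro borel_measurable_times borel_measurable_sum measurable_compose[OF z \<zeta>_measurable]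
        measurable_compose[OF measurable_compose[OF z pair_measurable(1)] basis.\<phi>_measurable]
        measurable_compose[OF _ clip_measurable] measurable_compose[OF p \<zeta>_measurable]
        measurable_compose[OF measurable_compose[OF p pair_measurable(1)] basis.\<phi>_measurable])
qed

lemma offdiag_measurable: "offdiag \<in> borel_measurable \<Omega>"
  unfolding offdiag_eq[abs_def] by (rule martingale_measurable[OF offdiag_step_measurable])

lemma offdiag_tail:
  "prob {\<omega>\<in>space \<Omega>. c_off * (n * L * sqrt D) < \<bar>offdiag \<omega>\<bar>} \<le> 2 * exp (- (\<kappa> * L))"
proof -
  let ?b = "K0 * (sqrt (C1 * D) * \<tau>)"
  \<comment> \<open>The squared increment bound is of order \<open>n L D\<close> and also serves as
    variance bound; this \<open>\<mu>\<close> makes both terms of the threshold multiples of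
    \<open>n L sqrt D\<close>.\<close>
  let ?\<mu> = "1 / (n * sqrt D)"
  have D0: "0 < D" "0 < sqrt D" "sqrt D * sqrt D = D" using D_ge_1 by auto
  have \<tau>2: "\<tau>\<^sup>2 = (K0\<^sup>2 + \<kappa>)\<^sup>2 * (n * L)" using L_ge_1 by (simp add: \<tau>_def power_mult_distrib)
  have b2: "?b\<^sup>2 = K0\<^sup>2 * C1 * (K0\<^sup>2 + \<kappa>)\<^sup>2 * (n * L) * D"
    using C1_nonneg D0 by (simp add: power_mult_distrib \<tau>2)
  have "real n * ?\<mu> * ?b\<^sup>2 + \<kappa> * L / ?\<mu> = c_off * (n * L * sqrt D)"
  proof -
    have "real n * ?\<mu> * ?b\<^sup>2 = K0\<^sup>2 * C1 * (K0\<^sup>2 + \<kappa>)\<^sup>2 * (n * L) * (D / sqrt D)"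
      unfolding b2 using n_real_pos by simp
    also have "D / sqrt D = sqrt D" using D0 by (simp add: field_simps)
    finally show ?thesis by (simp add: c_off_def algebra_simps)
  qed
  moreover have "prob {\<omega>\<in>space \<Omega>. real n * ?\<mu> * ?b\<^sup>2 + \<kappa> * L / ?\<mu> < \<bar>offdiag \<omega>\<bar>} \<le> 2 * exp (- (\<kappa> * L))"
    unfolding offdiag_eq
  proof (rule martingale_tail[OF offdiag_step_measurable])
    fix j :: nat and p :: "nat \<Rightarrow> real \<times> real"
    let ?c = "\<lambda>k. clip \<tau> (\<Sum>i\<in>{1..<j}. \<zeta> (p i) * \<phi> k (fst (p i)))"
    let ?g = "\<lambda>z. \<zeta> z * (\<Sum>k\<in>B. \<phi> k (fst z) * ?c k)"
    have "\<bar>\<Sum>k\<in>B. \<phi> k x * ?c k\<bar> \<le> sqrt (C1 * D) * \<tau>" for x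
    proof -
      have "\<bar>\<Sum>k\<in>B. \<phi> k x * ?c k\<bar> \<le> (\<Sum>k\<in>B. \<bar>\<phi> k x\<bar> * \<tau>)"
        using abs_clip_le[OF \<tau>_nonneg]
        by (intro order_trans[OF sum_abs] sum_mono) (auto simp: abs_mult intro!: mult_left_mono)
      also have "\<dots> \<le> sqrt (C1 * D) * \<tau>"
        unfolding sum_distrib_right[symmetric] by (intro mult_right_mono sum_\<phi>_le \<tau>_nonneg)
      finally show ?thesis .
    qed
    note inner = this
    show bd: "AE z in P. \<bar>?g z\<bar> \<le> ?b"
      using \<zeta>_bounded
    proof eventually_elim
      case (elim z)
      show ?case unfolding abs_mult using elim inner[of "fst z"] K0_pos by (intro mult_mono) auto
    qed
    have "?g = (\<lambda>z. \<Sum>k\<in>B. ?c k * (\<zeta> z * \<phi> k (fst z)))"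
      by (simp add: fun_eq_iff sum_distrib_left mult_ac)
    then show "(\<integral>z. ?g z \<partial>P) = 0"
      by (simp add: \<zeta>_\<phi>_integrable \<zeta>_centered)
    show "(\<integral>z. (?g z)\<^sup>2 \<partial>P) \<le> ?b\<^sup>2"
      by (rule P.expectation_sq_le[OF _ bd]) measurable
  next
    show "0 < ?\<mu>" using n_real_pos D0 by simp
    have "?\<mu> * ?b = K0 * sqrt C1 * (K0\<^sup>2 + \<kappa>) * (sqrt (n * L) / n)"
      using D0 C1_nonneg by (simp add: \<tau>_def real_sqrt_mult)
    also have "sqrt (n * L) / n = sqrt (L / n)"
      using sqrt_L_n(2) n_real_pos by (simp add: field_simps)
    also have "K0 * sqrt C1 * (K0\<^sup>2 + \<kappa>) * sqrt (L / n) \<le> 1" by (rule n3)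
    finally show "?\<mu> * ?b \<le> 1" .
  qed
  ultimately show ?thesis by simp
qed

definition diag :: "'w \<Rightarrow> real" where
  "diag \<omega> = (\<Sum>i=1..n. (\<zeta> (Z i \<omega>))\<^sup>2 * (\<Sum>k\<in>B. (\<phi> k (fst (Z i \<omega>)))\<^sup>2) - V)"

definition c_diag :: real where "c_diag = (K0\<^sup>2 * C1)\<^sup>2 + \<kappa>"

lemma diag_measurable: "diag \<in> borel_measurable \<Omega>"
  unfolding diag_def[abs_def]
  by (intro borel_measurable_sum borel_measurable_diff borel_measurable_const
      measurable_compose[OF Z_measurable, where g="\<lambda>z. (\<zeta> z)\<^sup>2 * (\<Sum>k\<in>B. (\<phi> k (fst z))\<^sup>2)"]) auto

lemma diag_tail:
  "prob {\<omega>\<in>space \<Omega>. c_diag * (sqrt (n * L) * D) < \<bar>diag \<omega>\<bar>} \<le> 2 * exp (- (\<kappa> * L))"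
proof -
  let ?q = "\<lambda>z. (\<zeta> z)\<^sup>2 * (\<Sum>k\<in>B. (\<phi> k (fst z))\<^sup>2)"
  let ?b = "K0\<^sup>2 * (C1 * D)"
  \<comment> \<open>Summands and centering are of order \<open>D\<close>, and the squared bound
    again serves as variance bound.\<close>
  let ?\<mu> = "sqrt (L / n) / D"
  have D0: "0 < D" using D_ge_1 by simp
  have "real n * ?\<mu> * ?b\<^sup>2 + \<kappa> * L / ?\<mu> = c_diag * (sqrt (n * L) * D)"
  proof -
    have "real n * ?\<mu> * ?b\<^sup>2 + \<kappa> * L / ?\<mu> = (n * sqrt (L / n)) * D * (K0\<^sup>2 * C1)\<^sup>2 + \<kappa> * (L / sqrt (L / n)) * D"
      using D0 by (simp add: power2_eq_square)
    then show ?thesis unfolding sqrt_L_n by (simp add: c_diag_def algebra_simps)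
  qed
  moreover have "prob {\<omega>\<in>space \<Omega>. real n * ?\<mu> * ?b\<^sup>2 + \<kappa> * L / ?\<mu> < \<bar>\<Sum>i=1..n. ?q (Z i \<omega>) - V\<bar>} \<le> 2 * exp (- (\<kappa> * L))"
  proof (rule bernstein[where h="\<lambda>z. ?q z - V"])
    have V: "0 \<le> V" "V \<le> ?b"
    proof -
      show "0 \<le> V" unfolding V_def by (simp add: sum_nonneg)
      show "V \<le> ?b" using P.abs_expectation_le[OF _ diag_bounded] by (simp add: V_def)
    qed
    show bd: "AE z in P. \<bar>?q z - V\<bar> \<le> ?b"
      using diag_bounded
    proof eventually_elim
      case (elim z)
      have "0 \<le> ?q z" by (simp add: sum_nonneg)
      then show ?case using elim V by linarith
    qed
    show "(\<integral>z. ?q z - V \<partial>P) = 0"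
      using diag_integrable by (simp add: V_def)
    show "(\<integral>z. (?q z - V)\<^sup>2 \<partial>P) \<le> ?b\<^sup>2"
      by (rule P.expectation_sq_le[OF _ bd]) measurable
    show "0 < ?\<mu>" using sqrt_L_n D0 by simp
    show "?\<mu> * ?b \<le> 1" using n4 D0 by (simp add: mult_ac)
  qed auto
  ultimately show ?thesis by (simp add: diag_def)
qed

definition dbar :: "'w \<Rightarrow> real" where "dbar \<omega> = (\<Sum>i=1..n. loss_diff (Z i \<omega>)) / n - bias"

lemma dbar_measurable: "dbar \<in> borel_measurable \<Omega>"
  unfolding dbar_def[abs_def]
  by (intro borel_measurable_divide borel_measurable_sum borel_measurable_diff borel_measurable_const
      measurable_compose[OF Z_measurable loss_diff_measurable])

text \<open>Here \<open>\<mu> = 1 / L\<close>: a fraction of order \<open>1 / L\<close> of the bias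
  is affordable as an error, and the price \<open>\<kappa> L^2 / n\<close> stays below the remainder
  \<open>L^3 / n\<close> by a factor of order \<open>L\<close>.\<close>

lemma dbar_tail:
  "prob {\<omega>\<in>space \<Omega>. 9 * K0\<^sup>2 * bias / L + \<kappa> * L\<^sup>2 / n < \<bar>dbar \<omega>\<bar>} \<le> 2 * exp (- (\<kappa> * L))"
proof -
  let ?t = "real n * (1 / L) * (9 * K0\<^sup>2 * bias) + \<kappa> * L / (1 / L)"
  have L0: "0 < L" using L_ge_1 by simp
  have nd: "n * dbar \<omega> = (\<Sum>i=1..n. loss_diff (Z i \<omega>) - bias)" for \<omega>
    using n_real_pos by (simp add: dbar_def sum_subtractf right_diff_distrib)
  have t: "?t = n * (9 * K0\<^sup>2 * bias / L + \<kappa> * L\<^sup>2 / n)"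
    using n_real_pos by (simp add: distrib_left power2_eq_square)
  have "{\<omega>\<in>space \<Omega>. 9 * K0\<^sup>2 * bias / L + \<kappa> * L\<^sup>2 / n < \<bar>dbar \<omega>\<bar>} = {\<omega>\<in>space \<Omega>. ?t < \<bar>n * dbar \<omega>\<bar>}"
    unfolding t abs_mult using n_real_pos by simp
  moreover have "prob {\<omega>\<in>space \<Omega>. ?t < \<bar>n * dbar \<omega>\<bar>} \<le> 2 * exp (- (\<kappa> * L))"
    unfolding nd
  proof (rule bernstein[where h="\<lambda>z. loss_diff z - bias"])
    show "AE z in P. \<bar>loss_diff z - bias\<bar> \<le> 6 * K0\<^sup>2"
      using loss_diff_bounded
    proof eventually_elim
      case (elim z)
      then show ?case using bias_nonneg bias_le zero_le_power2[of K0] by linarith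
    qed
    show "(\<integral>z. loss_diff z - bias \<partial>P) = 0"
      using loss_diff_integrable by (simp add: bias_eq_integral)
    have "integrable P (\<lambda>z. (loss_diff z)\<^sup>2)"
    proof (rule P.integrable_AE_bounded)
      show "AE z in P. \<bar>(loss_diff z)\<^sup>2\<bar> \<le> (3 * K0\<^sup>2)\<^sup>2"
        using loss_diff_bounded by eventually_elim (simp only: abs_power2 sq_le_sq)
    qed measurable
    from P.expectation_centered_sq_le[OF loss_diff_integrable this] loss_diff_second_moment
    show "(\<integral>z. (loss_diff z - bias)\<^sup>2 \<partial>P) \<le> 9 * K0\<^sup>2 * bias" by (simp add: bias_eq_integral)
    show "0 < 1 / L" using L0 by simp
    show "1 / L * (6 * K0\<^sup>2) \<le> 1" using n5 L0 by simp
  qed auto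
  ultimately show ?thesis by simp
qed

definition good :: "'w set" where
  "good = {\<omega>\<in>space \<Omega>. (\<forall>k\<in>B. \<forall>m\<in>{1..n}. \<bar>T m k \<omega>\<bar> \<le> \<tau>) \<and>
     (\<forall>k\<in>B. \<forall>l\<in>B. \<bar>gram k l \<omega> - (if k = l then 1 else 0)\<bar> \<le> \<epsilon>0) \<and>
     \<bar>offdiag \<omega>\<bar> \<le> c_off * (n * L * sqrt D) \<and> \<bar>diag \<omega>\<bar> \<le> c_diag * (sqrt (n * L) * D) \<and>
     \<bar>dbar \<omega>\<bar> \<le> 9 * K0\<^sup>2 * bias / L + \<kappa> * L\<^sup>2 / n}"

text \<open>Two families of at most \<open>n^2\<close> events (because
  \<open>card B \<le> n\<close>) and three single ones, each of probability at most
  \<open>2 exp (- \<kappa> L)\<close>; the single ones are counted \<open>n^2\<close> times for a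
  uniform total of ten.\<close>

lemma good_prob: "good \<in> events" "1 - 10 * real n ^ 2 * exp (- (\<kappa> * L)) \<le> prob good"
proof -
  let ?e = "exp (- (\<kappa> * L))"
  let ?G = "\<lambda>k l \<omega>. \<bar>gram k l \<omega> - (if k = l then 1 else 0)\<bar>"
  define F1 where "F1 = (\<Union>(k, m)\<in>B \<times> {1..n}. {\<omega>\<in>space \<Omega>. \<tau> < \<bar>T m k \<omega>\<bar>})"
  define F2 where "F2 = (\<Union>(k, l)\<in>B \<times> B. {\<omega>\<in>space \<Omega>. \<epsilon>0 < ?G k l \<omega>})"
  define F3 where "F3 = {\<omega>\<in>space \<Omega>. c_off * (n * L * sqrt D) < \<bar>offdiag \<omega>\<bar>}"
  define F4 where "F4 = {\<omega>\<in>space \<Omega>. c_diag * (sqrt (n * L) * D) < \<bar>diag \<omega>\<bar>}"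
  define F5 where "F5 = {\<omega>\<in>space \<Omega>. 9 * K0\<^sup>2 * bias / L + \<kappa> * L\<^sup>2 / n < \<bar>dbar \<omega>\<bar>}"
  have Tm: "{\<omega>\<in>space \<Omega>. \<tau> < \<bar>T m k \<omega>\<bar>} \<in> events" if "m \<in> {1..n}" for m k
    using T_measurable[of m k] that by simp
  have Gm: "{\<omega>\<in>space \<Omega>. \<epsilon>0 < ?G k l \<omega>} \<in> events" for k l
    using gram_measurable[of k l] by simp
  have F1: "F1 \<in> events" unfolding F1_def using Tm by (intro sets.finite_UN) auto
  have F2: "F2 \<in> events" unfolding F2_def using Gm by (intro sets.finite_UN) auto
  have F3: "F3 \<in> events" unfolding F3_def using offdiag_measurable by simp
  have F4: "F4 \<in> events" unfolding F4_def using diag_measurable by simp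
  have F5: "F5 \<in> events" unfolding F5_def using dbar_measurable by simp
  have good: "good = space \<Omega> - (F1 \<union> F2 \<union> F3 \<union> F4 \<union> F5)"
  proof (rule set_eqI)
    fix \<omega>
    have "\<omega> \<in> F1 \<longleftrightarrow> \<omega> \<in> space \<Omega> \<and> \<not> (\<forall>k\<in>B. \<forall>m\<in>{1..n}. \<bar>T m k \<omega>\<bar> \<le> \<tau>)"
      unfolding F1_def by (simp add: not_le Bex_def) blast
    moreover have "\<omega> \<in> F2 \<longleftrightarrow> \<omega> \<in> space \<Omega> \<and> \<not> (\<forall>k\<in>B. \<forall>l\<in>B. ?G k l \<omega> \<le> \<epsilon>0)"
      unfolding F2_def by (simp add: not_le Bex_def split del: if_split) blast
    moreover have "\<omega> \<in> F3 \<longleftrightarrow> \<omega> \<in> space \<Omega> \<and> \<not> \<bar>offdiag \<omega>\<bar> \<le> c_off * (n * L * sqrt D)"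
      "\<omega> \<in> F4 \<longleftrightarrow> \<omega> \<in> space \<Omega> \<and> \<not> \<bar>diag \<omega>\<bar> \<le> c_diag * (sqrt (n * L) * D)"
      "\<omega> \<in> F5 \<longleftrightarrow> \<omega> \<in> space \<Omega> \<and> \<not> \<bar>dbar \<omega>\<bar> \<le> 9 * K0\<^sup>2 * bias / L + \<kappa> * L\<^sup>2 / n"
      unfolding F3_def F4_def F5_def mem_Collect_eq not_le by (rule refl)+
    ultimately show "\<omega> \<in> good \<longleftrightarrow> \<omega> \<in> space \<Omega> - (F1 \<union> F2 \<union> F3 \<union> F4 \<union> F5)"
      unfolding good_def mem_Collect_eq Diff_iff Un_iff by (simp only:) blast
  qed
  show "good \<in> events" unfolding good using F1 F2 F3 F4 F5 by auto
  have n1': "1 \<le> real n ^ 2" using n_pos by simp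
  have Dn2: "real (card B) * real n \<le> real n ^ 2" "real (card B) * real (card B) \<le> real n ^ 2"
    using D_le_n n_real_pos by (auto simp: D_def power2_eq_square intro!: mult_mono)
  have e0: "0 \<le> ?e" by simp
  have p1: "prob F1 \<le> real n ^ 2 * (2 * ?e)"
  proof -
    have "prob F1 \<le> card (B \<times> {1..n}) * (2 * ?e)"
      unfolding F1_def by (intro prob_UN_le) (auto intro!: Tm T_tail)
    also have "\<dots> = (real (card B) * real n) * (2 * ?e)" by (simp add: card_cartesian_product)
    also have "\<dots> \<le> real n ^ 2 * (2 * ?e)" using Dn2 by (intro mult_right_mono) auto
    finally show ?thesis .
  qed
  have p2: "prob F2 \<le> real n ^ 2 * (2 * ?e)"
  proof -
    have "prob F2 \<le> card (B \<times> B) * (2 * ?e)"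
      unfolding F2_def
    proof (intro prob_UN_le)
      fix x assume "x \<in> B \<times> B"
      then show "prob (case x of (k, l) \<Rightarrow> {\<omega> \<in> space \<Omega>. \<epsilon>0 < ?G k l \<omega>}) \<le> 2 * ?e"
        using gram_tail[of "fst x" "snd x"] by (cases x) simp
    qed (auto intro!: Gm)
    also have "\<dots> = (real (card B) * real (card B)) * (2 * ?e)" by (simp add: card_cartesian_product)
    also have "\<dots> \<le> real n ^ 2 * (2 * ?e)" using Dn2 by (intro mult_right_mono) auto
    finally show ?thesis .
  qed
  have n2e: "2 * ?e \<le> real n ^ 2 * (2 * ?e)" using mult_right_mono[OF n1', of "2 * ?e"] by simp
  have p3: "prob F3 \<le> real n ^ 2 * (2 * ?e)" "prob F4 \<le> real n ^ 2 * (2 * ?e)" "prob F5 \<le> real n ^ 2 * (2 * ?e)"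
    unfolding F3_def F4_def F5_def
    by (rule order_trans[OF offdiag_tail n2e] order_trans[OF diag_tail n2e] order_trans[OF dbar_tail n2e])+
  have "prob (F1 \<union> F2 \<union> F3 \<union> F4 \<union> F5) \<le> prob F1 + prob F2 + prob F3 + prob F4 + prob F5"
    using F1 F2 F3 F4 F5 measure_Un_le by (smt (verit) sets.Un)
  also have "\<dots> \<le> 10 * real n ^ 2 * ?e" using p1 p2 p3 by linarith
  finally have "prob (F1 \<union> F2 \<union> F3 \<union> F4 \<union> F5) \<le> 10 * real n ^ 2 * ?e" .
  moreover have "prob good = 1 - prob (F1 \<union> F2 \<union> F3 \<union> F4 \<union> F5)"
    unfolding good using F1 F2 F3 F4 F5 by (intro prob_compl) auto
  ultimately show "1 - 10 * real n ^ 2 * ?e \<le> prob good" by linarith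
qed

end

locale least_squares_model = large_sample_model \<Omega> n Z P B \<phi> M C1 C2 R s0 sM A smin \<kappa> a L
  for \<Omega> :: "'w measure" and n Z P and B :: "'k set" and \<phi> M C1 C2 R s0 sM A smin \<kappa> a L +
  fixes sn :: "'w \<Rightarrow> real \<Rightarrow> real"
  assumes estimator: "\<omega> \<in> space \<Omega> \<Longrightarrow>
      is_arg_min (\<lambda>s. (\<Sum>i=1..n. contrast s (Z i \<omega>)) / real n) (\<lambda>s. s \<in> M) (sn \<omega>)"
begin

section \<open>Least squares in coordinates\<close>

definition comb :: "('k \<Rightarrow> real) \<Rightarrow> real \<Rightarrow> real" where "comb c x = (\<Sum>k\<in>B. c k * \<phi> k x)"

definition emp :: "'w \<Rightarrow> (real \<times> real \<Rightarrow> real) \<Rightarrow> real" where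
  "emp \<omega> f = (\<Sum>i=1..n. f (Z i \<omega>)) / real n"

text \<open>Some coefficient vector of the estimator, chosen separately for each outcome; no
  measurability in \<open>\<omega>\<close> is claimed.\<close>

definition est :: "'w \<Rightarrow> 'k \<Rightarrow> real" where "est \<omega> = (SOME c. sn \<omega> = comb c)"

definition p1 :: "'w \<Rightarrow> real" where "p1 \<omega> = (\<Sum>k\<in>B. (est \<omega> k - coef k)\<^sup>2)"

definition p2 :: "'w \<Rightarrow> real" where "p2 \<omega> = emp \<omega> (\<lambda>z. contrast sM z - contrast (sn \<omega>) z)"

definition score :: "'k \<Rightarrow> 'w \<Rightarrow> real" where "score k \<omega> = T n k \<omega> / n"

definition chi2 :: "'w \<Rightarrow> real" where "chi2 \<omega> = (\<Sum>k\<in>B. (score k \<omega>)\<^sup>2)"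

definition Nf :: "'w \<Rightarrow> ('k \<Rightarrow> real) \<Rightarrow> real" where "Nf \<omega> c = emp \<omega> (\<lambda>z. (comb c (fst z))\<^sup>2)"

lemma M_eq_comb: "M = range comb"
  unfolding basis.M_eq comb_def[abs_def] by auto

lemma sn_eq: "\<omega> \<in> space \<Omega> \<Longrightarrow> sn \<omega> = comb (est \<omega>)"
  using estimator[of \<omega>] unfolding est_def M_eq_comb is_arg_min_def by (metis (mono_tags, lifting) imageE someI_ex)

lemma sM_comb: "sM = comb coef"
  by (simp add: fun_eq_iff comb_def sM_eq)

lemma excess_loss_sn: "\<omega> \<in> space \<Omega> \<Longrightarrow> excess_loss P s0 (sn \<omega>) = bias + p1 \<omega>"
  using excess_loss_comb[of "est \<omega>"] by (simp add: sn_eq p1_def comb_def[abs_def])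

lemma emp_minimal:
  assumes "\<omega> \<in> space \<Omega>"
  shows "emp \<omega> (contrast (sn \<omega>)) \<le> emp \<omega> (contrast (comb c))"
  using estimator[OF assms] unfolding is_arg_min_def emp_def M_eq_comb by (auto simp: not_less)

lemma emp_diff: "emp \<omega> (\<lambda>z. f z - g z) = emp \<omega> f - emp \<omega> g"
  by (simp add: emp_def sum_subtractf diff_divide_distrib)

lemma emp_mono: "(\<And>i. i \<in> {1..n} \<Longrightarrow> f (Z i \<omega>) \<le> g (Z i \<omega>)) \<Longrightarrow> emp \<omega> f \<le> emp \<omega> g"
  unfolding emp_def by (intro divide_right_mono sum_mono) auto

text \<open>The empirical gain over \<open>sM\<close> is exactly quadratic in the displacement of
  the coefficients: a linear part given by the score and the empirical squared norm.\<close>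

lemma emp_contrast_diff:
  "emp \<omega> (\<lambda>z. contrast sM z - contrast (comb c) z) =
     2 * (\<Sum>k\<in>B. (c k - coef k) * score k \<omega>) - Nf \<omega> (\<lambda>k. c k - coef k)"
proof -
  let ?d = "\<lambda>k. c k - coef k"
  have pt: "contrast sM z - contrast (comb c) z = 2 * (\<Sum>k\<in>B. ?d k * (\<zeta> z * \<phi> k (fst z))) - (comb ?d (fst z))\<^sup>2" for z
  proof -
    have c: "comb c x = sM x + comb ?d x" for x
      by (simp add: sM_comb comb_def left_diff_distrib sum_subtractf)
    have "contrast sM z - contrast (comb c) z = 2 * (\<zeta> z * comb ?d (fst z)) - (comb ?d (fst z))\<^sup>2"
      by (cases z) (simp add: contrast_def c \<zeta>_def power2_eq_square algebra_simps)
    also have "\<zeta> z * comb ?d (fst z) = (\<Sum>k\<in>B. ?d k * (\<zeta> z * \<phi> k (fst z)))"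
      by (simp add: comb_def sum_distrib_left mult_ac)
    finally show ?thesis .
  qed
  have "emp \<omega> (\<lambda>z. 2 * (\<Sum>k\<in>B. ?d k * (\<zeta> z * \<phi> k (fst z)))) = 2 * (\<Sum>k\<in>B. ?d k * score k \<omega>)"
  proof -
    have "(\<Sum>i=1..n. \<Sum>k\<in>B. ?d k * (\<zeta> (Z i \<omega>) * \<phi> k (fst (Z i \<omega>)))) = (\<Sum>k\<in>B. ?d k * T n k \<omega>)"
      unfolding T_def sum_distrib_left by (rule sum.swap)
    then have "emp \<omega> (\<lambda>z. 2 * (\<Sum>k\<in>B. ?d k * (\<zeta> z * \<phi> k (fst z)))) = 2 * (\<Sum>k\<in>B. ?d k * T n k \<omega>) / n"
      unfolding emp_def sum_distrib_left[symmetric] by simp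
    then show ?thesis by (simp add: score_def sum_divide_distrib[symmetric])
  qed
  then show ?thesis unfolding pt emp_diff Nf_def by simp
qed

lemma p2_eq:
  assumes "\<omega> \<in> space \<Omega>"
  shows "p2 \<omega> = 2 * (\<Sum>k\<in>B. (est \<omega> k - coef k) * score k \<omega>) - Nf \<omega> (\<lambda>k. est \<omega> k - coef k)"
  unfolding p2_def sn_eq[OF assms] by (rule emp_contrast_diff)

lemma p2_ge:
  assumes "\<omega> \<in> space \<Omega>"
  shows "2 * (\<Sum>k\<in>B. d k * score k \<omega>) - Nf \<omega> d \<le> p2 \<omega>"
proof -
  have "2 * (\<Sum>k\<in>B. d k * score k \<omega>) - Nf \<omega> d = emp \<omega> (\<lambda>z. contrast sM z - contrast (comb (\<lambda>k. coef k + d k)) z)"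
    unfolding emp_contrast_diff by simp
  also have "\<dots> \<le> p2 \<omega>"
    unfolding p2_def emp_diff using emp_minimal[OF assms, of "\<lambda>k. coef k + d k"] by simp
  finally show ?thesis .
qed

lemma Nf_zero: "Nf \<omega> (\<lambda>_. 0) = 0"
  by (simp add: Nf_def emp_def comb_def)

lemma Nf_scale: "Nf \<omega> (\<lambda>k. t * d k) = t\<^sup>2 * Nf \<omega> d"
proof -
  have "comb (\<lambda>k. t * d k) x = t * comb d x" for x by (simp add: comb_def sum_distrib_left mult_ac)
  then show ?thesis by (simp add: Nf_def emp_def power_mult_distrib sum_distrib_left)
qed

lemma p2_nonneg: "\<omega> \<in> space \<Omega> \<Longrightarrow> 0 \<le> p2 \<omega>"
  using p2_ge[of \<omega> "\<lambda>_. 0"] by (simp add: Nf_zero)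

text \<open>Only optimality along the ray through the estimator's displacement is used. The gain
  along it is a parabola in \<open>t\<close> whose maximum sits at \<open>t = 1\<close>; comparison
  with its vertex \<open>s / N\<close> forces \<open>s = N\<close>.\<close>

lemma normal_equation:
  assumes \<omega>: "\<omega> \<in> space \<Omega>" and pos: "\<And>d. c * (\<Sum>k\<in>B. (d k)\<^sup>2) \<le> Nf \<omega> d" and c: "0 < c"
  shows "(\<Sum>k\<in>B. (est \<omega> k - coef k) * score k \<omega>) = Nf \<omega> (\<lambda>k. est \<omega> k - coef k)"
proof -
  define d where "d = (\<lambda>k. est \<omega> k - coef k)"
  define s where "s = (\<Sum>k\<in>B. d k * score k \<omega>)"
  define N where "N = Nf \<omega> d"
  have le: "2 * (t * s) - t\<^sup>2 * N \<le> 2 * s - N" for t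
  proof -
    have "(\<Sum>k\<in>B. t * d k * score k \<omega>) = t * s" by (simp add: s_def sum_distrib_left mult.assoc)
    moreover have "p2 \<omega> = 2 * s - N" unfolding p2_eq[OF \<omega>] by (simp add: s_def N_def d_def)
    ultimately show ?thesis using p2_ge[OF \<omega>, of "\<lambda>k. t * d k"] by (simp add: Nf_scale N_def)
  qed
  have N0: "0 \<le> N"
  proof -
    have "0 \<le> c * (\<Sum>k\<in>B. (d k)\<^sup>2)" using c by (simp add: sum_nonneg)
    also have "\<dots> \<le> N" unfolding N_def by (rule pos)
    finally show ?thesis .
  qed
  show ?thesis
  proof (cases "N = 0")
    case True
    then have "(\<Sum>k\<in>B. (d k)\<^sup>2) \<le> 0" using pos[of d] c by (simp add: N_def mult_le_0_iff)
    then have "(\<Sum>k\<in>B. (d k)\<^sup>2) = 0" by (intro antisym sum_nonneg) auto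
    then have "\<forall>k\<in>B. d k = 0" by (simp add: sum_nonneg_eq_0_iff)
    then have "s = 0" by (simp add: s_def)
    then show ?thesis using True by (simp add: s_def N_def d_def)
  next
    case False
    then have N: "0 < N" using N0 by simp
    have "2 * (s / N * s) - (s / N)\<^sup>2 * N = s\<^sup>2 / N" using N by (simp add: power2_eq_square)
    then have "s\<^sup>2 / N \<le> 2 * s - N" using le[of "s / N"] by simp
    then have "s\<^sup>2 \<le> (2 * s - N) * N" using N by (simp only: pos_divide_le_eq)
    then have "(s - N)\<^sup>2 \<le> 0" by (simp add: power2_eq_square algebra_simps)
    then show ?thesis by (simp add: s_def N_def d_def)
  qed
qed

section \<open>Empirical Gram matrix close to the identity\<close>

definition \<epsilon> :: real where "\<epsilon> = R * \<epsilon>0"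

lemma R_ge: "0 \<le> R"
proof -
  obtain k where "k \<in> B" using basis.B_nonempty by auto
  from basis.overlap[OF this] show ?thesis by (meson of_nat_0_le_iff order_trans)
qed

lemma \<epsilon>0_nonneg: "0 \<le> \<epsilon>0"
  using C1_nonneg a_pos \<kappa>_pos w_pos by (simp add: \<epsilon>0_def)

lemma \<epsilon>_bounds: "0 \<le> \<epsilon>" "\<epsilon> \<le> 1 / 2"
proof -
  show "0 \<le> \<epsilon>" using R_ge \<epsilon>0_nonneg by (simp add: \<epsilon>_def)
  have "2 * \<epsilon> = 2 * R * (C1 * a + \<kappa>) / sqrt L" by (simp add: \<epsilon>_def \<epsilon>0_def w_def)
  also have "\<dots> \<le> 1" using n6 L_ge_1 by simp
  finally show "\<epsilon> \<le> 1 / 2" by simp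
qed

lemma Nf_gram: "Nf \<omega> c = (\<Sum>k\<in>B. \<Sum>l\<in>B. c k * c l * gram k l \<omega>)"
proof -
  have "(comb c x)\<^sup>2 = (\<Sum>k\<in>B. \<Sum>l\<in>B. c k * c l * (\<phi> k x * \<phi> l x))" for x
    unfolding power2_eq_square comb_def sum_product by (intro sum.cong refl) (simp add: mult_ac)
  then have "Nf \<omega> c = (\<Sum>i=1..n. \<Sum>k\<in>B. \<Sum>l\<in>B. c k * c l * (\<phi> k (fst (Z i \<omega>)) * \<phi> l (fst (Z i \<omega>)))) / n"
    by (simp add: Nf_def emp_def)
  also have "(\<Sum>i=1..n. \<Sum>k\<in>B. \<Sum>l\<in>B. c k * c l * (\<phi> k (fst (Z i \<omega>)) * \<phi> l (fst (Z i \<omega>))))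
     = (\<Sum>k\<in>B. \<Sum>l\<in>B. \<Sum>i=1..n. c k * c l * (\<phi> k (fst (Z i \<omega>)) * \<phi> l (fst (Z i \<omega>))))"
    by (subst sum.swap, intro sum.cong refl, rule sum.swap)
  also have "\<dots> / n = (\<Sum>k\<in>B. \<Sum>l\<in>B. c k * c l * gram k l \<omega>)"
    by (simp add: gram_def sum_divide_distrib sum_distrib_left)
  finally show ?thesis .
qed

text \<open>A Schur test: at most \<open>R\<close> entries per row differ from zero, so entrywise
  precision \<open>\<epsilon>0\<close> costs a factor \<open>R\<close>, not the dimension, in the
  quadratic form.\<close>

lemma gram_form:
  assumes "\<omega> \<in> good"
  shows "\<bar>Nf \<omega> c - (\<Sum>k\<in>B. (c k)\<^sup>2)\<bar> \<le> \<epsilon> * (\<Sum>k\<in>B. (c k)\<^sup>2)"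
proof -
  let ?\<delta> = "\<lambda>k l. if k = l then 1 else 0 :: real"
  let ?r = "\<lambda>k l. \<exists>x. \<phi> k x * \<phi> l x \<noteq> 0"
  let ?o = "\<lambda>k l. if ?r k l then 1 else 0 :: real"
  have G: "\<bar>gram k l \<omega> - ?\<delta> k l\<bar> \<le> \<epsilon>0 * ?o k l" if kl: "k \<in> B" "l \<in> B" for k l
  proof (cases "?r k l")
    case True
    then show ?thesis using assms kl unfolding good_def by simp
  next
    \<comment> \<open>Functions with disjoint supports have empirical Gram entry exactly zero, and
      they are distinct because a normalized function meets itself.\<close>
    case False
    then have "k \<noteq> l" using \<phi>_orthonormal[OF kl] by (auto split: if_splits)
    moreover have "\<phi> k x * \<phi> l x = 0" for x using False by blast
    then have "gram k l \<omega> = 0" by (simp only: gram_def sum.neutral_const div_0)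
    ultimately show ?thesis using \<epsilon>0_nonneg by simp
  qed
  have card_r: "(\<Sum>l\<in>B. ?o k l) \<le> R" if "k \<in> B" for k
    using basis.overlap[OF that] by (simp add: sum.If_cases Int_def)
  have sq: "(\<Sum>k\<in>B. (c k)\<^sup>2) = (\<Sum>k\<in>B. \<Sum>l\<in>B. c k * c l * ?\<delta> k l)"
  proof (intro sum.cong refl)
    fix k assume k: "k \<in> B"
    have "(\<Sum>l\<in>B. c k * c l * ?\<delta> k l) = (\<Sum>l\<in>B. if l = k then c k * c l else 0)" by (intro sum.cong) auto
    also have "\<dots> = (c k)\<^sup>2" using k by (subst sum.delta) (auto simp: power2_eq_square)
    finally show "(c k)\<^sup>2 = (\<Sum>l\<in>B. c k * c l * ?\<delta> k l)" by simp
  qed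
  have "\<bar>Nf \<omega> c - (\<Sum>k\<in>B. (c k)\<^sup>2)\<bar> = \<bar>\<Sum>k\<in>B. \<Sum>l\<in>B. c k * c l * (gram k l \<omega> - ?\<delta> k l)\<bar>"
    unfolding Nf_gram sq sum_subtractf[symmetric] right_diff_distrib ..
  also have "\<dots> \<le> (\<Sum>k\<in>B. \<Sum>l\<in>B. \<bar>c k * c l * (gram k l \<omega> - ?\<delta> k l)\<bar>)"
    by (intro order_trans[OF sum_abs] sum_mono sum_abs)
  also have "\<dots> \<le> (\<Sum>k\<in>B. \<Sum>l\<in>B. \<epsilon>0 / 2 * ((c k)\<^sup>2 * ?o k l) + \<epsilon>0 / 2 * ((c l)\<^sup>2 * ?o l k))"
  proof (intro sum_mono)
    fix k l assume kl: "k \<in> B" "l \<in> B"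
    have am: "\<bar>c k * c l\<bar> \<le> ((c k)\<^sup>2 + (c l)\<^sup>2) / 2"
      using sum_squares_bound[of "\<bar>c k\<bar>" "\<bar>c l\<bar>"] by (simp add: abs_mult)
    have "\<bar>c k * c l * (gram k l \<omega> - ?\<delta> k l)\<bar> \<le> ((c k)\<^sup>2 + (c l)\<^sup>2) / 2 * (\<epsilon>0 * ?o k l)"
      unfolding abs_mult[of "c k * c l"] by (intro mult_mono am G kl) auto
    also have "\<dots> = \<epsilon>0 / 2 * ((c k)\<^sup>2 * ?o k l) + \<epsilon>0 / 2 * ((c l)\<^sup>2 * ?o l k)"
      by (simp add: mult.commute[of "\<phi> l _"] algebra_simps)
    finally show "\<bar>c k * c l * (gram k l \<omega> - ?\<delta> k l)\<bar> \<le> \<epsilon>0 / 2 * ((c k)\<^sup>2 * ?o k l) + \<epsilon>0 / 2 * ((c l)\<^sup>2 * ?o l k)" .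
  qed
  also have "\<dots> = (\<Sum>k\<in>B. \<Sum>l\<in>B. \<epsilon>0 / 2 * ((c k)\<^sup>2 * ?o k l)) + (\<Sum>k\<in>B. \<Sum>l\<in>B. \<epsilon>0 / 2 * ((c l)\<^sup>2 * ?o l k))"
    by (simp only: sum.distrib)
  also have "(\<Sum>k\<in>B. \<Sum>l\<in>B. \<epsilon>0 / 2 * ((c l)\<^sup>2 * ?o l k)) = (\<Sum>k\<in>B. \<Sum>l\<in>B. \<epsilon>0 / 2 * ((c k)\<^sup>2 * ?o k l))"
    by (rule sum.swap)
  also have "(\<Sum>k\<in>B. \<Sum>l\<in>B. \<epsilon>0 / 2 * ((c k)\<^sup>2 * ?o k l)) + (\<Sum>k\<in>B. \<Sum>l\<in>B. \<epsilon>0 / 2 * ((c k)\<^sup>2 * ?o k l))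
      = \<epsilon>0 * (\<Sum>k\<in>B. (c k)\<^sup>2 * (\<Sum>l\<in>B. ?o k l))"
    by (simp only: sum_distrib_left[symmetric])
  also have "\<dots> \<le> \<epsilon>0 * (\<Sum>k\<in>B. (c k)\<^sup>2 * R)"
    using card_r by (intro mult_left_mono sum_mono \<epsilon>0_nonneg) auto
  also have "\<dots> = \<epsilon> * (\<Sum>k\<in>B. (c k)\<^sup>2)"
    unfolding \<epsilon>_def sum_distrib_right[symmetric] by (simp add: mult_ac)
  finally show ?thesis .
qed

lemma chi2_nonneg: "0 \<le> chi2 \<omega>"
  by (simp add: chi2_def sum_nonneg)

lemma p1_nonneg: "0 \<le> p1 \<omega>"
  by (simp add: p1_def sum_nonneg)

text \<open>\<open>p2\<close> dominates the quadratic gain at every displacement; the score vector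
  scaled by \<open>1 / (1 + \<epsilon>)\<close> is nearly optimal.\<close>

lemma p2_lower:
  assumes g: "\<omega> \<in> good"
  shows "chi2 \<omega> / (1 + \<epsilon>) \<le> p2 \<omega>"
proof -
  have \<omega>: "\<omega> \<in> space \<Omega>" using g by (simp add: good_def)
  define t where "t = 1 / (1 + \<epsilon>)"
  have t: "0 < t" "t * (1 + \<epsilon>) = 1" using \<epsilon>_bounds by (auto simp: t_def)
  have N: "Nf \<omega> (\<lambda>k. score k \<omega>) \<le> (1 + \<epsilon>) * chi2 \<omega>"
    using gram_form[OF g, of "\<lambda>k. score k \<omega>"] by (simp add: chi2_def algebra_simps)
  have "t * chi2 \<omega> = 2 * (t * chi2 \<omega>) - t * (t * (1 + \<epsilon>)) * chi2 \<omega>" unfolding t(2) by simp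
  also have "\<dots> = 2 * (t * chi2 \<omega>) - t\<^sup>2 * ((1 + \<epsilon>) * chi2 \<omega>)" by (simp add: power2_eq_square)
  also have "\<dots> \<le> 2 * (t * chi2 \<omega>) - t\<^sup>2 * Nf \<omega> (\<lambda>k. score k \<omega>)"
    using N by (intro diff_left_mono mult_left_mono) auto
  also have "\<dots> = 2 * (\<Sum>k\<in>B. t * score k \<omega> * score k \<omega>) - Nf \<omega> (\<lambda>k. t * score k \<omega>)"
    unfolding Nf_scale by (simp add: chi2_def sum_distrib_left power2_eq_square mult_ac)
  also have "\<dots> \<le> p2 \<omega>" by (rule p2_ge[OF \<omega>])
  finally show ?thesis by (simp add: t_def)
qed

text \<open>Young's inequality with weight \<open>1 - \<epsilon>\<close> lets the empirical norm
  absorb the squared displacement exactly.\<close>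

lemma p2_upper:
  assumes g: "\<omega> \<in> good"
  shows "p2 \<omega> \<le> chi2 \<omega> / (1 - \<epsilon>)"
proof -
  have \<omega>: "\<omega> \<in> space \<Omega>" using g by (simp add: good_def)
  define t where "t = 1 - \<epsilon>"
  have t: "0 < t" using \<epsilon>_bounds by (simp add: t_def)
  let ?d = "\<lambda>k. est \<omega> k - coef k"
  have N: "t * p1 \<omega> \<le> Nf \<omega> ?d"
    using gram_form[OF g, of ?d] by (simp add: p1_def t_def algebra_simps)
  have "2 * (d * s) \<le> t * d\<^sup>2 + s\<^sup>2 / t" for d s :: real
  proof -
    have "0 \<le> (t * d - s)\<^sup>2 / t" using t by simp
    also have "\<dots> = t * d\<^sup>2 + s\<^sup>2 / t - 2 * (d * s)" using t by (simp add: power2_eq_square field_simps)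
    finally show ?thesis by simp
  qed
  then have "2 * (\<Sum>k\<in>B. ?d k * score k \<omega>) \<le> (\<Sum>k\<in>B. t * (?d k)\<^sup>2 + (score k \<omega>)\<^sup>2 / t)"
    unfolding sum_distrib_left by (intro sum_mono) auto
  also have "\<dots> = t * p1 \<omega> + chi2 \<omega> / t"
    by (simp add: sum.distrib p1_def chi2_def sum_distrib_left sum_divide_distrib)
  finally show ?thesis using p2_eq[OF \<omega>] N by (simp add: t_def)
qed

text \<open>By the normal equation \<open>p2\<close> is the empirical squared norm of the
  displacement of which \<open>p1\<close> is the population squared norm.\<close>

lemma p1_p2:
  assumes g: "\<omega> \<in> good"
  shows "(1 - \<epsilon>) * p1 \<omega> \<le> p2 \<omega>" "p2 \<omega> \<le> (1 + \<epsilon>) * p1 \<omega>"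
proof -
  have \<omega>: "\<omega> \<in> space \<Omega>" using g by (simp add: good_def)
  let ?d = "\<lambda>k. est \<omega> k - coef k"
  have "(1 - \<epsilon>) * (\<Sum>k\<in>B. (d k)\<^sup>2) \<le> Nf \<omega> d" for d
    using gram_form[OF g, of d] by (simp add: algebra_simps)
  from normal_equation[OF \<omega> this] have "p2 \<omega> = Nf \<omega> ?d"
    using p2_eq[OF \<omega>] \<epsilon>_bounds by simp
  then have "\<bar>p2 \<omega> - p1 \<omega>\<bar> \<le> \<epsilon> * p1 \<omega>"
    using gram_form[OF g, of ?d] by (simp add: p1_def)
  then show "(1 - \<epsilon>) * p1 \<omega> \<le> p2 \<omega>" "p2 \<omega> \<le> (1 + \<epsilon>) * p1 \<omega>"
    unfolding left_diff_distrib distrib_right mult_1_left by linarith+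
qed

text \<open>\<open>p2\<close> is compared with \<open>chi2\<close> first, then \<open>p1\<close>
  with \<open>p2\<close>. With \<open>E = \<epsilon> * chi2\<close>, the composed losses are at most
  \<open>2 E\<close> below and \<open>4 E + 4 \<epsilon> E \<le> 6 E\<close> above; 8 is a
  convenient common constant.\<close>

lemma p_chi2:
  assumes g: "\<omega> \<in> good"
  shows "\<bar>p2 \<omega> - chi2 \<omega>\<bar> \<le> 8 * \<epsilon> * chi2 \<omega>" "\<bar>p1 \<omega> - chi2 \<omega>\<bar> \<le> 8 * \<epsilon> * chi2 \<omega>"
proof -
  note e = \<epsilon>_bounds
  have inv1: "1 - \<epsilon> \<le> 1 / (1 + \<epsilon>)"
  proof -
    have "(1 - \<epsilon>) * (1 + \<epsilon>) \<le> 1" by (simp add: algebra_simps)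
    then show ?thesis using e by (simp only: pos_le_divide_eq)
  qed
  have inv2: "1 / (1 - \<epsilon>) \<le> 1 + 2 * \<epsilon>"
  proof -
    have "0 \<le> \<epsilon> * (1 - 2 * \<epsilon>)" using e by (intro mult_nonneg_nonneg) auto
    then show ?thesis using e by (simp add: pos_divide_le_eq algebra_simps)
  qed
  have c: "0 \<le> chi2 \<omega>" by (rule chi2_nonneg)
  have l2: "(1 - \<epsilon>) * chi2 \<omega> \<le> p2 \<omega>" using p2_lower[OF g] mult_right_mono[OF inv1 c] by simp
  have u2: "p2 \<omega> \<le> (1 + 2 * \<epsilon>) * chi2 \<omega>" using p2_upper[OF g] mult_right_mono[OF inv2 c] by simp
  define E where "E = \<epsilon> * chi2 \<omega>"
  have E: "0 \<le> E" "\<epsilon> * E \<le> 1 / 2 * E" "0 \<le> \<epsilon> * E"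
    using e c mult_right_mono[OF e(2), of E] by (auto simp: E_def)
  have E8: "8 * \<epsilon> * chi2 \<omega> = 8 * E" by (simp add: E_def)
  have e1: "(1 - \<epsilon>) * chi2 \<omega> = chi2 \<omega> - E" "(1 + 2 * \<epsilon>) * chi2 \<omega> = chi2 \<omega> + 2 * E"
    by (simp_all add: E_def left_diff_distrib distrib_right)
  show "\<bar>p2 \<omega> - chi2 \<omega>\<bar> \<le> 8 * \<epsilon> * chi2 \<omega>"
    using l2 u2 E(1) unfolding E8 e1 by linarith
  have p2n: "0 \<le> p2 \<omega>" using g by (intro p2_nonneg) (simp add: good_def)
  have "(1 - \<epsilon>) * p2 \<omega> \<le> 1 / (1 + \<epsilon>) * p2 \<omega>" by (rule mult_right_mono[OF inv1 p2n])
  also have "\<dots> \<le> p1 \<omega>" using p1_p2(2)[OF g] e by (simp add: pos_divide_le_eq mult.commute)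
  finally have lo: "(1 - \<epsilon>) * (chi2 \<omega> - E) \<le> p1 \<omega>"
    using mult_left_mono[OF l2[unfolded e1], of "1 - \<epsilon>"] e by linarith
  have "p1 \<omega> \<le> 1 / (1 - \<epsilon>) * p2 \<omega>" using p1_p2(1)[OF g] e by (simp add: pos_le_divide_eq mult.commute)
  then have "p1 \<omega> \<le> (1 + 2 * \<epsilon>) * p2 \<omega>" using mult_right_mono[OF inv2 p2n] by linarith
  then have hi: "p1 \<omega> \<le> (1 + 2 * \<epsilon>) * (chi2 \<omega> + 2 * E)"
    using mult_left_mono[OF u2[unfolded e1], of "1 + 2 * \<epsilon>"] e by linarith
  have e2: "(1 - \<epsilon>) * (chi2 \<omega> - E) = chi2 \<omega> - 2 * E + \<epsilon> * E"
      "(1 + 2 * \<epsilon>) * (chi2 \<omega> + 2 * E) = chi2 \<omega> + 4 * E + 4 * (\<epsilon> * E)"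
    unfolding left_diff_distrib distrib_right right_diff_distrib distrib_left by (simp_all add: E_def)
  show "\<bar>p1 \<omega> - chi2 \<omega>\<bar> \<le> 8 * \<epsilon> * chi2 \<omega>"
    using lo hi E unfolding E8 e2 by linarith
qed

section \<open>Expansion and concentration of the squared score\<close>

lemma square_of_sum:
  fixes u :: "nat \<Rightarrow> real"
  shows "(\<Sum>i=1..m. u i)\<^sup>2 = (\<Sum>i=1..m. (u i)\<^sup>2) + 2 * (\<Sum>j=1..m. u j * (\<Sum>i=1..j - 1. u i))"
  by (induction m) (auto simp: power2_eq_square algebra_simps)

text \<open>On \<open>good\<close> the partial sums never reach the truncation level, so the
  truncated martingale coincides with the true off-diagonal part.\<close>

lemma chi2_decomposition:
  assumes g: "\<omega> \<in> good"
  shows "(real n)\<^sup>2 * chi2 \<omega> - n * V = diag \<omega> + 2 * offdiag \<omega>"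
proof -
  have clip: "clip \<tau> (T (j - 1) k \<omega>) = T (j - 1) k \<omega>" if "k \<in> B" "j \<in> {1..n}" for j k
  proof (rule clip_id)
    show "\<bar>T (j - 1) k \<omega>\<bar> \<le> \<tau>"
    proof (cases "j = 1")
      \<comment> \<open>For \<open>j = 1\<close> the past is \<open>T 0\<close>, an empty sum;
        \<open>good\<close> speaks only of indices from 1 on.\<close>
      case True
      then show ?thesis using \<tau>_nonneg by (simp add: T_def)
    next
      case False
      then have "j - 1 \<in> {1..n}" using that by auto
      then show ?thesis using g that unfolding good_def by blast
    qed
  qed
  have "(real n)\<^sup>2 * chi2 \<omega> = (\<Sum>k\<in>B. (T n k \<omega>)\<^sup>2)"
    using n_real_pos by (simp add: chi2_def score_def power_divide sum_divide_distrib[symmetric])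
  also have "\<dots> = (\<Sum>k\<in>B. (\<Sum>i=1..n. (\<zeta> (Z i \<omega>) * \<phi> k (fst (Z i \<omega>)))\<^sup>2) +
      2 * (\<Sum>j=1..n. \<zeta> (Z j \<omega>) * \<phi> k (fst (Z j \<omega>)) * T (j - 1) k \<omega>))"
    unfolding T_def square_of_sum ..
  also have "\<dots> = (\<Sum>k\<in>B. \<Sum>i=1..n. (\<zeta> (Z i \<omega>) * \<phi> k (fst (Z i \<omega>)))\<^sup>2) +
      2 * (\<Sum>k\<in>B. \<Sum>j=1..n. \<zeta> (Z j \<omega>) * \<phi> k (fst (Z j \<omega>)) * T (j - 1) k \<omega>)"
    by (simp add: sum.distrib sum_distrib_left)
  also have "(\<Sum>k\<in>B. \<Sum>i=1..n. (\<zeta> (Z i \<omega>) * \<phi> k (fst (Z i \<omega>)))\<^sup>2) = diag \<omega> + n * V"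
    by (subst sum.swap) (simp add: diag_def sum_subtractf power_mult_distrib sum_distrib_left)
  also have "(\<Sum>k\<in>B. \<Sum>j=1..n. \<zeta> (Z j \<omega>) * \<phi> k (fst (Z j \<omega>)) * T (j - 1) k \<omega>) = offdiag \<omega>"
    unfolding offdiag_def sum_distrib_left
    by (subst sum.swap) (intro sum.cong refl, simp add: clip mult.assoc del: One_nat_def)
  finally show ?thesis by simp
qed

text \<open>The variance rate \<open>D / n\<close> enlarged by \<open>L^3 / n\<close>, so that one
  scale covers models of all dimensions.\<close>

definition H :: real where "H = (D + L ^ 3) / n"

lemma H_nonneg: "0 \<le> H"
  using D_ge_1 L_ge_1 by (simp add: H_def)

lemma chi2_concentration:
  assumes g: "\<omega> \<in> good"
  shows "\<bar>chi2 \<omega> - V / n\<bar> \<le> (c_diag + c_off) * w * H"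
proof -
  have n: "0 < real n" by (rule n_real_pos)
  have L: "0 < L" "0 < sqrt L" "sqrt L * sqrt L = L" using L_ge_1 by auto
  have c: "0 \<le> c_diag" "0 \<le> c_off" using \<kappa>_pos C1_nonneg by (auto simp: c_diag_def c_off_def)
  \<comment> \<open>The diagonal deviation is absorbed because \<open>L^2 \<le> n\<close>.\<close>
  have "sqrt (n * L) \<le> n * w"
  proof (rule real_le_lsqrt)
    have "real n * L = n * L\<^sup>2 / L" using L by (simp add: power2_eq_square)
    also have "\<dots> \<le> n * n / L" using L_sq_le L n by (intro divide_right_mono mult_left_mono) auto
    also have "\<dots> = (n * w)\<^sup>2" unfolding power_mult_distrib w_sq by (simp add: power2_eq_square)
    finally show "real n * L \<le> (n * w)\<^sup>2" .
  qed (use n w_pos in auto)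
  then have 1: "sqrt (n * L) * D \<le> n * w * D" using D_ge_1 by (intro mult_right_mono) auto
  \<comment> \<open>The square of \<open>sqrt D - L sqrt L\<close> is nonnegative. This is the
    origin of the exponent 3 of the logarithm: the off-diagonal term is negligible against
    \<open>D\<close> once \<open>D\<close> is of the order of \<open>L^3\<close>.\<close>
  have 2: "2 * (L * sqrt D) \<le> w * (D + L ^ 3)"
  proof -
    have "0 \<le> w * (sqrt D - L * sqrt L)\<^sup>2" using w_pos by simp
    also have "(sqrt D - L * sqrt L)\<^sup>2 = D + L ^ 3 - 2 * (L * sqrt L * sqrt D)"
      using D_ge_1 L by (simp add: power2_eq_square power3_eq_cube algebra_simps)
    also have "w * \<dots> = w * (D + L ^ 3) - 2 * (L * (w * sqrt L) * sqrt D)"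
      by (simp add: algebra_simps)
    finally show ?thesis by (simp add: w_sqrt)
  qed
  have "\<bar>(real n)\<^sup>2 * chi2 \<omega> - n * V\<bar> \<le> \<bar>diag \<omega>\<bar> + 2 * \<bar>offdiag \<omega>\<bar>"
    unfolding chi2_decomposition[OF g] by linarith
  also have "\<dots> \<le> c_diag * (sqrt (n * L) * D) + c_off * (n * (2 * (L * sqrt D)))"
    using g by (auto simp: good_def)
  also have "\<dots> \<le> c_diag * (n * w * (D + L ^ 3)) + c_off * (n * (w * (D + L ^ 3)))"
  proof (intro add_mono mult_left_mono c)
    have "n * w * D \<le> n * w * (D + L ^ 3)" using n w_pos L by (intro mult_left_mono) auto
    then show "sqrt (n * L) * D \<le> n * w * (D + L ^ 3)" using 1 by linarith
  qed (use 2 in auto)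
  also have "\<dots> = (real n)\<^sup>2 * ((c_diag + c_off) * w * H)"
  proof -
    have nH: "D + L ^ 3 = n * H" using n by (simp add: H_def)
    show ?thesis unfolding nH by (simp add: power2_eq_square algebra_simps)
  qed
  also have "(real n)\<^sup>2 * chi2 \<omega> - n * V = (real n)\<^sup>2 * (chi2 \<omega> - V / n)"
    using n by (simp add: power2_eq_square right_diff_distrib)
  finally have "(real n)\<^sup>2 * \<bar>chi2 \<omega> - V / n\<bar> \<le> (real n)\<^sup>2 * ((c_diag + c_off) * w * H)"
    by (simp add: abs_mult)
  then show ?thesis using n by simp
qed

definition c_risk :: real where
  "c_risk = 8 * R * (C1 * a + \<kappa>) * (K0\<^sup>2 + c_diag + c_off) + c_diag + c_off"

lemma V_n_le: "V / n \<le> K0\<^sup>2 * H" "V / n \<le> K0\<^sup>2" "0 \<le> V / n"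
proof -
  have "K0\<^sup>2 * D \<le> K0\<^sup>2 * (D + L ^ 3)" using L_ge_1 by (intro mult_left_mono) auto
  then have "V \<le> K0\<^sup>2 * (D + L ^ 3)" using V_upper by linarith
  then show "V / n \<le> K0\<^sup>2 * H" using n_real_pos by (simp add: H_def divide_right_mono)
  have "V \<le> K0\<^sup>2 * n" using V_upper mult_left_mono[OF D_le_n, of "K0\<^sup>2"] by simp
  then show "V / n \<le> K0\<^sup>2" using n_real_pos by (simp add: divide_le_eq)
  have "0 \<le> smin\<^sup>2 * D" using D_ge_1 by simp
  then show "0 \<le> V / n" using V_lower by simp
qed

lemma risk_concentration:
  assumes g: "\<omega> \<in> good"
  shows "\<bar>p1 \<omega> - V / n\<bar> \<le> c_risk * w * H" "\<bar>p2 \<omega> - V / n\<bar> \<le> c_risk * w * H"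
proof -
  have c: "0 \<le> c_diag" "0 \<le> c_off" using \<kappa>_pos C1_nonneg by (auto simp: c_diag_def c_off_def)
  have "(c_diag + c_off) * w * H \<le> (c_diag + c_off) * 1 * H"
    using c w_le_1 H_nonneg by (intro mult_right_mono mult_left_mono) auto
  then have "chi2 \<omega> \<le> (K0\<^sup>2 + c_diag + c_off) * H"
    using chi2_concentration[OF g] V_n_le(1) by (simp add: algebra_simps)
  then have "8 * \<epsilon> * chi2 \<omega> \<le> 8 * \<epsilon> * ((K0\<^sup>2 + c_diag + c_off) * H)"
    using \<epsilon>_bounds by (intro mult_left_mono) auto
  also have "\<dots> + (c_diag + c_off) * w * H = c_risk * w * H"
    by (simp add: c_risk_def \<epsilon>_def \<epsilon>0_def algebra_simps)
  finally have "8 * \<epsilon> * chi2 \<omega> + (c_diag + c_off) * w * H \<le> c_risk * w * H" by simp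
  then show "\<bar>p1 \<omega> - V / n\<bar> \<le> c_risk * w * H" "\<bar>p2 \<omega> - V / n\<bar> \<le> c_risk * w * H"
    using p_chi2[OF g] chi2_concentration[OF g] by linarith+
qed

section \<open>Measurability and mean of the empirical excess\<close>

lemma emp_contrast_measurable: "(\<lambda>\<omega>. emp \<omega> (contrast (comb c))) \<in> borel_measurable \<Omega>"
proof -
  have "contrast (comb c) = (\<lambda>z. (snd z - comb c (fst z))\<^sup>2)" by (auto simp: contrast_def)
  moreover have "comb c \<in> borel_measurable borel" unfolding comb_def[abs_def] by measurable
  ultimately have "contrast (comb c) \<in> borel_measurable borel" by simp
  then show ?thesis unfolding emp_def
    by (intro borel_measurable_divide borel_measurable_sum borel_measurable_const measurable_compose[OF Z_measurable])
qed

text \<open>A strict inequality survives a small change of the coefficients. It reduces the event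
  that the minimal risk lies below \<open>r\<close> to a countable union.\<close>

lemma rational_approximation:
  assumes less: "emp \<omega> (contrast (comb c)) < r"
  shows "\<exists>q\<in>PiE B (\<lambda>_. \<rat>). emp \<omega> (contrast (comb q)) < r"
proof -
  have "\<exists>q. q \<in> \<rat> \<and> c k < q \<and> q < c k + 1 / real (Suc m)" for k m
    using Rats_dense_in_real[of "c k" "c k + 1 / real (Suc m)"] by auto
  then obtain q where q: "\<And>k m. q k m \<in> \<rat>" "\<And>k m. c k < q k m" "\<And>k m. q k m < c k + 1 / real (Suc m)"
    by metis
  have lim: "(\<lambda>m. q k m) \<longlonglongrightarrow> c k" for k
  proof (rule tendsto_sandwich[of "\<lambda>_. c k" _ _ "\<lambda>m. c k + 1 / real (Suc m)"])
    show "(\<lambda>m. c k + 1 / real (Suc m)) \<longlonglongrightarrow> c k"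
      using LIMSEQ_Suc[OF lim_const_over_n[of 1]] tendsto_add[OF tendsto_const[of "c k"], of _ 0] by fastforce
  qed (use q in \<open>auto intro!: always_eventually less_imp_le\<close>)
  have eq: "emp \<omega> (contrast (comb d)) = (\<Sum>i=1..n. (snd (Z i \<omega>) - (\<Sum>k\<in>B. d k * \<phi> k (fst (Z i \<omega>))))\<^sup>2) / n" for d
    by (simp add: emp_def contrast_def comb_def case_prod_unfold)
  have "(\<lambda>m. emp \<omega> (contrast (comb (\<lambda>k. q k m)))) \<longlonglongrightarrow> emp \<omega> (contrast (comb c))"
    unfolding eq by (intro tendsto_intros lim) (use n_real_pos in auto)
  then have "\<forall>\<^sub>F m in sequentially. emp \<omega> (contrast (comb (\<lambda>k. q k m))) < r"
    using less by (rule order_tendstoD(2))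
  then obtain m where m: "emp \<omega> (contrast (comb (\<lambda>k. q k m))) < r"
    using eventually_happens'[OF sequentially_bot] by blast
  have "comb (restrict (\<lambda>k. q k m) B) = comb (\<lambda>k. q k m)" by (simp add: comb_def[abs_def])
  then show ?thesis using m q(1) by (intro bexI[of _ "restrict (\<lambda>k. q k m) B"]) auto
qed

text \<open>The minimal empirical risk is measurable although the choice of the minimizer need not be.\<close>

lemma minimal_risk_measurable: "(\<lambda>\<omega>. emp \<omega> (contrast (sn \<omega>))) \<in> borel_measurable \<Omega>"
  unfolding borel_measurable_iff_less
proof
  fix r :: real
  have "{\<omega>\<in>space \<Omega>. emp \<omega> (contrast (sn \<omega>)) < r}
      = (\<Union>q\<in>PiE B (\<lambda>_. \<rat>). {\<omega>\<in>space \<Omega>. emp \<omega> (contrast (comb q)) < r})"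
  proof (intro set_eqI iffI)
    fix \<omega> assume "\<omega> \<in> {\<omega>\<in>space \<Omega>. emp \<omega> (contrast (sn \<omega>)) < r}"
    then show "\<omega> \<in> (\<Union>q\<in>PiE B (\<lambda>_. \<rat>). {\<omega>\<in>space \<Omega>. emp \<omega> (contrast (comb q)) < r})"
      using rational_approximation[of \<omega> "est \<omega>" r] by (auto simp: sn_eq)
  next
    fix \<omega> assume "\<omega> \<in> (\<Union>q\<in>PiE B (\<lambda>_. \<rat>). {\<omega>\<in>space \<Omega>. emp \<omega> (contrast (comb q)) < r})"
    then show "\<omega> \<in> {\<omega>\<in>space \<Omega>. emp \<omega> (contrast (sn \<omega>)) < r}"
      using emp_minimal by (auto intro: le_less_trans)
  qed
  also have "\<dots> \<in> events"
  proof (rule sets.countable_UN'')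
    show "countable (PiE B (\<lambda>_. \<rat> :: real set))"
      by (intro countable_PiE) (auto simp: countable_rat)
  qed (use emp_contrast_measurable in simp)
  finally show "{\<omega>\<in>space \<Omega>. emp \<omega> (contrast (sn \<omega>)) < r} \<in> events" .
qed

lemma p2_measurable: "p2 \<in> borel_measurable \<Omega>"
  unfolding p2_def[abs_def] emp_diff
  using minimal_risk_measurable emp_contrast_measurable[of coef] by (simp add: sM_comb)

lemma p2_bounded: "AE \<omega> in \<Omega>. 0 \<le> p2 \<omega> \<and> p2 \<omega> \<le> K0\<^sup>2"
proof -
  have "AE \<omega> in \<Omega>. \<forall>i\<in>{1..n}. \<bar>\<zeta> (Z i \<omega>)\<bar> \<le> K0"
    using AE_Z[OF _ \<zeta>_bounded] by (intro AE_finite_allI) auto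
  then show ?thesis
    using AE_space
  proof eventually_elim
    case (elim \<omega>)
    have "contrast sM (Z i \<omega>) \<le> K0\<^sup>2" if "i \<in> {1..n}" for i
      using elim that sq_le_sq[of "\<zeta> (Z i \<omega>)" K0] by (auto simp: contrast_def \<zeta>_def case_prod_unfold)
    then have "emp \<omega> (contrast sM) \<le> emp \<omega> (\<lambda>_. K0\<^sup>2)" by (intro emp_mono) auto
    also have "\<dots> = K0\<^sup>2" using n_real_pos by (simp add: emp_def)
    finally have "emp \<omega> (contrast sM) \<le> K0\<^sup>2" .
    moreover have "0 \<le> emp \<omega> (contrast (sn \<omega>))"
      by (auto simp: emp_def contrast_def case_prod_unfold intro!: divide_nonneg_nonneg sum_nonneg)
    ultimately show ?case using p2_nonneg[OF elim(2)] by (simp add: p2_def emp_diff)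
  qed
qed

lemma good_prob_ge: "1 - 10 / (real n)\<^sup>2 \<le> prob good"
proof -
  have "exp (- (\<kappa> * L)) \<le> exp (- (4 * L))" using \<kappa>_ge L_ge_1 by (simp add: mult_right_mono)
  also have "\<dots> = 1 / real n ^ 4"
    using n_real_pos exp_of_nat_mult[of 4 L] by (simp add: L_def exp_minus inverse_eq_divide)
  finally have "10 * real n ^ 2 * exp (- (\<kappa> * L)) \<le> 10 * real n ^ 2 * (1 / real n ^ 4)"
    by (intro mult_left_mono) auto
  also have "\<dots> = 10 / (real n)\<^sup>2"
    using n_real_pos by (simp add: power4_eq_xxxx power2_eq_square)
  finally show ?thesis using good_prob(2) by linarith
qed

definition c_mean :: real where "c_mean = c_risk + 10 * K0\<^sup>2"

text \<open>On \<open>good\<close> the deviation bound applies; off \<open>good\<close>,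
  \<open>p2\<close> and \<open>V / n\<close> both lie in \<open>[0, K0^2]\<close> almost surely, and
  the exceptional probability is itself at most a multiple of \<open>w * H\<close>.\<close>

lemma mean_p2: "\<bar>expectation p2 - V / n\<bar> \<le> c_mean * w * H"
proof -
  have n: "0 < real n" by (rule n_real_pos)
  have [measurable]: "p2 \<in> borel_measurable \<Omega>" "good \<in> events" using p2_measurable good_prob by auto
  have int: "integrable \<Omega> p2"
  proof (rule integrable_AE_bounded)
    show "AE \<omega> in \<Omega>. \<bar>p2 \<omega>\<bar> \<le> K0\<^sup>2" using p2_bounded by eventually_elim auto
  qed measurable
  have int_bad: "integrable \<Omega> (indicator (space \<Omega> - good) :: 'w \<Rightarrow> real)"
    by (simp add: integrable_indicator_iff emeasure_eq_measure)
  have "prob (space \<Omega> - good) \<le> 10 / (real n)\<^sup>2"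
    using good_prob_ge prob_compl[of good] good_prob(1) by simp
  \<comment> \<open>The summand \<open>L^3\<close> of \<open>H\<close> gives
    \<open>w * H \<ge> 1 / n\<close>, whatever the dimension.\<close>
  also have "10 / (real n)\<^sup>2 \<le> 10 * (w * H)"
  proof -
    have "1 \<le> L\<^sup>2 * (sqrt L * (w * sqrt L))" unfolding w_sqrt using L_ge_1 one_le_power[of L 2] mult_mono[of 1 "L\<^sup>2" 1 "sqrt L"] by simp
    also have "\<dots> = w * L ^ 3" using L_ge_1 by (simp add: power2_eq_square power3_eq_cube)
    also have "\<dots> \<le> w * (D + L ^ 3)" using w_pos D_ge_1 by (intro mult_left_mono) auto
    finally have "1 / n \<le> w * H" using n by (simp add: H_def divide_right_mono)
    moreover have "1 / (real n)\<^sup>2 \<le> 1 / n"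
      using n_pos by (simp add: power2_eq_square frac_le)
    ultimately show ?thesis by simp
  qed
  finally have bad: "prob (space \<Omega> - good) \<le> 10 * (w * H)" .
  have "\<bar>expectation p2 - V / n\<bar> = \<bar>expectation (\<lambda>\<omega>. p2 \<omega> - V / n)\<bar>"
    using int by (simp add: prob_space)
  also have "\<dots> \<le> expectation (\<lambda>\<omega>. \<bar>p2 \<omega> - V / n\<bar>)" by (rule integral_abs_bound)
  also have "\<dots> \<le> expectation (\<lambda>\<omega>. c_risk * w * H + K0\<^sup>2 * indicator (space \<Omega> - good) \<omega>)"
  proof (rule integral_mono_AE)
    show "AE \<omega> in \<Omega>. \<bar>p2 \<omega> - V / n\<bar> \<le> c_risk * w * H + K0\<^sup>2 * indicator (space \<Omega> - good) \<omega>"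
      using p2_bounded AE_space
    proof eventually_elim
      case (elim \<omega>)
      have "0 \<le> c_risk * w * H"
        using R_ge C1_nonneg a_pos \<kappa>_pos w_pos H_nonneg
        by (auto simp: c_risk_def c_diag_def c_off_def intro!: mult_nonneg_nonneg add_nonneg_nonneg)
      moreover have "\<bar>p2 \<omega> - V / n\<bar> \<le> K0\<^sup>2" using elim V_n_le(2,3) by linarith
      ultimately show ?case
        using risk_concentration(2)[of \<omega>] elim by (cases "\<omega> \<in> good") auto
    qed
  qed (use int int_bad in auto)
  also have "\<dots> = c_risk * w * H + K0\<^sup>2 * prob (space \<Omega> - good)"
    using int_bad by (simp add: prob_space)
  also have "\<dots> \<le> c_risk * w * H + K0\<^sup>2 * (10 * (w * H))"
    by (intro add_left_mono mult_left_mono bad) simp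
  finally show ?thesis
    by (simp add: c_mean_def algebra_simps)
qed

end

section \<open>The law of the observations\<close>

definition basis_const1 :: "sapp_constants \<Rightarrow> real" where
  "basis_const1 K = (real (r_max K) + 1)\<^sup>2 * inverse_const (r_max K) / (c_min K * c_Leb K)"

definition basis_const2 :: "sapp_constants \<Rightarrow> real" where
  "basis_const2 K = (real (r_max K) + 1) * sqrt (inverse_const (r_max K) * c_max K / c_min K)"

context SAPP
begin

abbreviation obs :: "nat \<Rightarrow> 'w \<Rightarrow> real \<times> real" where "obs i \<omega> \<equiv> (X i \<omega>, Y i \<omega>)"

lemma iid_sample_obs: "1 \<le> n \<Longrightarrow> iid_sample \<Omega> n obs P"
  using indep ident_distr by unfold_locales auto

context
  assumes n1: "1 \<le> n"
begin

interpretation iid_sample \<Omega> n obs P by (rule iid_sample_obs[OF n1])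

interpretation P: prob_space P by (rule prob_space_P)

declare One_nat_def[simp del]

lemma one_mem: "1 \<in> {1..n}" using n1 by simp

lemma X_measurable[measurable]: "X 1 \<in> borel_measurable \<Omega>" and Y_measurable[measurable]: "Y 1 \<in> borel_measurable \<Omega>"
proof -
  have c: "fst \<in> borel_measurable (borel :: (real \<times> real) measure)" "snd \<in> borel_measurable (borel :: (real \<times> real) measure)"
    by (auto intro!: borel_measurable_continuous_onI continuous_intros)
  show "X 1 \<in> borel_measurable \<Omega>" "Y 1 \<in> borel_measurable \<Omega>"
    using measurable_compose[OF Z_measurable[OF one_mem] c(1)] measurable_compose[OF Z_measurable[OF one_mem] c(2)] by auto
qed

lemma AE_P_iff:
  assumes "Measurable.pred borel Q"
  shows "(AE z in P. Q z) \<longleftrightarrow> (AE \<omega> in \<Omega>. Q (X 1 \<omega>, Y 1 \<omega>))"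
  unfolding distr_Z[OF one_mem, symmetric]
  using assms by (intro AE_distr_iff Z_measurable[OF one_mem]) simp

lemma integral_P:
  fixes f :: "real \<times> real \<Rightarrow> real"
  assumes "f \<in> borel_measurable borel"
  shows "(\<integral>z. f z \<partial>P) = (\<integral>\<omega>. f (X 1 \<omega>, Y 1 \<omega>) \<partial>\<Omega>)"
  using integral_Z[OF one_mem assms] by simp

lemma pair_components_measurable[measurable]:
  "fst \<in> borel_measurable (borel :: (real \<times> real) measure)" "snd \<in> borel_measurable (borel :: (real \<times> real) measure)"
  by (auto intro!: borel_measurable_continuous_onI continuous_intros)

lemma response_bounded_P: "AE z in P. \<bar>snd z\<bar> \<le> A_bound K"
  using Ab[OF one_mem] by (subst AE_P_iff) auto

lemma subalgebra_X: "sigma_finite_subalgebra \<Omega> (vimage_algebra (space \<Omega>) (X 1) borel)"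
proof -
  have "subalgebra \<Omega> (vimage_algebra (space \<Omega>) (X 1) borel)"
    unfolding subalgebra_def using X_measurable
    by (auto simp: sets_vimage_algebra2 measurable_sets)
  then have "finite_measure_subalgebra \<Omega> (vimage_algebra (space \<Omega>) (X 1) borel)"
    by (simp add: finite_measure_axioms finite_measure_subalgebra_axioms_def finite_measure_subalgebra_def)
  then interpret finite_measure_subalgebra \<Omega> "vimage_algebra (space \<Omega>) (X 1) borel" .
  show ?thesis by unfold_locales
qed

text \<open>Used with \<open>c = 0\<close> for the noise and \<open>c = 1\<close> for its
  square.\<close>

lemma cond_exp_product:
  assumes [measurable]: "g \<in> borel_measurable borel" "h \<in> borel_measurable \<Omega>"
    and int: "integrable \<Omega> (\<lambda>\<omega>. g (X 1 \<omega>) * h \<omega>)"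
    and ce: "AE \<omega> in \<Omega>. real_cond_exp \<Omega> (vimage_algebra (space \<Omega>) (X 1) borel) h \<omega> = c"
  shows "(\<integral>\<omega>. g (X 1 \<omega>) * h \<omega> \<partial>\<Omega>) = c * (\<integral>\<omega>. g (X 1 \<omega>) \<partial>\<Omega>)"
proof -
  let ?F = "vimage_algebra (space \<Omega>) (X 1) borel"
  interpret sigma_finite_subalgebra \<Omega> ?F by (rule subalgebra_X)
  have "X 1 \<in> measurable ?F borel" by (rule measurable_vimage_algebra1) simp
  then have "(\<lambda>\<omega>. g (X 1 \<omega>)) \<in> borel_measurable ?F" by (rule measurable_compose) fact
  from real_cond_exp_intg(2)[OF int this assms(2)]
  have "(\<integral>\<omega>. g (X 1 \<omega>) * h \<omega> \<partial>\<Omega>) = (\<integral>\<omega>. g (X 1 \<omega>) * real_cond_exp \<Omega> ?F h \<omega> \<partial>\<Omega>)" by simp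
  also have "\<dots> = (\<integral>\<omega>. c * g (X 1 \<omega>) \<partial>\<Omega>)"
    by (rule integral_cong_AE) (use ce in \<open>auto intro: borel_measurable_cond_exp2\<close>)
  finally show ?thesis by simp
qed

lemma s_star_integrable: "integrable \<Omega> (\<lambda>\<omega>. s_star (X 1 \<omega>))"
proof -
  note [measurable] = s_star_measurable
  have "integrable P (\<lambda>z. (s_star (fst z))\<^sup>2)"
    using s_star_L2 unfolding design_law_def
    by (subst (asm) integrable_distr_eq) (auto simp: measurable_cong_sets[OF sets_P refl])
  then have "integrable \<Omega> (\<lambda>\<omega>. (s_star (X 1 \<omega>))\<^sup>2)"
    unfolding distr_Z[OF one_mem, symmetric]
    by (subst (asm) integrable_distr_eq[OF Z_measurable[OF one_mem]]) auto
  then show ?thesis by (rule square_integrable_imp_integrable[rotated]) simp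
qed

lemma noise_eq: "\<omega> \<in> space \<Omega> \<Longrightarrow> \<sigma> (X 1 \<omega>) * \<epsilon> 1 \<omega> = Y 1 \<omega> - s_star (X 1 \<omega>)"
  using regression[OF one_mem] by simp

text \<open>\<open>\<sigma>\<close> is not assumed bounded, so integrability of
  \<open>\<sigma> g \<epsilon>\<close> is read off from its other form
  \<open>(Y - s_star) g\<close>, with \<open>Y\<close> bounded and \<open>s_star\<close> square
  integrable.\<close>

lemma residual_centered:
  assumes [measurable]: "g \<in> borel_measurable borel" and bd: "AE \<omega> in \<Omega>. \<bar>g (X 1 \<omega>)\<bar> \<le> b"
  shows "integrable \<Omega> (\<lambda>\<omega>. (Y 1 \<omega> - s_star (X 1 \<omega>)) * g (X 1 \<omega>))"
    and "(\<integral>\<omega>. (Y 1 \<omega> - s_star (X 1 \<omega>)) * g (X 1 \<omega>) \<partial>\<Omega>) = 0"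
proof -
  note [measurable] = s_star_measurable \<sigma>_measurable noise_measurable[OF one_mem]
  have iY: "integrable \<Omega> (Y 1)"
    by (rule integrable_const_bound[where B="A_bound K"]) (use Ab[OF one_mem] in auto)
  have i0: "integrable \<Omega> (\<lambda>\<omega>. Y 1 \<omega> - s_star (X 1 \<omega>))" using iY s_star_integrable by simp
  show i1: "integrable \<Omega> (\<lambda>\<omega>. (Y 1 \<omega> - s_star (X 1 \<omega>)) * g (X 1 \<omega>))"
  proof (rule Bochner_Integration.integrable_bound)
    show "integrable \<Omega> (\<lambda>\<omega>. b * \<bar>Y 1 \<omega> - s_star (X 1 \<omega>)\<bar>)" using i0 by simp
    show "AE \<omega> in \<Omega>. norm ((Y 1 \<omega> - s_star (X 1 \<omega>)) * g (X 1 \<omega>)) \<le> norm (b * \<bar>Y 1 \<omega> - s_star (X 1 \<omega>)\<bar>)"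
      using bd
    proof eventually_elim
      case (elim \<omega>)
      then have "\<bar>Y 1 \<omega> - s_star (X 1 \<omega>)\<bar> * \<bar>g (X 1 \<omega>)\<bar> \<le> \<bar>Y 1 \<omega> - s_star (X 1 \<omega>)\<bar> * \<bar>b\<bar>"
        by (intro mult_left_mono) auto
      then show ?case by (simp add: abs_mult mult.commute)
    qed
  qed measurable
  have eq: "(Y 1 \<omega> - s_star (X 1 \<omega>)) * g (X 1 \<omega>) = (\<sigma> (X 1 \<omega>) * g (X 1 \<omega>)) * \<epsilon> 1 \<omega>" if "\<omega> \<in> space \<Omega>" for \<omega>
    using noise_eq[OF that, symmetric] by (simp add: mult_ac)
  have "(\<integral>\<omega>. (Y 1 \<omega> - s_star (X 1 \<omega>)) * g (X 1 \<omega>) \<partial>\<Omega>) = (\<integral>\<omega>. (\<sigma> (X 1 \<omega>) * g (X 1 \<omega>)) * \<epsilon> 1 \<omega> \<partial>\<Omega>)"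
    by (intro Bochner_Integration.integral_cong refl eq)
  also have "\<dots> = 0 * (\<integral>\<omega>. \<sigma> (X 1 \<omega>) * g (X 1 \<omega>) \<partial>\<Omega>)"
  proof (rule cond_exp_product[where g="\<lambda>x. \<sigma> x * g x"])
    show "integrable \<Omega> (\<lambda>\<omega>. (\<sigma> (X 1 \<omega>) * g (X 1 \<omega>)) * \<epsilon> 1 \<omega>)"
      using i1 by (subst Bochner_Integration.integrable_cong[OF refl eq[symmetric]]) auto
  qed (use noise_cond_mean[OF one_mem] in auto)
  finally show "(\<integral>\<omega>. (Y 1 \<omega> - s_star (X 1 \<omega>)) * g (X 1 \<omega>) \<partial>\<Omega>) = 0" by simp
qed

text \<open>Testing the centered residual on the event where the regression function exceeds the bound
  on the responses shows that this event is negligible.\<close>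

lemma s_star_bounded: "AE \<omega> in \<Omega>. \<bar>s_star (X 1 \<omega>)\<bar> \<le> A_bound K"
proof -
  note [measurable] = s_star_measurable
  have "AE \<omega> in \<Omega>. u * s_star (X 1 \<omega>) \<le> A_bound K" if u: "\<bar>u\<bar> = 1" for u :: real
  proof -
    let ?S = "{x. A_bound K < u * s_star x}"
    let ?g = "\<lambda>x. u * indicator ?S x :: real"
    let ?f = "\<lambda>\<omega>. - ((Y 1 \<omega> - s_star (X 1 \<omega>)) * ?g (X 1 \<omega>))"
    have gb: "AE \<omega> in \<Omega>. \<bar>?g (X 1 \<omega>)\<bar> \<le> 1" using u by (auto split: split_indicator)
    note r = residual_centered[of ?g, OF _ gb]
    have nn: "AE \<omega> in \<Omega>. 0 \<le> ?f \<omega> \<and> (?f \<omega> = 0 \<longrightarrow> u * s_star (X 1 \<omega>) \<le> A_bound K)"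
      using Ab[OF one_mem]
    proof eventually_elim
      case (elim \<omega>)
      have "u * Y 1 \<omega> \<le> A_bound K"
      proof -
        have "\<bar>u * Y 1 \<omega>\<bar> \<le> A_bound K" using elim u by (simp add: abs_mult)
        then show ?thesis by simp
      qed
      moreover have "?f \<omega> = (u * s_star (X 1 \<omega>) - u * Y 1 \<omega>) * indicator ?S (X 1 \<omega>)"
        by (simp add: algebra_simps)
      ultimately show ?case by (auto split: split_indicator)
    qed
    have "AE \<omega> in \<Omega>. ?f \<omega> = 0"
    proof (subst integral_nonneg_eq_0_iff_AE[symmetric])
      show "integrable \<Omega> ?f" using r(1) by simp
      show "AE \<omega> in \<Omega>. 0 \<le> ?f \<omega>" using nn by eventually_elim simp
      show "(\<integral>\<omega>. ?f \<omega> \<partial>\<Omega>) = 0" using r(2) by simp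
    qed
    with nn show ?thesis by eventually_elim blast
  qed
  note ub = this
  have "AE \<omega> in \<Omega>. s_star (X 1 \<omega>) \<le> A_bound K" "AE \<omega> in \<Omega>. - s_star (X 1 \<omega>) \<le> A_bound K"
    using ub[of 1] ub[of "-1"] by auto
  then show ?thesis by eventually_elim auto
qed

lemma s_star_bounded_P: "AE z in P. \<bar>s_star (fst z)\<bar> \<le> A_bound K"
proof -
  note [measurable] = s_star_measurable
  show ?thesis using s_star_bounded by (subst AE_P_iff) auto
qed

lemma noise_centered_P:
  assumes [measurable]: "g \<in> borel_measurable borel" and bd: "AE z in P. \<bar>g (fst z)\<bar> \<le> b"
  shows "(\<integral>z. (snd z - s_star (fst z)) * g (fst z) \<partial>P) = 0"
proof -
  note [measurable] = s_star_measurable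
  have "AE \<omega> in \<Omega>. \<bar>g (X 1 \<omega>)\<bar> \<le> b" using bd by (subst (asm) AE_P_iff) auto
  from residual_centered(2)[OF assms(1) this] show ?thesis by (subst integral_P) auto
qed

text \<open>Unit conditional variance inserts the squared noise next to \<open>g\<close>; the lower
  bound on \<open>\<sigma>\<close> then recovers the residual.\<close>

lemma noise_variance_P:
  assumes [measurable]: "g \<in> borel_measurable borel" and g: "\<And>x. 0 \<le> g x \<and> g x \<le> b"
  shows "(sigma_min K)\<^sup>2 * (\<integral>z. g (fst z) \<partial>P) \<le> (\<integral>z. (snd z - s_star (fst z))\<^sup>2 * g (fst z) \<partial>P)"
proof -
  note [measurable] = s_star_measurable \<sigma>_measurable noise_measurable[OF one_mem]
  have b: "0 \<le> b" using g[of 0] by simp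
  have i1: "integrable \<Omega> (\<lambda>\<omega>. g (X 1 \<omega>) * (\<epsilon> 1 \<omega>)\<^sup>2)"
  proof (rule Bochner_Integration.integrable_bound)
    show "integrable \<Omega> (\<lambda>\<omega>. b * (\<epsilon> 1 \<omega>)\<^sup>2)" using noise_L2[OF one_mem] by simp
    show "AE \<omega> in \<Omega>. norm (g (X 1 \<omega>) * (\<epsilon> 1 \<omega>)\<^sup>2) \<le> norm (b * (\<epsilon> 1 \<omega>)\<^sup>2)"
      using g b by (auto simp: abs_mult intro!: mult_right_mono)
  qed measurable
  have "(sigma_min K)\<^sup>2 * (\<integral>z. g (fst z) \<partial>P) = (sigma_min K)\<^sup>2 * (\<integral>\<omega>. g (X 1 \<omega>) \<partial>\<Omega>)"
    by (subst integral_P) auto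
  also have "(\<integral>\<omega>. g (X 1 \<omega>) \<partial>\<Omega>) = (\<integral>\<omega>. g (X 1 \<omega>) * (\<epsilon> 1 \<omega>)\<^sup>2 \<partial>\<Omega>)"
    using cond_exp_product[OF assms(1) _ i1 noise_cond_var[OF one_mem]] by simp
  also have "(sigma_min K)\<^sup>2 * \<dots> = (\<integral>\<omega>. (sigma_min K)\<^sup>2 * (g (X 1 \<omega>) * (\<epsilon> 1 \<omega>)\<^sup>2) \<partial>\<Omega>)" by simp
  also have "\<dots> \<le> (\<integral>\<omega>. (Y 1 \<omega> - s_star (X 1 \<omega>))\<^sup>2 * g (X 1 \<omega>) \<partial>\<Omega>)"
  proof (rule integral_mono_AE)
    show "integrable \<Omega> (\<lambda>\<omega>. (Y 1 \<omega> - s_star (X 1 \<omega>))\<^sup>2 * g (X 1 \<omega>))"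
    proof (rule integrable_const_bound[where B="(2 * A_bound K)\<^sup>2 * b"])
      show "AE \<omega> in \<Omega>. norm ((Y 1 \<omega> - s_star (X 1 \<omega>))\<^sup>2 * g (X 1 \<omega>)) \<le> (2 * A_bound K)\<^sup>2 * b"
        using s_star_bounded Ab[OF one_mem]
      proof eventually_elim
        case (elim \<omega>)
        then have "\<bar>Y 1 \<omega> - s_star (X 1 \<omega>)\<bar> \<le> 2 * A_bound K" by linarith
        from sq_le_sq[OF this] show ?case
          using g[of "X 1 \<omega>"] by (auto simp: abs_mult simp del: power_mult_distrib intro!: mult_mono)
      qed
    qed measurable
    show "AE \<omega> in \<Omega>. (sigma_min K)\<^sup>2 * (g (X 1 \<omega>) * (\<epsilon> 1 \<omega>)\<^sup>2) \<le> (Y 1 \<omega> - s_star (X 1 \<omega>))\<^sup>2 * g (X 1 \<omega>)"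
      using An[OF one_mem] AE_space
    proof eventually_elim
      case (elim \<omega>)
      have "(sigma_min K)\<^sup>2 \<le> (\<sigma> (X 1 \<omega>))\<^sup>2"
        using elim(1) constants_pos by (intro power_mono) auto
      then have "(sigma_min K)\<^sup>2 * (g (X 1 \<omega>) * (\<epsilon> 1 \<omega>)\<^sup>2) \<le> (\<sigma> (X 1 \<omega>))\<^sup>2 * (g (X 1 \<omega>) * (\<epsilon> 1 \<omega>)\<^sup>2)"
        using g by (intro mult_right_mono mult_nonneg_nonneg) auto
      then show ?case
        by (simp add: noise_eq[OF elim(2), symmetric] power_mult_distrib mult_ac)
    qed
  qed (use i1 in auto)
  also have "\<dots> = (\<integral>z. (snd z - s_star (fst z))\<^sup>2 * g (fst z) \<partial>P)"
    by (subst integral_P) auto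
  finally show ?thesis .
qed

lemma prob_space_design: "prob_space (design_law P)"
  unfolding design_law_def by (rule P.prob_space_distr) (auto simp: measurable_cong_sets[OF sets_P refl])

lemma design_law_bounds:
  assumes S: "S \<in> sets borel" "S \<subseteq> {0..1}"
  shows "c_min K * measure lborel S \<le> measure (design_law P) S"
    and "measure (design_law P) S \<le> c_max K * measure lborel S"
proof -
  obtain f where f[measurable]: "f \<in> borel_measurable borel"
    and fb: "\<And>x. x \<in> {0..1} \<Longrightarrow> c_min K \<le> f x \<and> f x \<le> c_max K"
    and d: "design_law P = density lborel (\<lambda>x. ennreal (f x * indicator {0..1} x))"
    using AdLeb by blast
  note [measurable] = S(1)
  have cmin: "0 < c_min K" using constants_pos by simp
  have cmax: "0 \<le> c_max K" using fb[of 0] cmin by simp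
  have "emeasure lborel S \<le> emeasure lborel {0..1::real}" using S by (intro emeasure_mono) auto
  also have "\<dots> < \<infinity>" by simp
  finally have fin: "emeasure lborel S < \<infinity>" .
  then have eS: "emeasure lborel S = ennreal (measure lborel S)"
    by (simp add: emeasure_eq_ennreal_measure less_top)
  have fin2: "emeasure (design_law P) S = ennreal (measure (design_law P) S)"
    using prob_space.finite_measure[OF prob_space_design, THEN finite_measure.emeasure_eq_measure] by simp
  have eq: "emeasure (design_law P) S = (\<integral>\<^sup>+x. ennreal (f x) * indicator S x \<partial>lborel)"
    unfolding d using S by (subst emeasure_density) (auto intro!: nn_integral_cong split: split_indicator)
  have "ennreal (c_min K * measure lborel S) = (\<integral>\<^sup>+x. ennreal (c_min K) * indicator S x \<partial>lborel)"
    using S cmin by (simp add: nn_integral_cmult_indicator eS ennreal_mult)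
  also have "\<dots> \<le> emeasure (design_law P) S" unfolding eq
    using fb S by (intro nn_integral_mono) (auto split: split_indicator intro!: ennreal_leI)
  finally show "c_min K * measure lborel S \<le> measure (design_law P) S" unfolding fin2 by simp
  have "emeasure (design_law P) S \<le> (\<integral>\<^sup>+x. ennreal (c_max K) * indicator S x \<partial>lborel)" unfolding eq
    using fb S by (intro nn_integral_mono) (auto split: split_indicator intro!: ennreal_leI)
  also have "\<dots> = ennreal (c_max K * measure lborel S)"
    using S cmax by (simp add: nn_integral_cmult_indicator eS ennreal_mult)
  finally show "measure (design_law P) S \<le> c_max K * measure lborel S"
    unfolding fin2 using cmax by (simp add: ennreal_le_iff)
qed

lemma regression_model_exists:
  assumes M: "M \<in> \<M>"
  shows "\<exists>(B :: (real set \<times> nat) set) \<phi>. model_dim M = card B \<and>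
    regression_model \<Omega> n obs P B \<phi> M (basis_const1 K) (basis_const2 K) (real (r_max K) + 1)
      s_star (sM M) (A_bound K) (sigma_min K)"
proof -
  have sets: "sets (design_law P) = sets borel" by (simp add: design_law_def)
  have "\<exists>(B :: (real set \<times> nat) set) \<phi>. model_dim M = card B \<and>
    localized_basis (design_law P) B \<phi> M (basis_const1 K) (basis_const2 K) (real (r_max K) + 1)"
    unfolding basis_const1_def basis_const2_def
    by (rule localized_basis_exists[OF prob_space_design sets design_law_bounds])
      (use constants_pos pp_models[OF M] Aud[OF M] Alr[OF M] in auto)
  then obtain B :: "(real set \<times> nat) set" and \<phi> where B: "model_dim M = card B"
    and lb: "localized_basis (design_law P) B \<phi> M (basis_const1 K) (basis_const2 K) (real (r_max K) + 1)"
    by blast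
  have "regression_model \<Omega> n obs P B \<phi> M (basis_const1 K) (basis_const2 K) (real (r_max K) + 1)
      s_star (sM M) (A_bound K) (sigma_min K)"
    by (intro regression_model.intro regression_model_axioms.intro iid_sample_axioms lb
        constants_pos s_star_measurable response_bounded_P s_star_bounded_P noise_centered_P
        noise_variance_P projections M)
  then show ?thesis using B by blast
qed

end

end

section \<open>Comparison of penalized criteria\<close>

text \<open>In the following locale \<open>bias\<close>, \<open>gap\<close>, \<open>egap\<close> and \<open>fluct\<close> stand for the paper's
  \<open>l(s\<^sub>*, s\<^sub>M)\<close>, \<open>P(K s\<^sub>n(M) - K s\<^sub>M)\<close>, \<open>P\<^sub>n(K s\<^sub>M - K s\<^sub>n(M))\<close> and \<open>(P\<^sub>n - P)(K s\<^sub>M - K s\<^sub>*)\<close> on a fixed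
  realization of the data, \<open>mgap\<close> is the expectation of \<open>egap\<close>, and \<open>l\<close> is \<open>ln n\<close>.\<close>

locale penalized_selection =
  fixes \<M> :: "'m set" and dim bias gap egap mgap fluct pen :: "'m \<Rightarrow> real"
    and N l a e c0 c1 \<delta> Ar :: real
  assumes l: "1 \<le> l" and N: "1 \<le> N" and \<delta>: "0 \<le> \<delta>" "\<delta> < 1" and Ar: "0 < Ar"
    and e: "0 \<le> e" "e \<le> (1 - \<delta>) / 4" and c: "0 < c0" "0 \<le> c1"
    and bias: "M \<in> \<M> \<Longrightarrow> 0 \<le> bias M" and gap: "M \<in> \<M> \<Longrightarrow> 0 \<le> gap M" and egap: "M \<in> \<M> \<Longrightarrow> 0 \<le> egap M"
    and large: "M \<in> \<M> \<Longrightarrow> a * l ^ 3 \<le> dim M \<Longrightarrow>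
          c0 * dim M / N \<le> mgap M \<and> mgap M \<le> c1 * dim M / N \<and>
          \<bar>gap M - mgap M\<bar> \<le> e * mgap M \<and> \<bar>egap M - mgap M\<bar> \<le> e * mgap M \<and>
          \<bar>fluct M\<bar> \<le> e * (bias M + mgap M) \<and> 0 \<le> mgap M"
    and small: "M \<in> \<M> \<Longrightarrow> dim M \<le> a * l ^ 3 \<Longrightarrow>
          gap M \<le> c1 * (l ^ 3 / N) \<and> egap M \<le> c1 * (l ^ 3 / N) \<and>
          \<bar>fluct M\<bar> \<le> e * (bias M + l ^ 3 / N)"
    and pen_large: "M \<in> \<M> \<Longrightarrow> a * l ^ 3 \<le> dim M \<Longrightarrow>
          \<bar>pen M - 2 * mgap M\<bar> \<le> \<delta> * (bias M + mgap M)"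
    and pen_small: "M \<in> \<M> \<Longrightarrow> dim M \<le> a * l ^ 3 \<Longrightarrow>
          \<bar>pen M\<bar> \<le> Ar * (bias M / l\<^sup>2 + l ^ 3 / N)"
begin

definition loss :: "'m \<Rightarrow> real" where "loss M = bias M + gap M"

definition crit :: "'m \<Rightarrow> real" where "crit M = bias M + fluct M - egap M + pen M"

text \<open>The multiple \<open>8 e\<close> leaves room for replacing \<open>bias + mgap\<close> by
  the loss; \<open>Ar / l^2\<close> is the part of the small-model penalty proportional to the
  bias.\<close>

definition err :: real where "err = 8 * e + Ar / l\<^sup>2"

text \<open>Multiples of \<open>l^3 / N\<close> for small models: 1 for the fluctuation,
  \<open>c1\<close> each for \<open>egap\<close> and \<open>gap\<close>, \<open>Ar\<close> for the
  penalty.\<close>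

definition rem :: real where "rem = (1 + 2 * c1 + Ar) * (l ^ 3 / N)"

lemma rate_nonneg: "0 \<le> l ^ 3 / N"
  using l N by simp

lemma rem_nonneg: "0 \<le> rem"
  unfolding rem_def using c Ar by (intro mult_nonneg_nonneg rate_nonneg) auto

lemma err_bounds: "8 * e \<le> err" "0 \<le> err" "Ar / l\<^sup>2 \<le> err"
  using e Ar l by (auto simp: err_def)

lemma e_quarter: "e \<le> 1 / 4" using e \<delta> by simp

lemma loss_nonneg: "M \<in> \<M> \<Longrightarrow> 0 \<le> loss M"
  using bias gap by (simp add: loss_def)

context
  fixes M assumes M: "M \<in> \<M>" and D: "a * l ^ 3 \<le> dim M"
begin

text \<open>The criterion is \<open>bias + fluct - egap + pen\<close>; with \<open>egap\<close>
  close to \<open>mgap\<close> and \<open>pen\<close> close to \<open>2 mgap\<close> it is close to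
  \<open>bias + mgap\<close>, the ideal risk. This explains the factor 2 in the penalty.\<close>

lemma large_crit: "(1 - \<delta> - 2 * e) * (bias M + mgap M) \<le> crit M"
    "crit M \<le> (1 + \<delta> + 2 * e) * (bias M + mgap M)"
proof -
  note b = large[OF M D] pen_large[OF M D] bias[OF M]
  have "0 \<le> e * bias M" using e b by simp
  then have "\<bar>crit M - (bias M + mgap M)\<bar> \<le> \<delta> * (bias M + mgap M) + 2 * (e * (bias M + mgap M))"
  proof -
    have "\<bar>egap M - mgap M\<bar> \<le> e * mgap M" "\<bar>fluct M\<bar> \<le> e * bias M + e * mgap M"
      "\<bar>pen M - 2 * mgap M\<bar> \<le> \<delta> * (bias M + mgap M)"
      using b by (auto simp: distrib_left)
    then show ?thesis
      using \<open>0 \<le> e * bias M\<close> unfolding crit_def distrib_left[of e] abs_le_iff by simp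
  qed
  then show "(1 - \<delta> - 2 * e) * (bias M + mgap M) \<le> crit M"
    "crit M \<le> (1 + \<delta> + 2 * e) * (bias M + mgap M)"
    unfolding left_diff_distrib distrib_right[of _ _ "bias M + mgap M"] mult_1_left by linarith+
qed

lemma large_loss: "loss M \<le> (1 + e) * (bias M + mgap M)" "(1 - e) * (bias M + mgap M) \<le> loss M"
proof -
  note b = large[OF M D] bias[OF M]
  have "0 \<le> e * bias M" using e b by simp
  then show "loss M \<le> (1 + e) * (bias M + mgap M)" "(1 - e) * (bias M + mgap M) \<le> loss M"
    using b unfolding loss_def by (auto simp: algebra_simps)
qed

text \<open>Criterion and loss are both compared with \<open>bias + mgap\<close>; the slack
  \<open>8 e \<le> err\<close> pays for the composition of the two comparisons.\<close>

lemma large_sandwich: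
  assumes "err \<le> 1 - \<delta>"
  shows "(1 - \<delta> - err) * loss M \<le> crit M" "crit M \<le> (1 + \<delta> + err) * loss M"
proof -
  let ?S = "bias M + mgap M"
  have S: "0 \<le> ?S" using large[OF M D] bias[OF M] by simp
  note q = loss_nonneg[OF M]
  have "(1 - \<delta> - err) * loss M \<le> (1 - \<delta> - err) * ((1 + e) * ?S)"
    using assms large_loss(1) by (intro mult_left_mono) auto
  also have "\<dots> = ((1 - \<delta> - err) * (1 + e)) * ?S" by simp
  also have "\<dots> \<le> (1 - \<delta> - 2 * e) * ?S"
  proof (rule mult_right_mono[OF _ S])
    have "(1 - \<delta> - err) * (1 + e) \<le> (1 - \<delta> - err) + 1 * e"
      using mult_right_mono[of "1 - \<delta> - err" 1 e] e \<delta> err_bounds by (simp add: distrib_left)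
    then show "(1 - \<delta> - err) * (1 + e) \<le> 1 - \<delta> - 2 * e" using err_bounds e by linarith
  qed
  also have "\<dots> \<le> crit M" by (rule large_crit)
  finally show "(1 - \<delta> - err) * loss M \<le> crit M" .
  have "crit M \<le> (1 + \<delta> + 2 * e) * ?S" by (rule large_crit)
  also have "\<dots> \<le> ((1 + \<delta> + err) * (1 - e)) * ?S"
  proof (rule mult_right_mono[OF _ S])
    have "(1 + \<delta> + err) * e \<le> 3 * e"
      using assms \<delta> e by (intro mult_right_mono) auto
    then show "1 + \<delta> + 2 * e \<le> (1 + \<delta> + err) * (1 - e)"
      using err_bounds e by (simp add: right_diff_distrib)
  qed
  also have "\<dots> = (1 + \<delta> + err) * ((1 - e) * ?S)" by simp
  also have "\<dots> \<le> (1 + \<delta> + err) * loss M"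
    using large_loss(2) \<delta> err_bounds by (intro mult_left_mono) auto
  finally show "crit M \<le> (1 + \<delta> + err) * loss M" .
qed

end

context
  fixes M assumes M: "M \<in> \<M>" and D: "dim M \<le> a * l ^ 3"
begin

text \<open>For small models every variance term is of order \<open>l^3 / N\<close>, so the
  criterion is the bias up to \<open>err\<close> and an additive remainder.\<close>

lemma small_crit: "(1 - err) * bias M - (1 + c1 + Ar) * (l ^ 3 / N) \<le> crit M"
    "crit M \<le> (1 + err) * bias M + rem"
proof -
  define \<rho> where "\<rho> = l ^ 3 / N"
  have \<rho>: "0 \<le> \<rho>" using rate_nonneg by (simp add: \<rho>_def)
  note b = small[OF M D, folded \<rho>_def] pen_small[OF M D, folded \<rho>_def] bias[OF M] egap[OF M]
  have "Ar * (bias M / l\<^sup>2 + \<rho>) = Ar / l\<^sup>2 * bias M + Ar * \<rho>" by (simp add: distrib_left)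
  moreover have "(e + Ar / l\<^sup>2) * bias M \<le> err * bias M"
    using b e by (intro mult_right_mono) (auto simp: err_def)
  moreover have "e * \<rho> \<le> 1 * \<rho>" using e_quarter \<rho> by (intro mult_right_mono) auto
  moreover have "0 \<le> c1 * \<rho>" using c \<rho> by simp
  ultimately show "(1 - err) * bias M - (1 + c1 + Ar) * (l ^ 3 / N) \<le> crit M"
    "crit M \<le> (1 + err) * bias M + rem"
    using b unfolding crit_def rem_def \<rho>_def[symmetric] by (auto simp: algebra_simps)
qed

lemma small_sandwich:
  assumes "err \<le> 1 - \<delta>"
  shows "(1 - \<delta> - err) * loss M - rem \<le> crit M" "crit M \<le> (1 + \<delta> + err) * loss M + rem"
proof -
  define \<rho> where "\<rho> = l ^ 3 / N"
  have t: "0 \<le> 1 - err" "1 - err \<le> 1" using assms \<delta> err_bounds by auto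
  have g: "0 \<le> gap M" "gap M \<le> c1 * \<rho>" using small[OF M D] gap[OF M] by (auto simp: \<rho>_def)
  have "(1 - \<delta> - err) * loss M \<le> (1 - err) * loss M"
    using loss_nonneg[OF M] \<delta> by (intro mult_right_mono) auto
  also have "\<dots> \<le> (1 - err) * bias M + c1 * \<rho>"
    using mult_right_mono[OF t(2) g(1)] g by (simp add: loss_def distrib_left)
  finally show "(1 - \<delta> - err) * loss M - rem \<le> crit M"
    using small_crit(1) by (simp add: rem_def \<rho>_def[symmetric] algebra_simps)
  have "(1 + err) * bias M \<le> (1 + \<delta> + err) * loss M"
    using bias[OF M] gap[OF M] err_bounds \<delta> by (intro mult_mono) (auto simp: loss_def)
  then show "crit M \<le> (1 + \<delta> + err) * loss M + rem" using small_crit(2) by linarith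
qed

end

lemma sandwich:
  assumes "M \<in> \<M>" "err \<le> 1 - \<delta>"
  shows "(1 - \<delta> - err) * loss M - rem \<le> crit M" "crit M \<le> (1 + \<delta> + err) * loss M + rem"
proof -
  consider "a * l ^ 3 \<le> dim M" | "dim M \<le> a * l ^ 3" by linarith
  then have "(1 - \<delta> - err) * loss M - rem \<le> crit M \<and> crit M \<le> (1 + \<delta> + err) * loss M + rem"
  proof cases
    case 1
    then show ?thesis using large_sandwich[OF assms(1) 1 assms(2)] rem_nonneg by linarith
  next
    case 2
    then show ?thesis using small_sandwich[OF assms(1) 2 assms(2)] by blast
  qed
  then show "(1 - \<delta> - err) * loss M - rem \<le> crit M" "crit M \<le> (1 + \<delta> + err) * loss M + rem" by auto
qed

text \<open>The two factors differ by \<open>2 err / (d (d - err))\<close> with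
  \<open>d = 1 - \<delta>\<close>, which is at most \<open>4 err / d^2\<close> because
  \<open>err \<le> d / 2\<close>.\<close>

lemma oracle_factor:
  assumes err: "err \<le> (1 - \<delta>) / 2" and le: "(1 - \<delta> - err) * x \<le> (1 + \<delta> + err) * y + r"
    and y: "0 \<le> y" and r: "0 \<le> r" and \<theta>: "err \<le> \<theta>"
  shows "x \<le> ((1 + \<delta>) / (1 - \<delta>) + 5 * \<theta> / (1 - \<delta>)\<^sup>2) * y + 2 / (1 - \<delta>) * r"
proof -
  define d where "d = 1 - \<delta>"
  have d: "0 < d" "d \<le> 1" using \<delta> by (auto simp: d_def)
  have pos: "d / 2 \<le> d - err" using err by (simp add: d_def)
  then have p: "0 < d - err" using d by linarith
  have "x \<le> ((1 + \<delta> + err) * y + r) / (d - err)"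
    using le p by (simp add: d_def pos_le_divide_eq mult.commute)
  also have "\<dots> = (1 + \<delta> + err) / (d - err) * y + r / (d - err)"
    by (subst add_divide_distrib) (simp only: times_divide_eq_left)
  also have "\<dots> \<le> ((1 + \<delta>) / d + 5 * \<theta> / d\<^sup>2) * y + 2 / d * r"
  proof (intro add_mono mult_right_mono y)
    have "(1 + \<delta> + err) / (d - err) - (1 + \<delta>) / d = 2 * err / (d * (d - err))"
    proof -
      have "(1 + \<delta> + err) * d - (1 + \<delta>) * (d - err) = 2 * err" by (simp add: d_def algebra_simps)
      then show ?thesis using p d by (subst diff_frac_eq) (auto simp: mult.commute)
    qed
    also have "\<dots> \<le> 2 * err / (d * (d / 2))"
      using err_bounds d pos by (intro divide_left_mono mult_left_mono mult_pos_pos p) auto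
    also have "\<dots> = 4 * err / d\<^sup>2" by (simp add: power2_eq_square)
    also have "\<dots> \<le> 5 * \<theta> / d\<^sup>2" using err_bounds \<theta> by (intro divide_right_mono) auto
    finally show "(1 + \<delta> + err) / (d - err) \<le> (1 + \<delta>) / d + 5 * \<theta> / d\<^sup>2" by linarith
    have "r / (d - err) \<le> r / (d / 2)" using r d pos p by (intro divide_left_mono) auto
    then show "r / (d - err) \<le> 2 / d * r" by (simp add: mult.commute)
  qed
  finally show ?thesis by (simp add: d_def)
qed

lemma oracle_inequality:
  assumes "Mh \<in> \<M>" "Ms \<in> \<M>" "crit Mh \<le> crit Ms" "err \<le> (1 - \<delta>) / 2" "err \<le> \<theta>"
  shows "loss Mh \<le> ((1 + \<delta>) / (1 - \<delta>) + 5 * \<theta> / (1 - \<delta>)\<^sup>2) * loss Ms + 4 / (1 - \<delta>) * rem"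
proof -
  have "err \<le> 1 - \<delta>" using assms(4) \<delta> by simp
  from sandwich(1)[OF assms(1) this] sandwich(2)[OF assms(2) this]
  have "(1 - \<delta> - err) * loss Mh \<le> (1 + \<delta> + err) * loss Ms + 2 * rem" using assms(3) by linarith
  from oracle_factor[OF assms(4) this loss_nonneg[OF assms(2)] _ assms(5)] rem_nonneg
  show ?thesis by simp
qed

lemma oracle_inequality_large:
  assumes "Mh \<in> \<M>" "Ms \<in> \<M>" "a * l ^ 3 \<le> dim Mh" "a * l ^ 3 \<le> dim Ms"
    "crit Mh \<le> crit Ms" "err \<le> (1 - \<delta>) / 2" "err \<le> \<theta>"
  shows "loss Mh \<le> ((1 + \<delta>) / (1 - \<delta>) + 5 * \<theta> / (1 - \<delta>)\<^sup>2) * loss Ms"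
proof -
  have "err \<le> 1 - \<delta>" using assms(6) \<delta> by simp
  from large_sandwich(1)[OF assms(1,3) this] large_sandwich(2)[OF assms(2,4) this]
  have "(1 - \<delta> - err) * loss Mh \<le> (1 + \<delta> + err) * loss Ms + 0" using assms(5) by linarith
  from oracle_factor[OF assms(6) this loss_nonneg[OF assms(2)] _ assms(7)]
  show ?thesis by simp
qed

text \<open>A model \<open>M0\<close> that balances bias and variance has a small criterion, which excludes models of
  larger variance (first statement) or of larger bias (second statement).\<close>

context
  fixes M0 g assumes M0: "M0 \<in> \<M>" "a * l ^ 3 \<le> dim M0" and g: "bias M0 + mgap M0 \<le> g"
begin

lemma crit_M0: "crit M0 \<le> 3 * g"
proof -
  have "0 \<le> bias M0 + mgap M0" using large[OF M0] bias[OF M0(1)] by simp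
  then have "(1 + \<delta> + 2 * e) * (bias M0 + mgap M0) \<le> 3 * g"
    using e_quarter e \<delta> g by (intro mult_mono) auto
  then show ?thesis using large_crit(2)[OF M0] by linarith
qed

lemma loss_M0: "loss M0 \<le> 3 * g"
proof -
  have "0 \<le> bias M0 + mgap M0" using large[OF M0] bias[OF M0(1)] by simp
  then have "(1 + e) * (bias M0 + mgap M0) \<le> 3 * g" using e_quarter e g by (intro mult_mono) auto
  then show ?thesis using large_loss(1)[OF M0] by linarith
qed

text \<open>A dimension above \<open>T\<close> costs a variance \<open>c0 T / N\<close> that the
  criterion of \<open>M0\<close> cannot match. Only the smallness of \<open>e\<close> enters, not
  that of \<open>err\<close>, so the resulting threshold is free of \<open>Ar\<close>.\<close>

lemma dim_selected_le:
  assumes "Mh \<in> \<M>" "crit Mh \<le> crit M0" "6 * g < (1 - \<delta>) * (c0 * T / N)" "a * l ^ 3 \<le> T"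
  shows "dim Mh \<le> T"
proof (rule ccontr)
  assume "\<not> dim Mh \<le> T"
  then have d: "T \<le> dim Mh" "a * l ^ 3 \<le> dim Mh" using assms(4) by auto
  have "c0 * T / N \<le> c0 * dim Mh / N" using d c N by (intro divide_right_mono mult_left_mono) auto
  then have "c0 * T / N \<le> bias Mh + mgap Mh" using large[OF assms(1) d(2)] bias[OF assms(1)] by linarith
  then have "(1 - \<delta>) * (c0 * T / N) \<le> (1 - \<delta>) * (bias Mh + mgap Mh)" using \<delta> by (intro mult_left_mono) auto
  also have "\<dots> \<le> 2 * ((1 - \<delta> - 2 * e) * (bias Mh + mgap Mh))"
  proof -
    have "0 \<le> bias Mh + mgap Mh" using large[OF assms(1) d(2)] bias[OF assms(1)] by simp
    then have "(1 - \<delta>) * (bias Mh + mgap Mh) \<le> (2 * (1 - \<delta> - 2 * e)) * (bias Mh + mgap Mh)"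
      using e by (intro mult_right_mono) auto
    then show ?thesis by (simp only: mult.assoc)
  qed
  also have "\<dots> \<le> 6 * g" using large_crit(1)[OF assms(1) d(2)] crit_M0 assms(2) by linarith
  finally show False using assms(3) by simp
qed

text \<open>For a small model the criterion is at least half its bias minus the remainder, and the
  bias is at least \<open>b\<close>.\<close>

lemma dim_selected_ge:
  assumes "Mh \<in> \<M>" "crit Mh \<le> crit M0" "err \<le> (1 - \<delta>) / 2"
    and b: "\<And>M. M \<in> \<M> \<Longrightarrow> dim M \<le> a * l ^ 3 \<Longrightarrow> b \<le> bias M" and bg: "3 * g < b / 2 - rem"
  shows "a * l ^ 3 \<le> dim Mh"
proof (rule ccontr)
  assume "\<not> a * l ^ 3 \<le> dim Mh"
  then have d: "dim Mh \<le> a * l ^ 3" by simp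
  have "b / 2 \<le> bias Mh / 2" using b[OF assms(1) d] by simp
  also have "\<dots> \<le> (1 - err) * bias Mh"
    using assms(3) \<delta> bias[OF assms(1)] mult_right_mono[of "1 / 2" "1 - err" "bias Mh"] by simp
  also have "\<dots> \<le> crit Mh + rem"
  proof -
    have "(1 + c1 + Ar) * (l ^ 3 / N) \<le> rem"
      unfolding rem_def using rate_nonneg c by (intro mult_right_mono) auto
    then show ?thesis using small_crit(1)[OF assms(1) d] by linarith
  qed
  finally show False using crit_M0 assms(2) bg by linarith
qed

lemma dim_oracle_ge:
  assumes "Ms \<in> \<M>" "loss Ms \<le> loss M0"
    and b: "\<And>M. M \<in> \<M> \<Longrightarrow> dim M \<le> a * l ^ 3 \<Longrightarrow> b \<le> bias M" and bg: "3 * g < b / 2 - rem"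
  shows "a * l ^ 3 \<le> dim Ms"
proof (rule ccontr)
  assume "\<not> a * l ^ 3 \<le> dim Ms"
  then have "b \<le> loss Ms" using b[of Ms] assms(1) gap[OF assms(1)] by (simp add: loss_def)
  then have b1: "b \<le> 3 * g" using assms(2) loss_M0 by linarith
  have "0 \<le> g" using g large[OF M0] bias[OF M0(1)] by linarith
  then show False using b1 bg rem_nonneg by linarith
qed

end

end

section \<open>Uniform control of the models\<close>

definition noise_const :: "sapp_constants \<Rightarrow> real" where
  "noise_const K = A_bound K * (1 + basis_const2 K)"

text \<open>The 4 outweighs the \<open>n^2\<close> events per model and leaves
  \<open>n^(-2)\<close>; \<open>alpha_card K\<close> pays for the union over the models.\<close>

definition conc_exp :: "sapp_constants \<Rightarrow> real" where "conc_exp K = 4 + alpha_card K"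

definition diag_const :: "sapp_constants \<Rightarrow> real" where
  "diag_const K = ((noise_const K)\<^sup>2 * basis_const1 K)\<^sup>2 + conc_exp K"

definition offdiag_const :: "sapp_constants \<Rightarrow> real" where
  "offdiag_const K = (noise_const K)\<^sup>2 * basis_const1 K * ((noise_const K)\<^sup>2 + conc_exp K)\<^sup>2 + conc_exp K"

definition risk_const :: "sapp_constants \<Rightarrow> real" where
  "risk_const K = 8 * (real (r_max K) + 1) * (basis_const1 K * A_plus K + conc_exp K) *
      ((noise_const K)\<^sup>2 + diag_const K + offdiag_const K) + diag_const K + offdiag_const K
      + 10 * (noise_const K)\<^sup>2"

definition large_sample :: "sapp_constants \<Rightarrow> nat \<Rightarrow> bool" where
  "large_sample K n \<longleftrightarrow> (let L = ln (real n); B = noise_const K; C1 = basis_const1 K; \<kappa> = conc_exp K in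
     1 \<le> n \<and> 1 \<le> L \<and> L\<^sup>2 \<le> real n \<and> B\<^sup>2 * C1 * A_plus K \<le> L \<and> ((C1 + 1) * A_plus K)\<^sup>2 \<le> L \<and>
     (B * sqrt C1 * (B\<^sup>2 + \<kappa>)) * sqrt (L / n) \<le> 1 \<and> B\<^sup>2 * C1 * sqrt (L / n) \<le> 1 \<and> 6 * B\<^sup>2 \<le> L \<and>
     2 * (real (r_max K) + 1) * (C1 * A_plus K + \<kappa>) \<le> sqrt L)"

lemma eventually_ln_ge: "\<forall>\<^sub>F n::nat in sequentially. c \<le> ln (real n)" for c :: real
  by real_asymp

lemma eventually_sqrt_ln_ge: "\<forall>\<^sub>F n::nat in sequentially. c \<le> sqrt (ln (real n))" for c :: real
  by real_asymp

lemma eventually_sqrt_ln_over_le: "\<forall>\<^sub>F n::nat in sequentially. c * sqrt (ln (real n) / real n) \<le> 1" for c :: real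
proof -
  have "(\<lambda>n::nat. sqrt (ln (real n) / real n)) \<longlonglongrightarrow> 0" by real_asymp
  then have "(\<lambda>n::nat. c * sqrt (ln (real n) / real n)) \<longlonglongrightarrow> 0" by (rule tendsto_mult_right_zero)
  then have "\<forall>\<^sub>F n::nat in sequentially. c * sqrt (ln (real n) / real n) < 1" by (rule order_tendstoD) simp
  then show ?thesis by (rule eventually_mono) simp
qed

lemma eventually_large_sample: "\<forall>\<^sub>F n in sequentially. large_sample K n"
proof -
  have 1: "\<forall>\<^sub>F n::nat in sequentially. (ln (real n))\<^sup>2 \<le> real n" by real_asymp
  show ?thesis
    unfolding large_sample_def Let_def
    by (intro eventually_conj eventually_ge_at_top eventually_ln_ge eventually_sqrt_ln_ge
        eventually_sqrt_ln_over_le 1)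
qed

context SAPP
begin

text \<open>The basis disappears here: \<open>V\<close> is only asserted to exist, and the constants
  are functions of \<open>K\<close>, hence common to all models. One \<open>V\<close> centers the
  mean and both random gaps, which makes them comparable with one another.\<close>

lemma model_concentration:
  assumes ls: "large_sample K n" and M: "M \<in> \<M>"
  defines "L \<equiv> ln (real n)" and "D \<equiv> model_dim M" and "E \<equiv> mean_emp_excess \<Omega> n X Y sM sn M"
    and "bias \<equiv> excess_loss P s_star (sM M)"
  defines "H \<equiv> (D + L ^ 3) / real n"
  shows "\<exists>G\<in>events. 1 - 10 * real n ^ 2 * exp (- (conc_exp K * L)) \<le> prob G \<and> G \<subseteq> space \<Omega> \<and>
    0 \<le> bias \<and> bias \<le> (noise_const K)\<^sup>2 \<and>
    (\<exists>V. (sigma_min K)\<^sup>2 * D \<le> V \<and> V \<le> (noise_const K)\<^sup>2 * D \<and>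
      \<bar>E - V / n\<bar> \<le> risk_const K / sqrt L * H \<and>
      (\<forall>\<omega>\<in>G. 0 \<le> excess_loss P s_star (sn \<omega> M) - bias \<and>
        \<bar>(excess_loss P s_star (sn \<omega> M) - bias) - V / n\<bar> \<le> risk_const K / sqrt L * H \<and>
        0 \<le> emp_mean n X Y \<omega> (\<lambda>z. contrast (sM M) z - contrast (sn \<omega> M) z) \<and>
        \<bar>emp_mean n X Y \<omega> (\<lambda>z. contrast (sM M) z - contrast (sn \<omega> M) z) - V / n\<bar> \<le> risk_const K / sqrt L * H \<and>
        \<bar>emp_mean n X Y \<omega> (\<lambda>z. contrast (sM M) z - contrast s_star z) - bias\<bar>
           \<le> 9 * (noise_const K)\<^sup>2 * bias / L + conc_exp K * L\<^sup>2 / n))"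
proof -
  have n1: "1 \<le> n" using ls by (simp add: large_sample_def Let_def)
  obtain B :: "(real set \<times> nat) set" and \<phi> where dim: "model_dim M = card B"
    and rm: "regression_model \<Omega> n obs P B \<phi> M (basis_const1 K) (basis_const2 K) (real (r_max K) + 1)
      s_star (sM M) (A_bound K) (sigma_min K)"
    using regression_model_exists[OF n1 M] by blast
  interpret m: regression_model \<Omega> n obs P B \<phi> M "basis_const1 K" "basis_const2 K" "real (r_max K) + 1"
      s_star "sM M" "A_bound K" "sigma_min K" by (rule rm)
  have K0: "m.K0 = noise_const K" by (simp add: m.K0_def noise_const_def)
  have Dm: "m.D = D" by (simp add: m.D_def D_def dim)
  interpret m: least_squares_model \<Omega> n obs P B \<phi> M "basis_const1 K" "basis_const2 K" "real (r_max K) + 1"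
      s_star "sM M" "A_bound K" "sigma_min K" "conc_exp K" "A_plus K" L "\<lambda>\<omega>. sn \<omega> M"
  proof unfold_locales
    show "L = ln (real n)" by (simp add: L_def)
    show "4 \<le> conc_exp K" using constants_pos by (simp add: conc_exp_def)
    show "0 < A_plus K" using constants_pos by simp
    show "m.D \<le> A_plus K * real n / L\<^sup>2" "m.D \<le> real n"
      using P2[OF M] by (auto simp: Dm D_def L_def)
    show "is_arg_min (\<lambda>s. (\<Sum>i=1..n. contrast s (X i \<omega>, Y i \<omega>)) / real n) (\<lambda>s. s \<in> M) (sn \<omega> M)"
      if "\<omega> \<in> space \<Omega>" for \<omega>
      using estimators[OF M that] by (simp add: emp_mean_def[abs_def])
  qed (use ls in \<open>simp_all add: large_sample_def Let_def K0 L_def\<close>)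
  have emp: "m.emp \<omega> f = emp_mean n X Y \<omega> f" for \<omega> f by (simp add: m.emp_def emp_mean_def)
  have Hm: "m.H = H" by (simp add: m.H_def H_def Dm)
  have bias: "m.bias = bias" by (simp add: m.bias_def bias_def)
  have cm: "m.c_mean = risk_const K"
    by (simp add: m.c_mean_def m.c_risk_def m.c_diag_def m.c_off_def K0 risk_const_def diag_const_def offdiag_const_def)
  have p2: "m.p2 \<omega> = emp_mean n X Y \<omega> (\<lambda>z. contrast (sM M) z - contrast (sn \<omega> M) z)" for \<omega>
    by (simp add: m.p2_def emp)
  have E: "expectation m.p2 = E" by (simp add: p2[abs_def] E_def mean_emp_excess_def)
  have dbar: "m.dbar \<omega> = emp_mean n X Y \<omega> (\<lambda>z. contrast (sM M) z - contrast s_star z) - bias" for \<omega>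
    by (simp add: m.dbar_def emp_mean_def m.loss_diff_def bias)
  have w: "m.c_mean * m.w * m.H = risk_const K / sqrt L * H" by (simp add: cm m.w_def Hm)
  have le: "m.c_risk * m.w * m.H \<le> risk_const K / sqrt L * H"
    unfolding w[symmetric] using m.w_pos m.H_nonneg by (intro mult_right_mono) (auto simp: m.c_mean_def)
  show ?thesis
  proof (intro bexI[of _ m.good] conjI exI[of _ m.V] ballI)
    show "m.good \<in> events" "1 - 10 * real n ^ 2 * exp (- (conc_exp K * L)) \<le> prob m.good"
      by (rule m.good_prob)+
    show "m.good \<subseteq> space \<Omega>" by (auto simp: m.good_def)
    show "0 \<le> bias" "bias \<le> (noise_const K)\<^sup>2" using m.bias_nonneg m.bias_le by (auto simp: bias K0)
    show "(sigma_min K)\<^sup>2 * D \<le> m.V" "m.V \<le> (noise_const K)\<^sup>2 * D"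
      using m.V_lower m.V_upper by (auto simp: Dm K0)
    show "\<bar>E - m.V / n\<bar> \<le> risk_const K / sqrt L * H" using m.mean_p2 unfolding w E .
    fix \<omega> assume g: "\<omega> \<in> m.good"
    then have \<omega>: "\<omega> \<in> space \<Omega>" by (simp add: m.good_def)
    have p1: "excess_loss P s_star (sn \<omega> M) - bias = m.p1 \<omega>"
      using m.excess_loss_sn[OF \<omega>] by (simp add: bias)
    show "0 \<le> excess_loss P s_star (sn \<omega> M) - bias" unfolding p1 by (rule m.p1_nonneg)
    show "\<bar>(excess_loss P s_star (sn \<omega> M) - bias) - m.V / n\<bar> \<le> risk_const K / sqrt L * H"
      unfolding p1 using m.risk_concentration(1)[OF g] le by linarith
    show "0 \<le> emp_mean n X Y \<omega> (\<lambda>z. contrast (sM M) z - contrast (sn \<omega> M) z)"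
      using m.p2_nonneg[OF \<omega>] unfolding p2 .
    show "\<bar>emp_mean n X Y \<omega> (\<lambda>z. contrast (sM M) z - contrast (sn \<omega> M) z) - m.V / n\<bar> \<le> risk_const K / sqrt L * H"
      using m.risk_concentration(2)[OF g] le unfolding p2 by linarith
    have "\<bar>m.dbar \<omega>\<bar> \<le> 9 * m.K0\<^sup>2 * m.bias / L + conc_exp K * L\<^sup>2 / n"
      using g unfolding m.good_def by simp
    then show "\<bar>emp_mean n X Y \<omega> (\<lambda>z. contrast (sM M) z - contrast s_star z) - bias\<bar>
           \<le> 9 * (noise_const K)\<^sup>2 * bias / L + conc_exp K * L\<^sup>2 / n"
      unfolding dbar K0 bias .
  qed
qed

end

section \<open>Derived constants and the regimes of the sample size\<close>

definition err_const :: "sapp_constants \<Rightarrow> real" where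
  "err_const K = 4 * risk_const K * (1 + 1 / A_plus K) / (sigma_min K)\<^sup>2 +
     (9 * (noise_const K)\<^sup>2 + conc_exp K) * (1 + 2 / (A_plus K * (sigma_min K)\<^sup>2))"

definition var_const :: "sapp_constants \<Rightarrow> real" where
  "var_const K = ((noise_const K)\<^sup>2 + risk_const K) * (A_plus K + 1) + (noise_const K)\<^sup>2 + risk_const K * (1 + 1 / A_plus K)"

definition balance_const :: "sapp_constants \<Rightarrow> real" where
  "balance_const K = C_plus K + var_const K * c_rich K"

text \<open>\<open>Ar\<close> is absent on purpose: this regime fixes \<open>n0\<close>. The last
  conjunct makes the variance at dimension \<open>n^(\<eta> + 1 / (1 + \<beta>))\<close> exceed the
  balanced risk.\<close>

definition selection_regime :: "sapp_constants \<Rightarrow> real \<Rightarrow> real \<Rightarrow> nat \<Rightarrow> bool" where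
  "selection_regime K \<eta> \<delta> n \<longleftrightarrow> large_sample K n \<and>
     2 * risk_const K * (1 + 1 / A_plus K) / (sigma_min K)\<^sup>2 \<le> sqrt (ln (real n)) \<and>
     4 * err_const K / (1 - \<delta>) \<le> sqrt (ln (real n)) \<and>
     A_plus K * ln (real n) ^ 3 \<le> real n powr (1 / (1 + beta_plus K)) \<and>
     ln (real n) ^ 3 \<le> real n \<and>
     12 * balance_const K < ((1 - \<delta>) * (sigma_min K)\<^sup>2) * real n powr \<eta>"

definition penalty_regime :: "sapp_constants \<Rightarrow> real \<Rightarrow> real \<Rightarrow> nat \<Rightarrow> bool" where
  "penalty_regime K Ar \<delta> n \<longleftrightarrow>
     8 * (err_const K / sqrt (ln (real n))) + Ar / (ln (real n))\<^sup>2 \<le> (1 - \<delta>) / 2"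

text \<open>The guaranteed bias at the largest small dimension \<open>A_plus K * (ln n)^3\<close>
  decays only like a power of a logarithm and eventually exceeds the balanced risk together with the
  remainder.\<close>

definition bias_regime :: "sapp_constants \<Rightarrow> real \<Rightarrow> real \<Rightarrow> real \<Rightarrow> nat \<Rightarrow> bool" where
  "bias_regime K Cm bm Ar n \<longleftrightarrow>
     3 * (balance_const K * real n powr (- (beta_plus K / (1 + beta_plus K))))
       < Cm * (A_plus K * ln (real n) ^ 3) powr (- bm) / 2 - (1 + 2 * var_const K + Ar) * (ln (real n) ^ 3 / real n)"

lemma eventually_selection_regime:
  assumes "0 < \<eta>" "\<delta> < 1" "0 < beta_plus K" "0 < sigma_min K"
  shows "\<forall>\<^sub>F n in sequentially. selection_regime K \<eta> \<delta> n"
proof -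
  have 1: "\<forall>\<^sub>F n::nat in sequentially. a * ln (real n) ^ 3 \<le> real n powr s" if "0 < s" for a s :: real
    using that by real_asymp
  have 2: "\<forall>\<^sub>F n::nat in sequentially. ln (real n) ^ 3 \<le> real n" by real_asymp
  have 3: "\<forall>\<^sub>F n::nat in sequentially. b < c * real n powr \<eta>" if "0 < c" for b c :: real
    using that assms(1) by real_asymp
  show ?thesis
    unfolding selection_regime_def using assms
    by (intro eventually_conj eventually_large_sample eventually_sqrt_ln_ge 1 2 3) auto
qed

lemma eventually_penalty_regime:
  assumes "\<delta> < 1"
  shows "\<forall>\<^sub>F n in sequentially. penalty_regime K Ar \<delta> n"
proof -
  have "(\<lambda>n::nat. 1 / sqrt (ln (real n))) \<longlonglongrightarrow> 0" "(\<lambda>n::nat. 1 / (ln (real n))\<^sup>2) \<longlonglongrightarrow> 0" by real_asymp+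
  from tendsto_add[OF tendsto_mult_right_zero[OF this(1), of "8 * err_const K"] tendsto_mult_right_zero[OF this(2), of Ar]]
  have "(\<lambda>n::nat. 8 * err_const K * (1 / sqrt (ln (real n))) + Ar * (1 / (ln (real n))\<^sup>2)) \<longlonglongrightarrow> 0" by simp
  then have "\<forall>\<^sub>F n::nat in sequentially. 8 * err_const K * (1 / sqrt (ln (real n))) + Ar * (1 / (ln (real n))\<^sup>2) < (1 - \<delta>) / 2"
    by (rule order_tendstoD) (use assms in simp)
  then show ?thesis unfolding penalty_regime_def by (rule eventually_mono) simp
qed

lemma ln_powr_over_powr_tendsto:
  fixes s p :: real
  assumes "0 < s"
  shows "(\<lambda>n::nat. ln (real n) powr p * real n powr (- s)) \<longlonglongrightarrow> 0"
  using assms by real_asymp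

text \<open>After multiplication by \<open>L powr (3 * bm)\<close> the right-hand main term becomes
  the fixed positive number \<open>c\<close>, while the other two terms tend to zero.\<close>

lemma eventually_bias_regime:
  assumes "0 < beta_plus K" "0 < A_plus K" "0 < Cm"
  shows "\<forall>\<^sub>F n in sequentially. bias_regime K Cm bm Ar n"
proof -
  define s where "s = beta_plus K / (1 + beta_plus K)"
  define r where "r = 1 + 2 * var_const K + Ar"
  have s: "0 < s" using assms by (simp add: s_def)
  define c where "c = Cm * A_plus K powr (- bm) / 2"
  have c: "0 < c" using assms by (simp add: c_def)
  from tendsto_add[OF tendsto_mult_right_zero[OF ln_powr_over_powr_tendsto[OF s, of "3 * bm"], of "3 * balance_const K"]
      tendsto_mult_right_zero[OF ln_powr_over_powr_tendsto[of 1 "3 * bm + 3"], of r]]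
  have "(\<lambda>n::nat. 3 * balance_const K * (ln (real n) powr (3 * bm) * real n powr (- s)) +
      r * (ln (real n) powr (3 * bm + 3) * real n powr (- 1))) \<longlonglongrightarrow> 0" by simp
  then have "\<forall>\<^sub>F n::nat in sequentially. 3 * balance_const K * (ln (real n) powr (3 * bm) * real n powr (- s)) +
      r * (ln (real n) powr (3 * bm + 3) * real n powr (- 1)) < c"
    by (rule order_tendstoD) (rule c)
  then show ?thesis using eventually_ge_at_top[of 3]
  proof eventually_elim
    case (elim n)
    define L where "L = ln (real n)"
    have L: "0 < L" using elim(2) by (simp add: L_def)
    have n: "0 < real n" using elim(2) by simp
    have L3: "L ^ 3 = L powr 3" using L by simp
    have 1: "(A_plus K * L ^ 3) powr (- bm) = A_plus K powr (- bm) * L powr (- (3 * bm))"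
      unfolding L3 using L assms by (simp add: powr_mult powr_powr del: powr_numeral)
    have 2: "L powr (3 * bm + 3) * real n powr (- 1) = L powr (3 * bm) * (L ^ 3 / n)"
      unfolding L3 using L n by (simp add: powr_add powr_minus_divide del: powr_numeral)
    have "L powr (3 * bm) * (3 * (balance_const K * real n powr (- s)) + r * (L ^ 3 / n)) < c"
      using elim(1) unfolding L_def[symmetric] 2 by (simp add: algebra_simps)
    also have "c = L powr (3 * bm) * (Cm * (A_plus K * L ^ 3) powr (- bm) / 2)"
      unfolding 1 c_def using L by (simp add: powr_minus field_simps)
    finally have "3 * (balance_const K * real n powr (- s)) + r * (L ^ 3 / n) < Cm * (A_plus K * L ^ 3) powr (- bm) / 2"
      using L by simp
    then show ?case by (simp add: bias_regime_def L_def s_def r_def)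
  qed
qed

text \<open>For \<open>D \<ge> a L^3\<close> the sum \<open>D + L^3\<close> is at most
  \<open>(1 + 1 / a) D\<close>, so the additive errors become errors relative to the mean
  \<open>E\<close>.\<close>

lemma large_model_bounds:
  fixes D N L a V E p r s b :: real
  assumes L: "1 \<le> L" and N: "0 < N" and a: "0 < a" and D: "a * L ^ 3 \<le> D" and s: "0 < s" and r: "0 \<le> r"
    and V: "s * D \<le> V" "V \<le> b * D"
    and E: "\<bar>E - V / N\<bar> \<le> r / sqrt L * ((D + L ^ 3) / N)"
    and w: "2 * r * (1 + 1 / a) / s \<le> sqrt L"
  shows "s / 2 * D / N \<le> E" "E \<le> (b + r * (1 + 1 / a)) * D / N"
    "\<bar>p - V / N\<bar> \<le> r / sqrt L * ((D + L ^ 3) / N) \<Longrightarrow> \<bar>p - E\<bar> \<le> 4 * r * (1 + 1 / a) / s / sqrt L * E"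
    "L ^ 3 / N \<le> 2 / (a * s) * E"
proof -
  define h where "h = 1 + 1 / a"
  define x where "x = D / N"
  define u where "u = r / sqrt L * ((D + L ^ 3) / N)"
  have sL: "1 \<le> sqrt L" using L by simp
  have L3: "L ^ 3 \<le> D / a" using D a by (simp add: pos_le_divide_eq mult.commute)
  have "0 < a * L ^ 3" using a L by simp
  then have D0: "0 < D" using D by linarith
  have x0: "0 \<le> x" using D0 N by (simp add: x_def)
  have h0: "0 \<le> h" using a by (simp add: h_def)
  have "D + L ^ 3 \<le> h * D" using L3 by (simp add: h_def distrib_right)
  then have "(D + L ^ 3) / N \<le> h * x" using N by (simp add: x_def divide_right_mono)
  then have u1: "u \<le> r / sqrt L * (h * x)" unfolding u_def using r L by (intro mult_left_mono) auto
  have "2 * (r * h) \<le> sqrt L * s" using w s by (simp add: h_def pos_divide_le_eq mult.assoc)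
  then have "2 * (r * h) / sqrt L \<le> s" using sL by (simp add: pos_divide_le_eq mult.commute)
  then have "2 * (r * h) / sqrt L * x \<le> s * x" using x0 by (intro mult_right_mono) auto
  also have "2 * (r * h) / sqrt L * x = 2 * (r / sqrt L * (h * x))" by simp
  finally have u2: "2 * u \<le> s * x" using u1 by linarith
  have Vx: "s * x \<le> V / N" "V / N \<le> b * x" using V N by (auto simp: x_def divide_right_mono)
  have E': "\<bar>E - V / N\<bar> \<le> u" using E by (simp add: u_def)
  have El: "s / 2 * x \<le> E" using E' Vx u2 by (simp add: abs_le_iff)
  then show "s / 2 * D / N \<le> E" by (simp add: x_def)
  have "r / sqrt L * (h * x) \<le> r * (h * x)"
  proof (rule mult_right_mono)
    show "r / sqrt L \<le> r" using r sL by (simp add: divide_le_eq mult_left_le mult_le_cancel_left1)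
  qed (use h0 x0 in simp)
  then have "E \<le> b * x + r * (h * x)" using E' Vx u1 by linarith
  then have "E \<le> (b + r * h) * x" by (simp only: distrib_right mult.assoc)
  then show "E \<le> (b + r * (1 + 1 / a)) * D / N" by (simp add: x_def h_def)
  have xE: "x \<le> 2 / s * E" using El s by (simp add: field_simps)
  show "\<bar>p - E\<bar> \<le> 4 * r * (1 + 1 / a) / s / sqrt L * E"
    if "\<bar>p - V / N\<bar> \<le> r / sqrt L * ((D + L ^ 3) / N)"
  proof -
    have "\<bar>p - E\<bar> \<le> 2 * u" using that E' by (simp add: u_def)
    also have "\<dots> \<le> 2 * (r / sqrt L * (h * x))" using u1 by simp
    also have "\<dots> = 2 * r * h / sqrt L * x" by simp
    also have "\<dots> \<le> 2 * r * h / sqrt L * (2 / s * E)"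
      using r h0 L by (intro mult_left_mono xE) auto
    also have "\<dots> = 4 * r * (1 + 1 / a) / s / sqrt L * E" by (simp add: h_def mult_ac)
    finally show ?thesis .
  qed
  have "L ^ 3 / N \<le> D / a / N" using L3 N by (intro divide_right_mono) auto
  also have "\<dots> = 1 / a * x" by (simp add: x_def)
  also have "\<dots> \<le> 1 / a * (2 / s * E)" using a by (intro mult_left_mono xE) auto
  finally show "L ^ 3 / N \<le> 2 / (a * s) * E" by simp
qed

lemma small_model_bound:
  fixes D N L a V p r b :: real
  assumes L: "1 \<le> L" and N: "0 < N" and D: "D \<le> a * L ^ 3" and r: "0 \<le> r" and b: "0 \<le> b"
    and V: "V \<le> b * D" and p: "\<bar>p - V / N\<bar> \<le> r / sqrt L * ((D + L ^ 3) / N)" and D0: "0 \<le> D"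
  shows "p \<le> (b + r) * (a + 1) * (L ^ 3 / N)"
proof -
  have H: "0 \<le> (D + L ^ 3) / N" using D0 L N by simp
  have "1 \<le> sqrt L" using L by simp
  then have "r / sqrt L \<le> r" using r by (simp add: divide_le_eq mult_le_cancel_left1)
  then have 1: "r / sqrt L * ((D + L ^ 3) / N) \<le> r * ((D + L ^ 3) / N)" using H by (intro mult_right_mono) auto
  have "V \<le> b * (D + L ^ 3)" using V b L by (simp add: distrib_left add_increasing2)
  then have "V / N \<le> b * ((D + L ^ 3) / N)" using N by (simp add: divide_right_mono)
  then have "p \<le> b * ((D + L ^ 3) / N) + r * ((D + L ^ 3) / N)" using p 1 by linarith
  also have "\<dots> = (b + r) * ((D + L ^ 3) / N)" by (simp only: distrib_right)
  also have "(b + r) * ((D + L ^ 3) / N) \<le> (b + r) * ((a + 1) * L ^ 3 / N)"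
    using D N r b by (intro mult_left_mono divide_right_mono) (auto simp: distrib_right)
  finally show ?thesis by simp
qed

text \<open>Weakens \<open>1 / L\<close> to \<open>1 / sqrt L\<close> and \<open>L^2\<close> to
  \<open>L^3 / sqrt L\<close>, so that the fluctuation has the same relative size as the other
  errors.\<close>

lemma fluctuation_bound:
  fixes L N k \<kappa> bias f :: real
  assumes L: "1 \<le> L" and N: "0 < N" and k: "0 \<le> k" "0 \<le> \<kappa>" "0 \<le> bias"
    and f: "\<bar>f\<bar> \<le> 9 * k * bias / L + \<kappa> * L\<^sup>2 / N"
  shows "\<bar>f\<bar> \<le> (9 * k + \<kappa>) / sqrt L * (bias + L ^ 3 / N)"
proof -
  have s: "1 \<le> sqrt L" "sqrt L * sqrt L = L" using L by auto
  have "sqrt L * 1 \<le> sqrt L * sqrt L" using s by (intro mult_left_mono) auto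
  then have sl: "sqrt L \<le> L" using s by simp
  have 1: "9 * k * bias / L \<le> 9 * k * bias / sqrt L"
    using k s sl by (intro divide_left_mono) auto
  have "L\<^sup>2 * sqrt L \<le> L\<^sup>2 * L" using sl by (intro mult_left_mono) auto
  then have "L\<^sup>2 \<le> L ^ 3 / sqrt L" using s by (simp add: pos_le_divide_eq power2_eq_square power3_eq_cube)
  then have "\<kappa> * L\<^sup>2 / N \<le> \<kappa> * (L ^ 3 / sqrt L) / N" using k N by (intro divide_right_mono mult_left_mono) auto
  also have "\<dots> = \<kappa> / sqrt L * (L ^ 3 / N)" by simp
  finally have "\<bar>f\<bar> \<le> 9 * k / sqrt L * bias + \<kappa> / sqrt L * (L ^ 3 / N)" using f 1 by simp
  also have "\<dots> \<le> (9 * k + \<kappa>) / sqrt L * bias + (9 * k + \<kappa>) / sqrt L * (L ^ 3 / N)"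
    using k s N L by (intro add_mono mult_right_mono divide_right_mono) auto
  finally show ?thesis by (simp add: distrib_left)
qed

text \<open>A crude bound on the loss of any controlled model, for those \<open>n\<close> beyond
  \<open>n0\<close> at which \<open>penalty_regime\<close> still fails.\<close>

definition loss_const :: "sapp_constants \<Rightarrow> real" where
  "loss_const K = 2 * (noise_const K)\<^sup>2 + 2 * risk_const K"

lemma (in prob_space) prob_Int_ge:
  assumes "A \<in> events" "B \<in> events"
  shows "prob A + prob B - 1 \<le> prob (A \<inter> B)"
proof -
  have "prob (A - B) \<le> prob (space M - B)"
    using assms sets.sets_into_space[OF assms(1)] by (intro finite_measure_mono) auto
  then show ?thesis
    using assms finite_measure_Diff'[OF assms] prob_compl[OF assms(2)] by simp
qed

lemma emp_mean_diff: "emp_mean n X Y \<omega> (\<lambda>z. f z - g z) = emp_mean n X Y \<omega> f - emp_mean n X Y \<omega> g"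
  by (simp add: emp_mean_def sum_subtractf diff_divide_distrib)

lemma with_prob_ge_mono:
  "with_prob_ge \<Omega> p Q \<Longrightarrow> (\<And>\<omega>. Q \<omega> \<Longrightarrow> R \<omega>) \<Longrightarrow> with_prob_ge \<Omega> p R"
  unfolding with_prob_ge_def by blast

section \<open>Simultaneous control of all models and the selected model\<close>

context SAPP
begin

abbreviation L :: real where "L \<equiv> ln (real n)"

abbreviation bias :: "(real \<Rightarrow> real) set \<Rightarrow> real" where "bias M \<equiv> excess_loss P s_star (sM M)"

abbreviation gap :: "'w \<Rightarrow> (real \<Rightarrow> real) set \<Rightarrow> real" where
  "gap \<omega> M \<equiv> excess_loss P s_star (sn \<omega> M) - bias M"

abbreviation egap :: "'w \<Rightarrow> (real \<Rightarrow> real) set \<Rightarrow> real" where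
  "egap \<omega> M \<equiv> emp_mean n X Y \<omega> (\<lambda>z. contrast (sM M) z - contrast (sn \<omega> M) z)"

abbreviation mgap :: "(real \<Rightarrow> real) set \<Rightarrow> real" where "mgap M \<equiv> mean_emp_excess \<Omega> n X Y sM sn M"

abbreviation fluct :: "'w \<Rightarrow> (real \<Rightarrow> real) set \<Rightarrow> real" where
  "fluct \<omega> M \<equiv> emp_mean n X Y \<omega> (\<lambda>z. contrast (sM M) z - contrast s_star z) - bias M"

abbreviation penalty_bounds :: "real \<Rightarrow> real \<Rightarrow> ((real \<Rightarrow> real) set \<Rightarrow> real) \<Rightarrow> bool" where
  "penalty_bounds \<delta> Ar pen \<equiv> \<forall>M\<in>\<M>.
     (model_dim M \<ge> A_plus K * L ^ 3 \<longrightarrow> \<bar>pen M - 2 * mgap M\<bar> \<le> \<delta> * (bias M + mgap M)) \<and>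
     (model_dim M \<le> A_plus K * L ^ 3 \<longrightarrow> \<bar>pen M\<bar> \<le> Ar * (bias M / L\<^sup>2 + L ^ 3 / real n))"

definition controlled :: "'w \<Rightarrow> (real \<Rightarrow> real) set \<Rightarrow> bool" where
  "controlled \<omega> M \<longleftrightarrow> 0 \<le> bias M \<and> bias M \<le> (noise_const K)\<^sup>2 \<and>
    (\<exists>V. (sigma_min K)\<^sup>2 * model_dim M \<le> V \<and> V \<le> (noise_const K)\<^sup>2 * model_dim M \<and>
      \<bar>mgap M - V / n\<bar> \<le> risk_const K / sqrt L * ((model_dim M + L ^ 3) / real n) \<and>
      0 \<le> gap \<omega> M \<and> \<bar>gap \<omega> M - V / n\<bar> \<le> risk_const K / sqrt L * ((model_dim M + L ^ 3) / real n) \<and>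
      0 \<le> egap \<omega> M \<and> \<bar>egap \<omega> M - V / n\<bar> \<le> risk_const K / sqrt L * ((model_dim M + L ^ 3) / real n) \<and>
      \<bar>fluct \<omega> M\<bar> \<le> 9 * (noise_const K)\<^sup>2 * bias M / L + conc_exp K * L\<^sup>2 / n)"

lemma dim_ge_1: "M \<in> \<M> \<Longrightarrow> 1 \<le> model_dim M"
  using P2 by blast

lemma dim_le_n: "M \<in> \<M> \<Longrightarrow> model_dim M \<le> real n"
  using P2 by fastforce

text \<open>Union bound over at most \<open>c n^alpha\<close> models, each failing with probability
  \<open>10 n^2 n^(-4 - alpha)\<close>.\<close>

lemma controlled_event:
  assumes ls: "large_sample K n"
  shows "with_prob_ge \<Omega> (1 - 10 * c_card K / (real n)\<^sup>2) (\<lambda>\<omega>. \<omega> \<in> space \<Omega> \<and> (\<forall>M\<in>\<M>. controlled \<omega> M))"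
proof -
  define q where "q = 10 * real n ^ 2 * exp (- (conc_exp K * L))"
  have n: "0 < real n" using ls by (simp add: large_sample_def Let_def)
  have "\<exists>G\<in>events. 1 - q \<le> prob G \<and> G \<subseteq> space \<Omega> \<and> (\<forall>\<omega>\<in>G. controlled \<omega> M)" if "M \<in> \<M>" for M
    using model_concentration[OF ls that] unfolding controlled_def q_def by meson
  then obtain G where G: "\<And>M. M \<in> \<M> \<Longrightarrow> G M \<in> events" "\<And>M. M \<in> \<M> \<Longrightarrow> 1 - q \<le> prob (G M)"
      "\<And>M. M \<in> \<M> \<Longrightarrow> G M \<subseteq> space \<Omega>" "\<And>M \<omega>. M \<in> \<M> \<Longrightarrow> \<omega> \<in> G M \<Longrightarrow> controlled \<omega> M"
    by metis
  define F where "F = (\<Union>M\<in>\<M>. space \<Omega> - G M)"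
  have F: "F \<in> events" unfolding F_def using finite_models G(1) by (intro sets.finite_UN) auto
  have "prob F \<le> card \<M> * q"
    unfolding F_def
  proof (rule prob_UN_le[OF finite_models])
    show "prob (space \<Omega> - G M) \<le> q" if "M \<in> \<M>" for M
      using G(1,2)[OF that] prob_compl[of "G M"] by simp
  qed (use G(1) in auto)
  also have "\<dots> \<le> (c_card K * real n powr alpha_card K) * q"
    using P1 by (intro mult_right_mono) (auto simp: q_def)
  also have "q = 10 * real n ^ 2 * (real n powr (- 4) * real n powr (- alpha_card K))"
    using n by (simp add: q_def conc_exp_def powr_def exp_add[symmetric] algebra_simps)
  also have "(c_card K * real n powr alpha_card K) * (10 * real n ^ 2 * (real n powr (- 4) * real n powr (- alpha_card K)))
      = 10 * c_card K * (real n ^ 2 * real n powr (- 4)) * (real n powr alpha_card K * real n powr (- alpha_card K))"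
    by (simp add: mult_ac)
  also have "real n powr alpha_card K * real n powr (- alpha_card K) = 1"
    using n by (simp add: powr_add[symmetric])
  also have "real n ^ 2 * real n powr (- 4) = 1 / (real n)\<^sup>2"
    using n by (simp add: powr_minus_divide power4_eq_xxxx power2_eq_square)
  finally have "prob F \<le> 10 * c_card K / (real n)\<^sup>2" by simp
  then have "1 - 10 * c_card K / (real n)\<^sup>2 \<le> prob (space \<Omega> - F)"
    using prob_compl[OF F] by simp
  moreover have "\<omega> \<in> space \<Omega> \<and> (\<forall>M\<in>\<M>. controlled \<omega> M)" if "\<omega> \<in> space \<Omega> - F" for \<omega>
    using that G(4) by (auto simp: F_def)
  ultimately show ?thesis
    unfolding with_prob_ge_def using F by (intro bexI[of _ "space \<Omega> - F"]) auto
qed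

text \<open>The absolute value makes the constant positive for every real \<open>c_card K\<close>,
  as the final statement asserts positivity before assuming anything on \<open>K\<close> beyond the
  range of \<open>\<eta>\<close>.\<close>

lemma controlled_penalized_event:
  assumes "large_sample K n" "with_prob_ge \<Omega> (1 - Ap / (real n)\<^sup>2) (\<lambda>\<omega>. penalty_bounds \<delta> Ar (pen \<omega>))"
  shows "with_prob_ge \<Omega> (1 - (Ap + 10 * \<bar>c_card K\<bar>) / (real n)\<^sup>2)
    (\<lambda>\<omega>. \<omega> \<in> space \<Omega> \<and> (\<forall>M\<in>\<M>. controlled \<omega> M) \<and> penalty_bounds \<delta> Ar (pen \<omega>))"
proof -
  obtain E1 where E1: "E1 \<in> events" "1 - 10 * c_card K / (real n)\<^sup>2 \<le> prob E1"
    "\<forall>\<omega>\<in>E1. \<omega> \<in> space \<Omega> \<and> (\<forall>M\<in>\<M>. controlled \<omega> M)"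
    using controlled_event[OF assms(1)] unfolding with_prob_ge_def by blast
  obtain E0 where E0: "E0 \<in> events" "1 - Ap / (real n)\<^sup>2 \<le> prob E0" "\<forall>\<omega>\<in>E0. penalty_bounds \<delta> Ar (pen \<omega>)"
    using assms(2) unfolding with_prob_ge_def by blast
  have "1 - (Ap + 10 * \<bar>c_card K\<bar>) / (real n)\<^sup>2 \<le> prob E0 + prob E1 - 1"
    using E0(2) E1(2) constants_pos by (simp add: add_divide_distrib)
  also have "\<dots> \<le> prob (E0 \<inter> E1)" by (rule prob_Int_ge[OF E0(1) E1(1)])
  finally show ?thesis
    unfolding with_prob_ge_def using E0(1,3) E1(1,3) by (intro bexI[of _ "E0 \<inter> E1"]) blast+
qed

lemma consts_nonneg: "0 \<le> conc_exp K" "0 \<le> basis_const1 K" "0 \<le> diag_const K" "0 \<le> offdiag_const K" "0 \<le> risk_const K"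
proof -
  show 1: "0 \<le> conc_exp K" using constants_pos by (simp add: conc_exp_def)
  show 2: "0 \<le> basis_const1 K" using constants_pos inverse_const_pos[of "r_max K"] by (simp add: basis_const1_def)
  show 3: "0 \<le> diag_const K" "0 \<le> offdiag_const K" using 1 2 by (auto simp: diag_const_def offdiag_const_def)
  show "0 \<le> risk_const K" using 1 2 3 constants_pos
    by (auto simp: risk_const_def intro!: add_nonneg_nonneg mult_nonneg_nonneg)
qed

lemma derived_consts_nonneg: "0 \<le> var_const K" "0 \<le> err_const K"
    "4 * risk_const K * (1 + 1 / A_plus K) / (sigma_min K)\<^sup>2 \<le> err_const K"
    "(9 * (noise_const K)\<^sup>2 + conc_exp K) * (1 + 2 / (A_plus K * (sigma_min K)\<^sup>2)) \<le> err_const K"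
    "9 * (noise_const K)\<^sup>2 + conc_exp K \<le> err_const K"
proof -
  note c = consts_nonneg constants_pos
  have 1: "0 \<le> 4 * risk_const K * (1 + 1 / A_plus K) / (sigma_min K)\<^sup>2" using c by simp
  have k: "0 \<le> 9 * (noise_const K)\<^sup>2 + conc_exp K" using c by simp
  have 2: "9 * (noise_const K)\<^sup>2 + conc_exp K \<le> (9 * (noise_const K)\<^sup>2 + conc_exp K) * (1 + 2 / (A_plus K * (sigma_min K)\<^sup>2))"
    using c mult_left_mono[OF _ k, of 1 "1 + 2 / (A_plus K * (sigma_min K)\<^sup>2)"] by simp
  show "0 \<le> var_const K" using c by (auto simp: var_const_def intro!: add_nonneg_nonneg mult_nonneg_nonneg)
  show "0 \<le> err_const K" "4 * risk_const K * (1 + 1 / A_plus K) / (sigma_min K)\<^sup>2 \<le> err_const K"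
    "(9 * (noise_const K)\<^sup>2 + conc_exp K) * (1 + 2 / (A_plus K * (sigma_min K)\<^sup>2)) \<le> err_const K"
    "9 * (noise_const K)\<^sup>2 + conc_exp K \<le> err_const K"
    using 1 2 k unfolding err_const_def by linarith+
qed

lemma controlled_large:
  assumes reg: "selection_regime K \<eta> \<delta> n" and M: "M \<in> \<M>" and g: "controlled \<omega> M"
    and D: "A_plus K * L ^ 3 \<le> model_dim M"
  shows "(sigma_min K)\<^sup>2 / 2 * model_dim M / n \<le> mgap M" "mgap M \<le> var_const K * model_dim M / n"
    "\<bar>gap \<omega> M - mgap M\<bar> \<le> err_const K / sqrt L * mgap M" "\<bar>egap \<omega> M - mgap M\<bar> \<le> err_const K / sqrt L * mgap M"
    "\<bar>fluct \<omega> M\<bar> \<le> err_const K / sqrt L * (bias M + mgap M)" "0 \<le> mgap M"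
proof -
  have ls: "1 \<le> L" "0 < real n" using reg by (auto simp: selection_regime_def large_sample_def Let_def)
  have w: "2 * risk_const K * (1 + 1 / A_plus K) / (sigma_min K)\<^sup>2 \<le> sqrt L" using reg by (simp add: selection_regime_def)
  obtain V where V: "(sigma_min K)\<^sup>2 * model_dim M \<le> V" "V \<le> (noise_const K)\<^sup>2 * model_dim M"
      "\<bar>mgap M - V / n\<bar> \<le> risk_const K / sqrt L * ((model_dim M + L ^ 3) / real n)"
    and G: "\<bar>gap \<omega> M - V / n\<bar> \<le> risk_const K / sqrt L * ((model_dim M + L ^ 3) / real n)"
      "\<bar>egap \<omega> M - V / n\<bar> \<le> risk_const K / sqrt L * ((model_dim M + L ^ 3) / real n)"
      "\<bar>fluct \<omega> M\<bar> \<le> 9 * (noise_const K)\<^sup>2 * bias M / L + conc_exp K * L\<^sup>2 / n"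
    and b: "0 \<le> bias M"
    using g unfolding controlled_def by blast
  have sp: "0 < (sigma_min K)\<^sup>2" "0 < A_plus K" using constants_pos by auto
  note B = large_model_bounds[OF ls(1,2) sp(2) D sp(1) consts_nonneg(5) V w]
  show lo: "(sigma_min K)\<^sup>2 / 2 * model_dim M / n \<le> mgap M" by (rule B(1))
  have "0 \<le> (sigma_min K)\<^sup>2 / 2 * model_dim M / n" using dim_ge_1[OF M] by simp
  then show m0: "0 \<le> mgap M" using lo by linarith
  have dn: "0 \<le> model_dim M / n" using dim_ge_1[OF M] by simp
  have "((noise_const K)\<^sup>2 + risk_const K * (1 + 1 / A_plus K)) \<le> var_const K"
    unfolding var_const_def using consts_nonneg sp by simp
  from mult_right_mono[OF this dn] show "mgap M \<le> var_const K * model_dim M / n" using B(2) by simp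
  have "4 * risk_const K * (1 + 1 / A_plus K) / (sigma_min K)\<^sup>2 / sqrt L * mgap M \<le> err_const K / sqrt L * mgap M"
    using derived_consts_nonneg(3) ls m0 by (intro mult_right_mono divide_right_mono) auto
  then show "\<bar>gap \<omega> M - mgap M\<bar> \<le> err_const K / sqrt L * mgap M" "\<bar>egap \<omega> M - mgap M\<bar> \<le> err_const K / sqrt L * mgap M"
    using B(3)[OF G(1)] B(3)[OF G(2)] by linarith+
  let ?k = "9 * (noise_const K)\<^sup>2 + conc_exp K" and ?h = "2 / (A_plus K * (sigma_min K)\<^sup>2)"
  have h: "0 \<le> ?h" using sp by simp
  have "\<bar>fluct \<omega> M\<bar> \<le> ?k / sqrt L * (bias M + L ^ 3 / n)"
    by (rule fluctuation_bound[OF ls _ consts_nonneg(1) b G(3)]) simp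
  also have "\<dots> \<le> ?k / sqrt L * ((1 + ?h) * (bias M + mgap M))"
  proof (rule mult_left_mono)
    have "0 \<le> ?h * bias M" using h b by simp
    then show "bias M + L ^ 3 / n \<le> (1 + ?h) * (bias M + mgap M)"
      using B(4) m0 unfolding distrib_right distrib_left mult_1_left by linarith
  qed (use consts_nonneg ls in simp)
  also have "\<dots> = ?k * (1 + ?h) / sqrt L * (bias M + mgap M)" by simp
  also have "\<dots> \<le> err_const K / sqrt L * (bias M + mgap M)"
    using derived_consts_nonneg(4) ls b m0 by (intro mult_right_mono divide_right_mono) auto
  finally show "\<bar>fluct \<omega> M\<bar> \<le> err_const K / sqrt L * (bias M + mgap M)" .
qed

lemma controlled_small:
  assumes ls: "large_sample K n" and M: "M \<in> \<M>" and g: "controlled \<omega> M"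
    and D: "model_dim M \<le> A_plus K * L ^ 3"
  shows "gap \<omega> M \<le> var_const K * (L ^ 3 / n)" "egap \<omega> M \<le> var_const K * (L ^ 3 / n)"
    "\<bar>fluct \<omega> M\<bar> \<le> err_const K / sqrt L * (bias M + L ^ 3 / n)"
proof -
  have ls: "1 \<le> L" "0 < real n" using ls by (auto simp: large_sample_def Let_def)
  obtain V where V: "V \<le> (noise_const K)\<^sup>2 * model_dim M"
    and G: "\<bar>gap \<omega> M - V / n\<bar> \<le> risk_const K / sqrt L * ((model_dim M + L ^ 3) / real n)"
      "\<bar>egap \<omega> M - V / n\<bar> \<le> risk_const K / sqrt L * ((model_dim M + L ^ 3) / real n)"
      "\<bar>fluct \<omega> M\<bar> \<le> 9 * (noise_const K)\<^sup>2 * bias M / L + conc_exp K * L\<^sup>2 / n"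
    and b: "0 \<le> bias M"
    using g unfolding controlled_def by blast
  have D0: "0 \<le> model_dim M" using dim_ge_1[OF M] by simp
  have r: "0 \<le> L ^ 3 / n" using ls by simp
  have "((noise_const K)\<^sup>2 + risk_const K) * (A_plus K + 1) \<le> var_const K"
    unfolding var_const_def using consts_nonneg constants_pos by simp
  from mult_right_mono[OF this r]
  show "gap \<omega> M \<le> var_const K * (L ^ 3 / n)" "egap \<omega> M \<le> var_const K * (L ^ 3 / n)"
    using small_model_bound[OF ls D consts_nonneg(5) zero_le_power2 V G(1) D0]
      small_model_bound[OF ls D consts_nonneg(5) zero_le_power2 V G(2) D0] by linarith+
  have "\<bar>fluct \<omega> M\<bar> \<le> (9 * (noise_const K)\<^sup>2 + conc_exp K) / sqrt L * (bias M + L ^ 3 / n)"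
    by (rule fluctuation_bound[OF ls _ consts_nonneg(1) b G(3)]) simp
  also have "\<dots> \<le> err_const K / sqrt L * (bias M + L ^ 3 / n)"
    using derived_consts_nonneg(5) ls b r by (intro mult_right_mono divide_right_mono) auto
  finally show "\<bar>fluct \<omega> M\<bar> \<le> err_const K / sqrt L * (bias M + L ^ 3 / n)" .
qed

lemma controlled_loss_le:
  assumes reg: "selection_regime K \<eta> \<delta> n" and M: "M \<in> \<M>" and g: "controlled \<omega> M"
  shows "excess_loss P s_star (sn \<omega> M) \<le> loss_const K"
proof -
  have ls: "1 \<le> L" "0 < real n" "L ^ 3 \<le> real n"
    using reg by (auto simp: selection_regime_def large_sample_def Let_def)
  obtain V where V: "V \<le> (noise_const K)\<^sup>2 * model_dim M"
    and G: "\<bar>gap \<omega> M - V / n\<bar> \<le> risk_const K / sqrt L * ((model_dim M + L ^ 3) / real n)"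
    and b: "bias M \<le> (noise_const K)\<^sup>2"
    using g unfolding controlled_def by blast
  have "V \<le> (noise_const K)\<^sup>2 * n" using V mult_left_mono[OF dim_le_n[OF M], of "(noise_const K)\<^sup>2"] by simp
  then have Vn: "V / n \<le> (noise_const K)\<^sup>2" using ls by (simp add: divide_le_eq)
  have "(model_dim M + L ^ 3) / real n \<le> 2" using dim_le_n[OF M] ls by (simp add: divide_le_eq)
  moreover have "risk_const K / sqrt L \<le> risk_const K"
    using consts_nonneg(5) ls by (simp add: divide_le_eq mult_le_cancel_left1)
  ultimately have "risk_const K / sqrt L * ((model_dim M + L ^ 3) / real n) \<le> risk_const K * 2"
    using consts_nonneg(5) ls dim_ge_1[OF M] by (intro mult_mono) auto
  then show ?thesis using G Vn b by (simp add: loss_const_def)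
qed

text \<open>At dimension of order \<open>n^(1 / (1 + \<beta>))\<close> the bias
  \<open>D^(-\<beta>)\<close> and the variance \<open>D / n\<close> have the same order
  \<open>n^(- \<beta> / (1 + \<beta>))\<close>. The model comes from richness and counts as large by
  the regime.\<close>

lemma balanced_model:
  assumes reg: "selection_regime K \<eta> \<delta> n" and g: "\<And>M. M \<in> \<M> \<Longrightarrow> controlled \<omega> M"
  obtains M0 where "M0 \<in> \<M>" "A_plus K * L ^ 3 \<le> model_dim M0"
    "bias M0 + mgap M0 \<le> balance_const K * real n powr (- (beta_plus K / (1 + beta_plus K)))"
proof -
  let ?b = "beta_plus K" and ?s = "beta_plus K / (1 + beta_plus K)"
  have n: "0 < real n" and r: "A_plus K * L ^ 3 \<le> real n powr (1 / (1 + ?b))"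
    using reg by (auto simp: selection_regime_def large_sample_def Let_def)
  have bp: "0 < ?b" using constants_pos by simp
  obtain M0 where M0: "M0 \<in> \<M>" "real n powr (1 / (1 + ?b)) \<le> model_dim M0"
      "model_dim M0 \<le> c_rich K * real n powr (1 / (1 + ?b))"
    using P3 by blast
  have D: "A_plus K * L ^ 3 \<le> model_dim M0" using r M0 by linarith
  have "model_dim M0 powr (- ?b) \<le> (real n powr (1 / (1 + ?b))) powr (- ?b)"
    using bp n M0 by (intro powr_mono2') auto
  also have "\<dots> = real n powr (- ?s)" by (simp add: powr_powr)
  finally have "C_plus K * model_dim M0 powr (- ?b) \<le> C_plus K * real n powr (- ?s)"
    using constants_pos by (intro mult_left_mono) auto
  then have 1: "bias M0 \<le> C_plus K * real n powr (- ?s)" using Apu[OF M0(1)] by linarith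
  have "real n powr (1 / (1 + ?b)) / n = real n powr (1 / (1 + ?b)) * real n powr (- 1)"
    using n by (simp add: powr_minus_divide)
  also have "\<dots> = real n powr (- ?s)"
  proof -
    have "1 / (1 + ?b) + - 1 = - ?s" using bp by (simp add: field_simps)
    then show ?thesis unfolding powr_add[symmetric] by simp
  qed
  finally have p: "real n powr (1 / (1 + ?b)) / n = real n powr (- ?s)" .
  have "mgap M0 \<le> var_const K * model_dim M0 / n" by (rule controlled_large(2)[OF reg M0(1) g[OF M0(1)] D])
  also have "\<dots> \<le> var_const K * (c_rich K * real n powr (1 / (1 + ?b))) / n"
    using M0(3) n derived_consts_nonneg(1) by (intro divide_right_mono mult_left_mono) auto
  also have "\<dots> = var_const K * c_rich K * (real n powr (1 / (1 + ?b)) / n)" by simp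
  finally have 2: "mgap M0 \<le> var_const K * c_rich K * real n powr (- ?s)" unfolding p .
  from 1 2 have "bias M0 + mgap M0 \<le> balance_const K * real n powr (- ?s)"
    by (simp add: balance_const_def distrib_right)
  with M0 D show thesis by (intro that) auto
qed

text \<open>The conclusions are graded by what they require: the first three hold in
  \<open>selection_regime\<close> alone, the oracle inequality with remainder needs
  \<open>penalty_regime\<close>, and the removal of the remainder needs \<open>bias_regime\<close>
  too.\<close>

lemma selected_model:
  assumes \<eta>: "0 < \<eta>" and \<delta>: "0 \<le> \<delta>" "\<delta> < 1" and Ar: "0 < Ar"
    and reg: "selection_regime K \<eta> \<delta> n" and controlled: "\<forall>M\<in>\<M>. controlled \<omega> M"
    and pen: "penalty_bounds \<delta> Ar pen"
    and Mh: "is_arg_min (\<lambda>M. emp_mean n X Y \<omega> (contrast (sn \<omega> M)) + pen M) (\<lambda>M. M \<in> \<M>) Mh"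
    and Ms: "is_arg_min (\<lambda>M. excess_loss P s_star (sn \<omega> M)) (\<lambda>M. M \<in> \<M>) Ms"
  defines "\<theta> \<equiv> (8 * err_const K + Ar) / L powr (1 / 4)"
  defines "factor \<equiv> (1 + \<delta>) / (1 - \<delta>) + 5 * \<theta> / (1 - \<delta>)\<^sup>2"
  shows "model_dim Mh \<le> real n powr (\<eta> + 1 / (1 + beta_plus K))"
    and "excess_loss P s_star (sn \<omega> Mh) \<le> loss_const K"
    and "0 \<le> factor * excess_loss P s_star (sn \<omega> Ms)"
    and "penalty_regime K Ar \<delta> n \<Longrightarrow> excess_loss P s_star (sn \<omega> Mh) \<le>
          factor * excess_loss P s_star (sn \<omega> Ms) + 4 / (1 - \<delta>) * ((1 + 2 * var_const K + Ar) * (L ^ 3 / n))"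
    and "penalty_regime K Ar \<delta> n \<Longrightarrow> bias_regime K Cm bm Ar n \<Longrightarrow> 0 < Cm \<Longrightarrow> 0 \<le> bm \<Longrightarrow>
          \<forall>M\<in>\<M>. Cm * model_dim M powr (- bm) \<le> bias M \<Longrightarrow>
          A_plus K * L ^ 3 \<le> model_dim Mh \<and>
          excess_loss P s_star (sn \<omega> Mh) \<le> factor * excess_loss P s_star (sn \<omega> Ms)"
proof -
  note g = bspec[OF controlled]
  have ls: "large_sample K n" and L1: "1 \<le> L" and n: "1 \<le> real n"
    using reg by (auto simp: selection_regime_def large_sample_def Let_def)
  let ?e = "err_const K / sqrt L"
  interpret sel: penalized_selection \<M> model_dim bias "gap \<omega>" "egap \<omega>" mgap "fluct \<omega>" pen
    "real n" L "A_plus K" ?e "(sigma_min K)\<^sup>2 / 2" "var_const K" \<delta> Ar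
  proof
    show "0 \<le> ?e" using derived_consts_nonneg(2) L1 by simp
    have "4 * err_const K / (1 - \<delta>) \<le> sqrt L" using reg by (simp add: selection_regime_def)
    then have "4 * err_const K \<le> sqrt L * (1 - \<delta>)" using \<delta> by (simp add: pos_divide_le_eq)
    then show "?e \<le> (1 - \<delta>) / 4" using L1 by (simp add: pos_divide_le_eq mult.commute)
    fix M assume M: "M \<in> \<M>"
    show "0 \<le> bias M" "0 \<le> gap \<omega> M" "0 \<le> egap \<omega> M" using g[OF M] unfolding controlled_def by auto
    show "(sigma_min K)\<^sup>2 / 2 * model_dim M / n \<le> mgap M \<and> mgap M \<le> var_const K * model_dim M / n \<and>
      \<bar>gap \<omega> M - mgap M\<bar> \<le> ?e * mgap M \<and> \<bar>egap \<omega> M - mgap M\<bar> \<le> ?e * mgap M \<and>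
      \<bar>fluct \<omega> M\<bar> \<le> ?e * (bias M + mgap M) \<and> 0 \<le> mgap M" if "A_plus K * L ^ 3 \<le> model_dim M"
      using controlled_large[OF reg M g[OF M] that] by blast
    show "gap \<omega> M \<le> var_const K * (L ^ 3 / n) \<and> egap \<omega> M \<le> var_const K * (L ^ 3 / n) \<and>
      \<bar>fluct \<omega> M\<bar> \<le> ?e * (bias M + L ^ 3 / n)" if "model_dim M \<le> A_plus K * L ^ 3"
      using controlled_small[OF ls M g[OF M] that] by blast
  qed (use L1 n \<delta> Ar constants_pos derived_consts_nonneg pen in auto)
  have Mh_in: "Mh \<in> \<M>" and Ms_in: "Ms \<in> \<M>" using Mh Ms by (auto simp: is_arg_min_def)
  have loss: "sel.loss M = excess_loss P s_star (sn \<omega> M)" for M by (simp add: sel.loss_def)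
  \<comment> \<open>The two criteria differ by the empirical risk of \<open>s_star\<close>, which is
    the same for all models and so does not affect the minimizer.\<close>
  have crit: "emp_mean n X Y \<omega> (contrast (sn \<omega> M)) + pen M = emp_mean n X Y \<omega> (contrast s_star) + sel.crit M" for M
    unfolding sel.crit_def by (simp add: emp_mean_diff)
  have crit_le: "sel.crit Mh \<le> sel.crit M" if "M \<in> \<M>" for M
    using Mh that unfolding is_arg_min_def crit by (auto simp: not_less)
  have loss_le: "sel.loss Ms \<le> sel.loss M" if "M \<in> \<M>" for M
    using Ms that unfolding is_arg_min_def loss by (auto simp: not_less)
  define s where "s = beta_plus K / (1 + beta_plus K)"
  define G where "G = balance_const K * real n powr (- s)"
  obtain M0 where M0: "M0 \<in> \<M>" "A_plus K * L ^ 3 \<le> model_dim M0" "bias M0 + mgap M0 \<le> G"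
    using balanced_model[OF reg g] unfolding G_def s_def by metis
  have \<theta>0: "0 \<le> \<theta>" using derived_consts_nonneg(2) Ar by (simp add: \<theta>_def)
  \<comment> \<open>The actual error is of order \<open>L^(-1/2)\<close> plus
    \<open>Ar / L^2\<close>; both are below the rate \<open>L^(-1/4)\<close> that the statement asks
    for.\<close>
  have err_\<theta>: "sel.err \<le> \<theta>"
  proof -
    have q: "L powr (1 / 4) \<le> sqrt L" "L powr (1 / 4) \<le> L\<^sup>2" "0 < L powr (1 / 4)"
      using L1 powr_mono[of "1 / 4" "1 / 2" L] powr_mono[of "1 / 4" 2 L] by (auto simp: powr_half_sqrt)
    have "err_const K / sqrt L \<le> err_const K / L powr (1 / 4)"
      using derived_consts_nonneg(2) q L1 by (intro divide_left_mono) auto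
    moreover have "Ar / L\<^sup>2 \<le> Ar / L powr (1 / 4)" using Ar q L1 by (intro divide_left_mono) auto
    ultimately show ?thesis unfolding sel.err_def \<theta>_def add_divide_distrib by simp
  qed
  have pr: "sel.err \<le> (1 - \<delta>) / 2" if "penalty_regime K Ar \<delta> n"
    using that by (simp add: penalty_regime_def sel.err_def)
  show "model_dim Mh \<le> real n powr (\<eta> + 1 / (1 + beta_plus K))"
  proof (rule sel.dim_selected_le[OF M0 Mh_in crit_le[OF M0(1)]])
    have "12 * balance_const K < ((1 - \<delta>) * (sigma_min K)\<^sup>2) * real n powr \<eta>"
      using reg by (simp add: selection_regime_def)
    then have "12 * balance_const K * real n powr (- s) < ((1 - \<delta>) * (sigma_min K)\<^sup>2) * real n powr \<eta> * real n powr (- s)"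
      using n by (intro mult_strict_right_mono) auto
    also have "real n powr (\<eta> + 1 / (1 + beta_plus K)) / n = real n powr \<eta> * real n powr (- s)"
    proof -
      have "real n powr (\<eta> + 1 / (1 + beta_plus K)) / n = real n powr (\<eta> + 1 / (1 + beta_plus K)) * real n powr (- 1)"
        using n by (simp add: powr_minus_divide)
      also have "\<dots> = real n powr (\<eta> + - s)"
      proof -
        have "\<eta> + 1 / (1 + beta_plus K) + - 1 = \<eta> + - s" using constants_pos by (simp add: s_def field_simps)
        then show ?thesis by (simp only: powr_add[symmetric])
      qed
      finally show ?thesis unfolding powr_add .
    qed
    then have "((1 - \<delta>) * (sigma_min K)\<^sup>2) * real n powr \<eta> * real n powr (- s)
       = ((1 - \<delta>) * (sigma_min K)\<^sup>2) * (real n powr (\<eta> + 1 / (1 + beta_plus K)) / n)" by simp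
    finally show "6 * G < (1 - \<delta>) * ((sigma_min K)\<^sup>2 / 2 * real n powr (\<eta> + 1 / (1 + beta_plus K)) / n)"
      by (simp add: G_def)
    have "A_plus K * L ^ 3 \<le> real n powr (1 / (1 + beta_plus K))" using reg by (simp add: selection_regime_def)
    also have "\<dots> \<le> real n powr (\<eta> + 1 / (1 + beta_plus K))" using n \<eta> by (intro powr_mono) auto
    finally show "A_plus K * L ^ 3 \<le> real n powr (\<eta> + 1 / (1 + beta_plus K))" .
  qed
  show "excess_loss P s_star (sn \<omega> Mh) \<le> loss_const K" by (rule controlled_loss_le[OF reg Mh_in g[OF Mh_in]])
  have "0 \<le> factor" unfolding factor_def using \<theta>0 \<delta> by (intro add_nonneg_nonneg) auto
  then show "0 \<le> factor * excess_loss P s_star (sn \<omega> Ms)" using sel.loss_nonneg[OF Ms_in] unfolding loss by simp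
  show "excess_loss P s_star (sn \<omega> Mh) \<le>
      factor * excess_loss P s_star (sn \<omega> Ms) + 4 / (1 - \<delta>) * ((1 + 2 * var_const K + Ar) * (L ^ 3 / n))"
    if "penalty_regime K Ar \<delta> n"
    using sel.oracle_inequality[OF Mh_in Ms_in crit_le[OF Ms_in] pr[OF that] err_\<theta>]
    unfolding loss sel.rem_def factor_def .
  show "A_plus K * L ^ 3 \<le> model_dim Mh \<and>
      excess_loss P s_star (sn \<omega> Mh) \<le> factor * excess_loss P s_star (sn \<omega> Ms)"
    if p: "penalty_regime K Ar \<delta> n" and br: "bias_regime K Cm bm Ar n" and Cm: "0 < Cm" and bm: "0 \<le> bm"
      and lower: "\<forall>M\<in>\<M>. Cm * model_dim M powr (- bm) \<le> bias M"
  proof -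
    define b where "b = Cm * (A_plus K * L ^ 3) powr (- bm)"
    have b: "b \<le> bias M" if "M \<in> \<M>" "model_dim M \<le> A_plus K * L ^ 3" for M
    proof -
      have "(A_plus K * L ^ 3) powr (- bm) \<le> model_dim M powr (- bm)"
        using bm that dim_ge_1[OF that(1)] by (intro powr_mono2') auto
      then have "b \<le> Cm * model_dim M powr (- bm)" unfolding b_def using Cm by simp
      then show ?thesis using bspec[OF lower that(1)] by linarith
    qed
    have bg: "3 * G < b / 2 - sel.rem"
      using br by (simp add: bias_regime_def G_def s_def b_def sel.rem_def)
    \<comment> \<open>Once selected and oracle models are both large, the remainder-free comparison
      applies to the pair.\<close>
    have 1: "A_plus K * L ^ 3 \<le> model_dim Mh"
      by (rule sel.dim_selected_ge[OF M0 Mh_in crit_le[OF M0(1)] pr[OF p] b bg])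
    have 2: "A_plus K * L ^ 3 \<le> model_dim Ms"
      by (rule sel.dim_oracle_ge[OF M0 Ms_in loss_le[OF M0(1)] b bg])
    show ?thesis
      using 1 sel.oracle_inequality_large[OF Mh_in Ms_in 1 2 crit_le[OF Ms_in] pr[OF p] err_\<theta>]
      unfolding loss factor_def by blast
  qed
qed

end


lemma some_threshold:
  assumes "\<forall>\<^sub>F n in sequentially. Q n"
  shows "(SOME N. \<forall>n\<ge>N. Q n) \<le> n \<Longrightarrow> Q n"
  using someI_ex[OF assms[unfolded eventually_sequentially]] by blast

text \<open>What a constant may depend on is expressed by functions quantified before all data.
  \<open>A5\<close> takes \<open>\<delta>\<close> as an argument because the factor
  \<open>4 / (1 - \<delta>)\<close> and the threshold of \<open>penalty_regime\<close> enter it;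
  \<open>n0'\<close> likewise takes \<open>Ar\<close>.\<close>

theorem theorem3:
  "\<exists>(A3 :: real \<Rightarrow> real \<Rightarrow> real)
     (A4 :: sapp_constants \<Rightarrow> real \<Rightarrow> real)
     (A5 :: sapp_constants \<Rightarrow> real \<Rightarrow> real \<Rightarrow> real)
     (n0 :: sapp_constants \<Rightarrow> real \<Rightarrow> real \<Rightarrow> nat)
     (n0' :: sapp_constants \<Rightarrow> real \<Rightarrow> real \<Rightarrow> real \<Rightarrow> real \<Rightarrow> real \<Rightarrow> nat).
   \<forall>(K :: sapp_constants) \<eta> \<delta> Ap Ar.
     0 < \<eta> \<and> \<eta> < beta_plus K / (1 + beta_plus K) \<and> 0 \<le> \<delta> \<and> \<delta> < 1 \<and> 0 < Ap \<and> 0 < Ar \<longrightarrow>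
     0 < A3 (c_card K) Ap \<and> 0 < A4 K Ar \<and> 0 < A5 K Ar \<delta> \<and>
     (\<exists>\<theta> :: nat \<Rightarrow> real.
       (\<forall>n\<ge>2. \<theta> n \<le> A4 K Ar / ln (real n) powr (1 / 4)) \<and>
       (\<forall>(\<Omega> :: 'w measure) n X Y \<epsilon> P s_star \<sigma> \<M> part sM sn
          (pen :: 'w \<Rightarrow> (real \<Rightarrow> real) set \<Rightarrow> real) Mhat Mstar.
          SAPP \<Omega> n X Y \<epsilon> P s_star \<sigma> \<M> part sM sn K \<and>
          (\<forall>\<omega>\<in>space \<Omega>.
             is_arg_min (\<lambda>M. emp_mean n X Y \<omega> (contrast (sn \<omega> M)) + pen \<omega> M)
               (\<lambda>M. M \<in> \<M>) (Mhat \<omega>) \<and>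
             is_arg_min (\<lambda>M. excess_loss P s_star (sn \<omega> M)) (\<lambda>M. M \<in> \<M>) (Mstar \<omega>)) \<and>
          with_prob_ge \<Omega> (1 - Ap / (real n)\<^sup>2) (\<lambda>\<omega>. \<forall>M\<in>\<M>.
             (model_dim M \<ge> A_plus K * ln (real n) ^ 3 \<longrightarrow>
                \<bar>pen \<omega> M - 2 * mean_emp_excess \<Omega> n X Y sM sn M\<bar>
                  \<le> \<delta> * (excess_loss P s_star (sM M) + mean_emp_excess \<Omega> n X Y sM sn M)) \<and>
             (model_dim M \<le> A_plus K * ln (real n) ^ 3 \<longrightarrow>
                \<bar>pen \<omega> M\<bar>
                  \<le> Ar * (excess_loss P s_star (sM M) / (ln (real n))\<^sup>2 + ln (real n) ^ 3 / real n)))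
          \<longrightarrow>
          (n \<ge> n0 K \<eta> \<delta> \<longrightarrow>
             with_prob_ge \<Omega> (1 - A3 (c_card K) Ap / (real n)\<^sup>2) (\<lambda>\<omega>.
               model_dim (Mhat \<omega>) \<le> real n powr (\<eta> + 1 / (1 + beta_plus K)) \<and>
               excess_loss P s_star (sn \<omega> (Mhat \<omega>))
                 \<le> ((1 + \<delta>) / (1 - \<delta>) + 5 * \<theta> n / (1 - \<delta>)\<^sup>2)
                     * excess_loss P s_star (sn \<omega> (Mstar \<omega>))
                   + A5 K Ar \<delta> * ln (real n) ^ 3 / real n)) \<and>
          (\<forall>C_minus beta_minus.
             0 < C_minus \<and> beta_plus K \<le> beta_minus \<and>
             (\<forall>M\<in>\<M>. C_minus * model_dim M powr (- beta_minus) \<le> excess_loss P s_star (sM M) \<and>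
                excess_loss P s_star (sM M) \<le> C_plus K * model_dim M powr (- beta_plus K)) \<and>
             n \<ge> n0' K C_minus beta_minus \<eta> \<delta> Ar \<longrightarrow>
             with_prob_ge \<Omega> (1 - A3 (c_card K) Ap / (real n)\<^sup>2) (\<lambda>\<omega>.
               A_plus K * ln (real n) ^ 3 \<le> model_dim (Mhat \<omega>) \<and>
               model_dim (Mhat \<omega>) \<le> real n powr (\<eta> + 1 / (1 + beta_plus K)) \<and>
               excess_loss P s_star (sn \<omega> (Mhat \<omega>))
                 \<le> ((1 + \<delta>) / (1 - \<delta>) + 5 * \<theta> n / (1 - \<delta>)\<^sup>2)
                     * excess_loss P s_star (sn \<omega> (Mstar \<omega>))))))"
proof -
  define A3 :: "real \<Rightarrow> real \<Rightarrow> real" where "A3 = (\<lambda>c Ap. Ap + 10 * \<bar>c\<bar>)"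
  define A4 where "A4 = (\<lambda>K Ar. 8 * \<bar>err_const K\<bar> + Ar)"
  define n0 :: "sapp_constants \<Rightarrow> real \<Rightarrow> real \<Rightarrow> nat"
    where "n0 = (\<lambda>K \<eta> \<delta>. SOME N. \<forall>n\<ge>N. selection_regime K \<eta> \<delta> n)"
  define n1 :: "sapp_constants \<Rightarrow> real \<Rightarrow> real \<Rightarrow> nat"
    where "n1 = (\<lambda>K Ar \<delta>. SOME N. \<forall>n\<ge>N. penalty_regime K Ar \<delta> n)"
  define n2 :: "sapp_constants \<Rightarrow> real \<Rightarrow> real \<Rightarrow> real \<Rightarrow> nat"
    where "n2 = (\<lambda>K Cm bm Ar. SOME N. \<forall>n\<ge>N. bias_regime K Cm bm Ar n)"
  \<comment> \<open>The first summand is the remainder of the oracle inequality. The second exceeds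
    the crude loss bound when multiplied by \<open>L^3 / n\<close> for \<open>n\<close> below
    \<open>n1\<close>. Absolute values keep it positive for arbitrary \<open>K\<close>.\<close>
  define A5 where "A5 = (\<lambda>K Ar \<delta>. 4 / (1 - \<delta>) * (1 + 2 * \<bar>var_const K\<bar> + Ar) + \<bar>loss_const K\<bar> * real (n1 K Ar \<delta>))"
  define n0' where "n0' = (\<lambda>K Cm bm \<eta> \<delta> Ar. max (n0 K \<eta> \<delta>) (max (n1 K Ar \<delta>) (n2 K Cm bm Ar)))"
  define \<theta> where "\<theta> = (\<lambda>K Ar (n::nat). A4 K Ar / ln (real n) powr (1 / 4))"
  have A5_pos: "0 < A5 K Ar \<delta>" if "0 < Ar" "\<delta> < 1" for K Ar \<delta>
    unfolding A5_def using that by (intro add_pos_nonneg mult_pos_pos) auto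
  show ?thesis
    apply (rule exI[of _ A3], rule exI[of _ A4], rule exI[of _ A5], rule exI[of _ n0], rule exI[of _ n0'])
    apply (intro allI impI, elim conjE)
    subgoal for K \<eta> \<delta> Ap Ar
      apply (intro conjI exI[of _ "\<theta> K Ar"])
      subgoal by (simp add: A3_def)
      subgoal by (simp add: A4_def)
      subgoal by (rule A5_pos)
      subgoal by (simp add: \<theta>_def)
      apply (intro allI impI, elim conjE)
      subgoal premises prems for \<Omega> n X Y \<epsilon> P s_star \<sigma> \<M> part sM sn pen Mhat Mstar
      proof -
        note \<eta> = \<open>0 < \<eta>\<close> and \<delta> = \<open>0 \<le> \<delta>\<close> \<open>\<delta> < 1\<close> and Ar = \<open>0 < Ar\<close>
        interpret SAPP \<Omega> n X Y \<epsilon> P s_star \<sigma> \<M> part sM sn K by fact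
        note c = constants_pos derived_consts_nonneg consts_nonneg
        have \<theta>: "(8 * err_const K + Ar) / L powr (1 / 4) = \<theta> K Ar n" using c by (simp add: \<theta>_def A4_def)
        have regime: "selection_regime K \<eta> \<delta> n" if "n0 K \<eta> \<delta> \<le> n"
          using that unfolding n0_def
          by (rule some_threshold[OF eventually_selection_regime[OF \<eta> \<delta>(2) constants_pos(6,8)]])
        have regime1: "penalty_regime K Ar \<delta> n" if "n1 K Ar \<delta> \<le> n"
          using that unfolding n1_def by (rule some_threshold[OF eventually_penalty_regime[OF \<delta>(2)]])
        have event: "with_prob_ge \<Omega> (1 - A3 (c_card K) Ap / (real n)\<^sup>2)
            (\<lambda>\<omega>. \<omega> \<in> space \<Omega> \<and> (\<forall>M\<in>\<M>. controlled \<omega> M) \<and> penalty_bounds \<delta> Ar (pen \<omega>))"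
          if "selection_regime K \<eta> \<delta> n"
          unfolding A3_def using that prems by (intro controlled_penalized_event) (auto simp: selection_regime_def)
        have argmin: "is_arg_min (\<lambda>M. emp_mean n X Y \<omega> (contrast (sn \<omega> M)) + pen \<omega> M) (\<lambda>M. M \<in> \<M>) (Mhat \<omega>)"
            "is_arg_min (\<lambda>M. excess_loss P s_star (sn \<omega> M)) (\<lambda>M. M \<in> \<M>) (Mstar \<omega>)"
          if "\<omega> \<in> space \<Omega>" for \<omega>
          using prems that by auto
        show ?thesis
          apply (intro conjI allI impI; (elim conjE)?)
          subgoal premises n
          proof (rule with_prob_ge_mono[OF event], goal_cases)
            case (2 \<omega>)
            note reg = regime[OF n]
            have L1: "1 \<le> L" and n1: "1 \<le> real n"
              using reg by (auto simp: selection_regime_def large_sample_def Let_def)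
            have \<omega>: "\<omega> \<in> space \<Omega>" "\<forall>M\<in>\<M>. controlled \<omega> M" "penalty_bounds \<delta> Ar (pen \<omega>)" using 2 by blast+
            note sel = selected_model[OF \<eta> \<delta> Ar reg \<omega>(2,3) argmin[OF \<omega>(1)], unfolded \<theta>]
            have A5: "4 / (1 - \<delta>) * (1 + 2 * var_const K + Ar) \<le> A5 K Ar \<delta>"
                "loss_const K * real (n1 K Ar \<delta>) \<le> A5 K Ar \<delta>" and l0: "0 \<le> loss_const K"
              using c \<delta> Ar by (auto simp: A5_def loss_const_def)
            have rate: "0 \<le> L ^ 3 / n" using L1 n1 by simp
            have "excess_loss P s_star (sn \<omega> (Mhat \<omega>))
              \<le> ((1 + \<delta>) / (1 - \<delta>) + 5 * \<theta> K Ar n / (1 - \<delta>)\<^sup>2) * excess_loss P s_star (sn \<omega> (Mstar \<omega>))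
                 + A5 K Ar \<delta> * (L ^ 3 / n)"
            proof (cases "n1 K Ar \<delta> \<le> n")
              case True
              from mult_right_mono[OF A5(1) rate] sel(4)[OF regime1[OF True]]
              show ?thesis unfolding mult.assoc by linarith
            next
              \<comment> \<open>Here \<open>n\<close> is below the threshold \<open>n1\<close>, so
                \<open>n1 * L^3 / n \<ge> 1\<close> and the remainder alone exceeds
                \<open>loss_const K\<close>, hence the loss.\<close>
              case False
              have "1 \<le> real (n1 K Ar \<delta>) / n * 1" using False n1 by simp
              also have "\<dots> \<le> real (n1 K Ar \<delta>) / n * L ^ 3"
                using one_le_power[OF L1, of 3] by (intro mult_left_mono) auto
              finally have "loss_const K * 1 \<le> loss_const K * (real (n1 K Ar \<delta>) * (L ^ 3 / n))"
                using l0 by (intro mult_left_mono) auto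
              also have "\<dots> \<le> A5 K Ar \<delta> * (L ^ 3 / n)"
                using mult_right_mono[OF A5(2) rate] by (simp only: mult.assoc)
              finally show ?thesis using sel(2,3) by simp
            qed
            then show ?case using sel(1) by simp
          qed (rule regime[OF n])
          subgoal premises ap for Cm bm
          proof (rule with_prob_ge_mono[OF event], goal_cases)
            case 1
            show ?case using ap by (intro regime) (simp add: n0'_def)
          next
            case (2 \<omega>)
            have n: "n0 K \<eta> \<delta> \<le> n" "n1 K Ar \<delta> \<le> n" "n2 K Cm bm Ar \<le> n" using ap by (auto simp: n0'_def)
            have \<omega>: "\<omega> \<in> space \<Omega>" "\<forall>M\<in>\<M>. controlled \<omega> M" "penalty_bounds \<delta> Ar (pen \<omega>)" using 2 by blast+
            note sel = selected_model[OF \<eta> \<delta> Ar regime[OF n(1)] \<omega>(2,3) argmin[OF \<omega>(1)], unfolded \<theta>]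
            have "bias_regime K Cm bm Ar n"
              using n(3) unfolding n2_def
              by (rule some_threshold[OF eventually_bias_regime[OF constants_pos(6,3) \<open>0 < Cm\<close>]])
            moreover have "0 \<le> bm" "\<forall>M\<in>\<M>. Cm * model_dim M powr (- bm) \<le> bias M" using ap c by auto
            ultimately show ?case using sel(1) sel(5)[OF regime1[OF n(2)] _ \<open>0 < Cm\<close>] by blast
          qed
          done
      qed
      done
    done
qed

end
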